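(* For every tentative velocity $w_h\in X_h^p$, the projected velocity $\mathcal{P}_h^{\mathrm{RT}}w_h\in X_h^p$ satisfies the discrete continuity equation exactly, i.e. $$b(\mathcal{P}_h^{\mathrm{RT}}w_h,q)=r(q)\qquad\text{for all } q\in M_h^{p-1}.$$
   Context: **Domain and mesh.** $\Omega\subset\mathbb{R}^d$ ($d=2,3$) is open and bounded, with boundary $\partial\Omega=\Gamma_D\cup\Gamma_N$, $\Gamma_N=\partial\Omega\setminus\Gamma_D$. Either $\Gamma_D=\partial\Omega$ (Dirichlet case, $\Gamma_N=\emptyset$) or $\Gamma_D\ne\partial\Omega,\emptyset$ (mixed case). Velocity data $g$ are given on $\Gamma_D$ (at a fixed time); in the Dirichlet case $\int_{\partial\Omega}g\cdot n\,ds=0$ is required, $n$ being the outer unit normal. $\mathcal{E}_h$ is an affine cuboid mesh of $\Omega$: every element is $E=\mu_E(\hat E)$, with $\hat E$ the reference cube and $\mu_E(\hat x)=B_E\hat x+b_E$ an affine transformation (so elements are parallelepipeds). $\Gamma_h^{\mathrm{int}},\Gamma_h^D,\Gamma_h^N$ are the sets of interior faces, of faces on $\Gamma_D$, and of faces on $\Gamma_N$. Each interior face $e$ shared by $E_e^1,E_e^2$ has a fixed unit normal $n_e$ pointing from $E_e^1$ to $E_e^2$; for boundary faces $n_e=n$. On $e\in\Gamma_h^{\mathrm{int}}$: $[\phi]=\phi|_{E_e^1}-\phi|_{E_e^2}$ and $\{\phi\}=\tfrac12\phi|_{E_e^1}+\tfrac12\phi|_{E_e^2}$ (same for vector-valued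 $\phi$). On boundary faces functions are evaluated by their trace from the interior. $(\cdot,\cdot)_{0,\omega}$ is the $L^2(\omega)$ inner product (scalar or vector). Derivatives of discontinuous functions are taken elementwise. **Spaces.** Let $p\ge1$. $Q_h^p=\{v\in L^2(\Omega): v|_E=q\circ\mu_E^{-1},\ q\in\mathbb{Q}_{p,d},\ E\in\mathcal{E}_h\}$, where $\mathbb{Q}_{p,d}$ is the set of polynomials in $d$ variables of degree at most $p$ in each variable. $X_h^p=(Q_h^p)^d$. In the mixed case $M_h^{p-1}=Q_h^{p-1}$; in the Dirichlet case $M_h^{p-1}=\{q\in Q_h^{p-1}:\int_\Omega q\,dx=0\}$. **Forms.** $$b(v,q)=-\sum_{E\in\mathcal{E}_h}(\nabla\cdot v,q)_{0,E}+\sum_{e\in\Gamma_h^{\mathrm{int}}}([v]\cdot n_e,\{q\})_{0,e}+\sum_{e\in\Gamma_h^D}(v\cdot n,q)_{0,e},\qquad r(q)=\sum_{e\in\Gamma_h^D}(g\cdot n,q)_{0,e}.$$ $\alpha(\psi,q)=b(\nabla\psi,q)+j_0(\psi,q)$, where $\nabla\psi$ is the elementwise gradient and $$j_0(\psi,q)=-\sum_{e\in\Gamma_h^{\mathrm{int}}}(\{\nabla q\}\cdot n_e,[\psi])_{0,e}+\sum_{e\in\Gamma_h^{\mathrm{int}}}\frac{\sigma}{h_e}([q],[\psi])_{0,e}-\sum_{e\in\Gamma_h^N}(\nabla q\cdot n_e,\psi)_{0,e}+\sum_{e\in\Gamma_h^N}\frac{\sigma}{h_e}(q,\psi)_{0,e}.$$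 Here $h_e>0$ is a face length scale (the minimum of the volumes of the elements adjacent to $e$ divided by $|e|$) and $\sigma>0$ is a penalty parameter chosen such that $\alpha$ is coercive on $M_h^{p-1}$. **Raviart–Thomas spaces.** With the Piola transformation $T_E(\hat v)=\frac{1}{|\det B_E|}B_E\hat v$ (composed with $\mu_E^{-1}$), let $\mathrm{RT}_E^k$ be the set of $v=T_E(\hat v)$ whose component $\hat v_i$ is a polynomial of degree at most $k+\delta_{ij}$ in $\hat x_j$ ($j=1,\dots,d$), and, for $k>0$, let $\Psi_E^k$ be the set of $v=T_E(\hat v)$ with $\hat v_i$ of degree at most $k-\delta_{ij}$ in $\hat x_j$. $\mathrm{RT}_h^k=\{v\in H(\mathrm{div};\Omega): v|_E\in\mathrm{RT}_E^k\ \forall E\in\mathcal{E}_h\}$. $Q_e^k$ is the space of polynomials on the face $e$ of degree at most $k$ in each of the $d-1$ (affine) face coordinates. **Reconstruction.** For $\psi_h\in M_h^{p-1}$ and $k=p-1$, $\gamma_h=G_h\psi_h\in\mathrm{RT}_h^{k}$ is defined by: for all faces $e$ and all $q\in Q_e^k$, - $(\gamma_h\cdot n_e,q)_{0,e}=(-\{\nabla\psi_h\}\cdot n_e+\frac{\sigma}{h_e}[\psi_h],q)_{0,e}$ if $e\in\Gamma_h^{\mathrm{int}}$, - $(\gamma_h\cdot n_e,q)_{0,e}=(-\nabla\psi_h\cdot n_e+\frac{\sigma}{h_e}\psi_h,q)_{0,e}$ if $e\in\Gamma_h^N$, - $(\gamma_h\cdot n_e,q)_{0,e}=0$ if $e\in\Gamma_h^D$,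 and, if $k>0$, for all $E\in\mathcal{E}_h$ and $r\in\Psi_E^k$, $$(\gamma_h,r)_{0,E}=-(\nabla\psi_h,r)_{0,E}+\tfrac12\sum_{e\in\partial E\cap\Gamma_h^{\mathrm{int}}}(r\cdot n_e,[\psi_h])_{0,e}+\sum_{e\in\partial E\cap\Gamma_h^N}(r\cdot n_e,\psi_h)_{0,e}.$$ **RT projection.** For $w_h\in X_h^p$: (i) let $\psi_h\in M_h^{p-1}$ solve $\alpha(\psi_h,q)=b(w_h,q)-r(q)$ for all $q\in M_h^{p-1}$; (ii) set $\gamma_h=G_h\psi_h\in\mathrm{RT}_h^{p-1}$; (iii) $\mathcal{P}_h^{\mathrm{RT}}w_h:=v_h\in X_h^p$, where $(v_h,\varphi)_{0,\Omega}=(w_h,\varphi)_{0,\Omega}+(G_h\psi_h,\varphi)_{0,\Omega}$ for all $\varphi\in X_h^p$.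
   Formalization: For p ≥ 2 the elements are assumed to be rectangular boxes (pairwise orthogonal edges, any rotation and size), because with Ψ_E^k defined by the Piola transformation the claim fails on skew parallelepipeds; for p = 1 all affine parallelepipeds are covered. *)

theory Defs
  imports "HOL-Analysis.Analysis"
begin

section \<open>Problem data\<close>

text \<open>
  The mesh is a finite set of closed elements. An element \<open>E\<close> comes with the matrix \<open>Bmat E\<close> and the
  vector \<open>bvec E\<close> of its affine map. \<open>side1 e\<close> and \<open>side2 e\<close> are the two elements at an interior face
  \<open>e\<close> (the fixed normal of \<open>e\<close> points from the first to the second); on a boundary face, \<open>side1 e\<close> is
  the adjacent element and \<open>side2 e\<close> is irrelevant.
\<close>

record ('d::finite) dg_data =
  omega :: "(real^'d) set"
  gamD  :: "(real^'d) set"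
  elems :: "(real^'d) set set"
  Bmat  :: "(real^'d) set \<Rightarrow> real^'d^'d"
  bvec  :: "(real^'d) set \<Rightarrow> real^'d"
  side1 :: "(real^'d) set \<Rightarrow> (real^'d) set"
  side2 :: "(real^'d) set \<Rightarrow> (real^'d) set"
  gdat  :: "real^'d \<Rightarrow> real^'d"
  penalty :: real

definition gamN :: "('d::finite) dg_data \<Rightarrow> (real^'d) set" where
  "gamN T = frontier (omega T) - gamD T"

definition ref_cube :: "(real^'d::finite) set" where
  "ref_cube = {x. \<forall>i. 0 \<le> x $ i \<and> x $ i \<le> 1}"

definition mu :: "('d::finite) dg_data \<Rightarrow> (real^'d) set \<Rightarrow> real^'d \<Rightarrow> real^'d" where
  "mu T E x = Bmat T E *v x + bvec T E"

definition faces :: "('d::finite) dg_data \<Rightarrow> (real^'d) set set" where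
  "faces T = {e. \<exists>E\<in>elems T. e facet_of E}"

definition int_faces :: "('d::finite) dg_data \<Rightarrow> (real^'d) set set" where
  "int_faces T = {e. \<exists>E\<in>elems T. \<exists>F\<in>elems T. E \<noteq> F \<and> e facet_of E \<and> e facet_of F}"

text \<open>
  Relative interiors are used because the edges of a Neumann face may belong to the Dirichlet part.
\<close>

definition dir_faces :: "('d::finite) dg_data \<Rightarrow> (real^'d) set set" where
  "dir_faces T = {e \<in> faces T. rel_interior e \<subseteq> gamD T}"

definition neu_faces :: "('d::finite) dg_data \<Rightarrow> (real^'d) set set" where
  "neu_faces T = {e \<in> faces T. rel_interior e \<subseteq> gamN T}"

text \<open>
  The condition on \<open>interior (closure (omega T))\<close> says that the domain lies locally on one side of its
  boundary (no slits), which is needed for the outer normal to make sense. Conformity makes the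
  elements have disjoint interiors.
\<close>

definition affine_cuboid_mesh :: "('d::finite) dg_data \<Rightarrow> bool" where
  "affine_cuboid_mesh T \<longleftrightarrow>
     open (omega T) \<and> bounded (omega T) \<and> interior (closure (omega T)) = omega T \<and>
     gamD T \<subseteq> frontier (omega T) \<and> gamD T \<noteq> {} \<and>
     finite (elems T) \<and> \<Union>(elems T) = closure (omega T) \<and>
     (\<forall>E\<in>elems T. det (Bmat T E) \<noteq> 0 \<and> E = mu T E ` ref_cube) \<and>
     (\<forall>E\<in>elems T. \<forall>F\<in>elems T. (E \<inter> F) face_of E \<and> (E \<inter> F) face_of F) \<and>
     (\<forall>e\<in>faces T. e \<subseteq> frontier (omega T) \<longrightarrow> e \<in> dir_faces T \<or> e \<in> neu_faces T) \<and>
     (\<forall>e\<in>faces T. side1 T e \<in> elems T \<and> e facet_of side1 T e) \<and>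
     (\<forall>e\<in>int_faces T. side2 T e \<in> elems T \<and> e facet_of side2 T e \<and> side1 T e \<noteq> side2 T e)"


section \<open>Integration over flat faces\<close>

text \<open>
  The (\<open>d-1\<close>)-dimensional Lebesgue measure on a flat face \<open>e\<close>, lying in a hyperplane: the measure of a
  subset of \<open>e\<close> is the volume of the slab of unit thickness over it. Here \<open>closest_point\<close> is the
  orthogonal projection onto that hyperplane.
\<close>

definition slab :: "(real^'d::finite) set \<Rightarrow> (real^'d) set" where
  "slab e = {y. closest_point (affine hull e) y \<in> e \<and>
                dist y (closest_point (affine hull e) y) \<le> 1/2}"

definition face_measure :: "(real^'d::finite) set \<Rightarrow> (real^'d) measure" where
  "face_measure e =
     distr (restrict_space lborel (slab e)) (restrict_space borel e) (closest_point (affine hull e))"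

definition face_area :: "(real^'d::finite) set \<Rightarrow> real" where
  "face_area e = measure (face_measure e) e"

definition outer_normal :: "(real^'d::finite) set \<Rightarrow> (real^'d) set \<Rightarrow> real^'d" where
  "outer_normal E e = (THE n. norm n = 1 \<and> (\<forall>x\<in>e. \<forall>y\<in>E. (y - x) \<bullet> n \<le> 0))"

definition nrm :: "('d::finite) dg_data \<Rightarrow> (real^'d) set \<Rightarrow> real^'d" where
  "nrm T e = outer_normal (side1 T e) e"

definition hface :: "('d::finite) dg_data \<Rightarrow> (real^'d) set \<Rightarrow> real" where
  "hface T e = Min {measure lebesgue E | E. E \<in> elems T \<and> e facet_of E} / face_area e"


section \<open>Traces and elementwise derivatives\<close>

text \<open>
  Discontinuous functions are functions on the whole space whose values on the mesh skeleton (a null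
  set) are irrelevant. Their derivatives are used in the interiors of the elements, their traces are
  limits from there.
\<close>

definition elt_trace :: "(real^'d::finite) set \<Rightarrow> (real^'d \<Rightarrow> 'b::t2_space) \<Rightarrow> real^'d \<Rightarrow> 'b" where
  "elt_trace E f x = Lim (at x within interior E) f"

definition btrace :: "('d::finite) dg_data \<Rightarrow> (real^'d) set \<Rightarrow>
    (real^'d \<Rightarrow> 'b::real_normed_vector) \<Rightarrow> real^'d \<Rightarrow> 'b" where
  "btrace T e f = elt_trace (side1 T e) f"

definition jump :: "('d::finite) dg_data \<Rightarrow> (real^'d) set \<Rightarrow>
    (real^'d \<Rightarrow> 'b::real_normed_vector) \<Rightarrow> real^'d \<Rightarrow> 'b" where
  "jump T e f x = elt_trace (side1 T e) f x - elt_trace (side2 T e) f x"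

definition avg :: "('d::finite) dg_data \<Rightarrow> (real^'d) set \<Rightarrow>
    (real^'d \<Rightarrow> 'b::real_normed_vector) \<Rightarrow> real^'d \<Rightarrow> 'b" where
  "avg T e f x = (1/2) *\<^sub>R elt_trace (side1 T e) f x + (1/2) *\<^sub>R elt_trace (side2 T e) f x"

definition grad :: "(real^'d::finite \<Rightarrow> real) \<Rightarrow> real^'d \<Rightarrow> real^'d" where
  "grad f x = (\<chi> i. frechet_derivative f (at x) (axis i 1))"

definition dvg :: "(real^'d::finite \<Rightarrow> real^'d) \<Rightarrow> real^'d \<Rightarrow> real" where
  "dvg v x = (\<Sum>i\<in>UNIV. frechet_derivative v (at x) (axis i 1) $ i)"


section \<open>Function spaces\<close>

definition L2 :: "(real^'d::finite) set \<Rightarrow> (real^'d \<Rightarrow> 'b::euclidean_space) set" where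
  "L2 S = {f. f \<in> borel_measurable (lebesgue_on S) \<and>
              integrable (lebesgue_on S) (\<lambda>x. (norm (f x))\<^sup>2)}"

text \<open>Polynomials of degree at most \<open>m j\<close> in the variable \<open>x\<^sub>j\<close>, for each \<open>j\<close>.\<close>

definition polys :: "('d::finite \<Rightarrow> nat) \<Rightarrow> (real^'d \<Rightarrow> real) set" where
  "polys m = {q. \<exists>c :: ('d \<Rightarrow> nat) \<Rightarrow> real.
                 \<forall>x. q x = (\<Sum>a\<in>{a. \<forall>j. a j \<le> m j}. c a * (\<Prod>j\<in>UNIV. (x $ j) ^ a j))}"

definition Qh :: "('d::finite) dg_data \<Rightarrow> nat \<Rightarrow> (real^'d \<Rightarrow> real) set" where
  "Qh T p = {v \<in> L2 (omega T). \<forall>E\<in>elems T. \<exists>q\<in>polys (\<lambda>_. p).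
                 \<forall>x\<in>interior E. v x = (q \<circ> inv (mu T E)) x}"

definition Xh :: "('d::finite) dg_data \<Rightarrow> nat \<Rightarrow> (real^'d \<Rightarrow> real^'d) set" where
  "Xh T p = {v. \<forall>i. (\<lambda>x. v x $ i) \<in> Qh T p}"

definition Mh :: "('d::finite) dg_data \<Rightarrow> nat \<Rightarrow> (real^'d \<Rightarrow> real) set" where
  "Mh T k = (if gamD T = frontier (omega T)
             then {q \<in> Qh T k. (LINT x:omega T|lebesgue. q x) = 0}
             else Qh T k)"

primrec Cdiff :: "nat \<Rightarrow> (real^'d::finite \<Rightarrow> real) \<Rightarrow> bool" where
  "Cdiff 0 f \<longleftrightarrow> continuous_on UNIV f"
| "Cdiff (Suc n) f \<longleftrightarrow> f differentiable_on UNIV \<and> (\<forall>i. Cdiff n (\<lambda>x. grad f x $ i))"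

definition test_funs :: "(real^'d::finite) set \<Rightarrow> (real^'d \<Rightarrow> real) set" where
  "test_funs S = {\<phi>. (\<forall>n. Cdiff n \<phi>) \<and>
                     (\<exists>K. compact K \<and> K \<subseteq> S \<and> (\<forall>x. x \<notin> K \<longrightarrow> \<phi> x = 0))}"

definition Hdiv :: "(real^'d::finite) set \<Rightarrow> (real^'d \<Rightarrow> real^'d) set" where
  "Hdiv S = {v \<in> L2 S. \<exists>f\<in>L2 S. \<forall>\<phi>\<in>test_funs S.
                (LINT x:S|lebesgue. v x \<bullet> grad \<phi> x) = - (LINT x:S|lebesgue. f x * \<phi> x)}"

definition piola :: "('d::finite) dg_data \<Rightarrow> (real^'d) set \<Rightarrow> (real^'d \<Rightarrow> real^'d) \<Rightarrow>
    real^'d \<Rightarrow> real^'d" where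
  "piola T E vh x = (1 / \<bar>det (Bmat T E)\<bar>) *\<^sub>R (Bmat T E *v vh (inv (mu T E) x))"

definition RT_loc :: "('d::finite) dg_data \<Rightarrow> nat \<Rightarrow> (real^'d) set \<Rightarrow> (real^'d \<Rightarrow> real^'d) set" where
  "RT_loc T k E = {piola T E vh | vh.
      \<forall>i. (\<lambda>x. vh x $ i) \<in> polys (\<lambda>j. k + (if i = j then 1 else 0))}"

text \<open>Only used for \<open>k > 0\<close>.\<close>

definition Psi_loc :: "('d::finite) dg_data \<Rightarrow> nat \<Rightarrow> (real^'d) set \<Rightarrow> (real^'d \<Rightarrow> real^'d) set" where
  "Psi_loc T k E = {piola T E vh | vh.
      \<forall>i. (\<lambda>x. vh x $ i) \<in> polys (\<lambda>j. k - (if i = j then 1 else 0))}"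

definition RTh :: "('d::finite) dg_data \<Rightarrow> nat \<Rightarrow> (real^'d \<Rightarrow> real^'d) set" where
  "RTh T k = {v \<in> Hdiv (omega T). \<forall>E\<in>elems T. \<exists>u\<in>RT_loc T k E. \<forall>x\<in>interior E. v x = u x}"

text \<open>
  A face is the image of some \<open>{x \<in> ref_cube. x\<^sub>i = s}\<close> with \<open>s \<in> {0,1}\<close>, and its coordinates are the
  \<open>x\<^sub>j\<close> with \<open>j \<noteq> i\<close>. For an interior face, both adjacent elements give the same space because the two
  parametrisations differ by an affine symmetry of the unit cube of dimension \<open>d-1\<close>.
\<close>

definition ref_face :: "'d::finite \<Rightarrow> real \<Rightarrow> (real^'d) set" where
  "ref_face i s = {x \<in> ref_cube. x $ i = s}"

definition Qface :: "('d::finite) dg_data \<Rightarrow> nat \<Rightarrow> (real^'d) set \<Rightarrow> (real^'d \<Rightarrow> real) set" where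
  "Qface T k e = {q. \<exists>E\<in>elems T. \<exists>i. \<exists>s\<in>{0,1}. e = mu T E ` ref_face i s \<and>
      (\<exists>P\<in>polys (\<lambda>j. if j = i then 0 else k). \<forall>x\<in>ref_face i s. q (mu T E x) = P x)}"


section \<open>Forms\<close>

definition bform :: "('d::finite) dg_data \<Rightarrow> (real^'d \<Rightarrow> real^'d) \<Rightarrow> (real^'d \<Rightarrow> real) \<Rightarrow> real" where
  "bform T v q =
     - (\<Sum>E\<in>elems T. LINT x:E|lebesgue. dvg v x * q x)
     + (\<Sum>e\<in>int_faces T. LINT x|face_measure e. (jump T e v x \<bullet> nrm T e) * avg T e q x)
     + (\<Sum>e\<in>dir_faces T. LINT x|face_measure e. (btrace T e v x \<bullet> nrm T e) * btrace T e q x)"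

definition rform :: "('d::finite) dg_data \<Rightarrow> (real^'d \<Rightarrow> real) \<Rightarrow> real" where
  "rform T q =
     (\<Sum>e\<in>dir_faces T. LINT x|face_measure e. (gdat T x \<bullet> nrm T e) * btrace T e q x)"

definition j0form :: "('d::finite) dg_data \<Rightarrow> (real^'d \<Rightarrow> real) \<Rightarrow> (real^'d \<Rightarrow> real) \<Rightarrow> real" where
  "j0form T \<psi> q =
     - (\<Sum>e\<in>int_faces T. LINT x|face_measure e. (avg T e (grad q) x \<bullet> nrm T e) * jump T e \<psi> x)
     + (\<Sum>e\<in>int_faces T. penalty T / hface T e *
          (LINT x|face_measure e. jump T e q x * jump T e \<psi> x))
     - (\<Sum>e\<in>neu_faces T. LINT x|face_measure e. (btrace T e (grad q) x \<bullet> nrm T e) * btrace T e \<psi> x)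
     + (\<Sum>e\<in>neu_faces T. penalty T / hface T e *
          (LINT x|face_measure e. btrace T e q x * btrace T e \<psi> x))"

definition alpha :: "('d::finite) dg_data \<Rightarrow> (real^'d \<Rightarrow> real) \<Rightarrow> (real^'d \<Rightarrow> real) \<Rightarrow> real" where
  "alpha T \<psi> q = bform T (grad \<psi>) q + j0form T \<psi> q"

text \<open>
  The space is finite dimensional (modulo null sets), so coercivity does not depend on the choice of
  the norm.
\<close>

definition coercive :: "('d::finite) dg_data \<Rightarrow> nat \<Rightarrow> bool" where
  "coercive T k \<longleftrightarrow>
     (\<exists>c>0. \<forall>q\<in>Mh T k. alpha T q q \<ge> c * (LINT x:omega T|lebesgue. (q x)\<^sup>2))"

definition admissible_data :: "('d::finite) dg_data \<Rightarrow> bool" where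
  "admissible_data T \<longleftrightarrow>
     (\<forall>e\<in>dir_faces T. integrable (face_measure e) (gdat T)) \<and>
     (gamD T = frontier (omega T) \<longrightarrow>
        (\<Sum>e\<in>dir_faces T. LINT x|face_measure e. gdat T x \<bullet> nrm T e) = 0)"


section \<open>Reconstruction and projection\<close>

text \<open>
  \<open>is_Gh T k \<psi> \<gamma>\<close> says that \<open>\<gamma>\<close> is the reconstruction of \<open>\<psi>\<close>. A function in \<open>Hdiv\<close> with piecewise
  polynomial values has a single-valued normal component on interior faces, which is written here as
  the mean of the two one-sided values.
\<close>

definition is_Gh :: "('d::finite) dg_data \<Rightarrow> nat \<Rightarrow> (real^'d \<Rightarrow> real) \<Rightarrow> (real^'d \<Rightarrow> real^'d) \<Rightarrow> bool"
  where
  "is_Gh T k \<psi> \<gamma> \<longleftrightarrow> \<gamma> \<in> RTh T k \<and>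
     (\<forall>e\<in>int_faces T. \<forall>q\<in>Qface T k e.
        (LINT x|face_measure e. (avg T e \<gamma> x \<bullet> nrm T e) * q x) =
        (LINT x|face_measure e.
           (- (avg T e (grad \<psi>) x \<bullet> nrm T e) + penalty T / hface T e * jump T e \<psi> x) * q x)) \<and>
     (\<forall>e\<in>neu_faces T. \<forall>q\<in>Qface T k e.
        (LINT x|face_measure e. (btrace T e \<gamma> x \<bullet> nrm T e) * q x) =
        (LINT x|face_measure e.
           (- (btrace T e (grad \<psi>) x \<bullet> nrm T e) + penalty T / hface T e * btrace T e \<psi> x) * q x)) \<and>
     (\<forall>e\<in>dir_faces T. \<forall>q\<in>Qface T k e.
        (LINT x|face_measure e. (btrace T e \<gamma> x \<bullet> nrm T e) * q x) = 0) \<and>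
     (k > 0 \<longrightarrow> (\<forall>E\<in>elems T. \<forall>r\<in>Psi_loc T k E.
        (LINT x:E|lebesgue. \<gamma> x \<bullet> r x) =
        - (LINT x:E|lebesgue. grad \<psi> x \<bullet> r x)
        + (1/2) * (\<Sum>e\<in>{e\<in>int_faces T. e facet_of E}.
                     LINT x|face_measure e. (r x \<bullet> nrm T e) * jump T e \<psi> x)
        + (\<Sum>e\<in>{e\<in>neu_faces T. e facet_of E}.
             LINT x|face_measure e. (r x \<bullet> nrm T e) * btrace T e \<psi> x)))"

text \<open>\<open>is_RT_projection T p w v\<close> says that \<open>v\<close> is the Raviart--Thomas projection of \<open>w\<close>.\<close>

definition is_RT_projection :: "('d::finite) dg_data \<Rightarrow> nat \<Rightarrow> (real^'d \<Rightarrow> real^'d) \<Rightarrow>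
    (real^'d \<Rightarrow> real^'d) \<Rightarrow> bool" where
  "is_RT_projection T p w v \<longleftrightarrow>
     (\<exists>\<psi>\<in>Mh T (p - 1). (\<forall>q\<in>Mh T (p - 1). alpha T \<psi> q = bform T w q - rform T q) \<and>
       (\<exists>\<gamma>. is_Gh T (p - 1) \<psi> \<gamma> \<and> v \<in> Xh T p \<and>
          (\<forall>\<phi>\<in>Xh T p. (LINT x:omega T|lebesgue. v x \<bullet> \<phi> x) =
             (LINT x:omega T|lebesgue. w x \<bullet> \<phi> x) + (LINT x:omega T|lebesgue. \<gamma> x \<bullet> \<phi> x))))"

text \<open>
  The elements are (possibly rotated) rectangular boxes: the edge vectors of each element, i.e. the
  columns of its matrix, are pairwise orthogonal. For \<open>k > 0\<close>, this is what makes the gradients of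
  functions in \<open>Qh T k\<close> belong to \<open>Psi_loc T k E\<close> on \<open>E\<close>; on skew elements, some of them do not, since
  \<open>Psi_loc\<close> uses the (contravariant) Piola transformation.
\<close>

definition rectangular :: "('d::finite) dg_data \<Rightarrow> bool" where
  "rectangular T \<longleftrightarrow>
     (\<forall>E\<in>elems T. \<forall>i j. i \<noteq> j \<longrightarrow> column i (Bmat T E) \<bullet> column j (Bmat T E) = 0)"

end

theory Submission
  imports Defs
begin

text \<open>
  The projection corrects the tentative velocity \<open>w\<close> by the reconstruction \<open>\<gamma>\<close> of \<open>\<psi>\<close>. On an
  element, the components of \<open>\<gamma>\<close> are polynomials of degree at most \<open>p\<close> in each reference coordinate,
  so the \<open>L\<^sup>2\<close> projection does not change them and \<open>v = w + \<gamma>\<close> inside every element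
  (\<open>projection_pieces\<close>). Hence \<open>b(v, q) = b(w, q) + b(\<gamma>, q)\<close> (\<open>bform_add\<close>), and since \<open>\<psi>\<close> solves
  \<open>\<alpha>(\<psi>, q) = b(w, q) - r(q)\<close>, the claim is equivalent to \<open>b(\<gamma>, q) = - \<alpha>(\<psi>, q)\<close>
  (\<open>bform_reconstruction\<close>).

  Integrating by parts on each element (\<open>bform_by_parts\<close>), \<open>b(\<gamma>, q)\<close> becomes the sum of \<open>(\<gamma>, grad q)\<close>
  over the elements, minus \<open>({\<gamma>} \<bullet> n, [q])\<close> over the interior faces, minus \<open>(\<gamma> \<bullet> n, q)\<close> over the
  Neumann faces. All of these are moments that the reconstruction prescribes. On the faces, the traces
  of \<open>q\<close> belong to the face space (\<open>piece_in_Qface\<close>). On the elements, \<open>grad q\<close> belongs to \<open>Psi_loc\<close>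
  because the elements are rectangular (\<open>grad_piece_in_Psi\<close>), or vanishes if \<open>q\<close> is piecewise constant.
  The prescribed values are those for \<open>- grad \<psi>\<close>, which reassemble to \<open>- b(grad \<psi>, q)\<close>, plus terms in
  the jumps and boundary values of \<open>\<psi>\<close>, which are exactly \<open>- j\<^sub>0(\<psi>, q)\<close>.

  Two geometric facts underlie the integration by parts. The first is the Gauss theorem on a
  parallelepiped (\<open>gauss\<close>), where a face carries the volume of the slab over it. Element and slab are
  affine images of the unit cube, and Cramer's rule relates their determinants (\<open>face_integral\<close>); on
  the cube itself, Fubini's theorem and the fundamental theorem of calculus apply (\<open>gauss_ref_cube\<close>).
  The second is that an interior face of a conforming mesh has exactly two elements, with opposite
  normals, and that every other face is either a Dirichlet or a Neumann face (\<open>opposite_normals\<close>,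
  \<open>elements_at_int_face\<close>, \<open>faces_partition\<close>), so that fluxes through element boundaries can be
  collected face by face (\<open>sum_all_faces\<close>).
\<close>

section \<open>Lebesgue measure, one coordinate at a time\<close>

definition set_coord :: "'d::finite \<Rightarrow> real \<Rightarrow> real^'d \<Rightarrow> real^'d" where
  "set_coord i s y = (\<chi> j. if j = i then s else y $ j)"

lemma set_coord_nth [simp]: "set_coord i s y $ j = (if j = i then s else y $ j)"
  by (simp add: set_coord_def)

lemma set_coord_simps [simp]: "set_coord i (y $ i) y = y" "set_coord i s (set_coord i t y) = set_coord i s y"
  by (simp_all add: vec_eq_iff)

lemma set_coord_eq_add: "set_coord i s y = y + (s - y $ i) *\<^sub>R axis i 1"
  by (auto simp: vec_eq_iff axis_def)

lemma continuous_on_set_coord [continuous_intros]: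
  assumes "continuous_on S f" "continuous_on S g"
  shows "continuous_on S (\<lambda>x. set_coord i (f x) (g x))"
  unfolding set_coord_eq_add by (intro continuous_intros assms)

lemma measurable_set_coord [measurable]: "(\<lambda>(y, t). set_coord i t y) \<in> borel_measurable (borel \<Otimes>\<^sub>M borel)"
  unfolding borel_prod split_def by (intro borel_measurable_continuous_onI continuous_intros)

lemma open_coordinate_strip: "open {y::real^'d::finite. 0 < y $ i \<and> y $ i < 1}"
  by (intro open_Collect_conj open_Collect_less continuous_intros)

lemma Basis_cart: "(Basis :: (real^'d::finite) set) = (\<lambda>i. axis i 1) ` UNIV"
  by (auto simp: Basis_vec_def)

lemma inj_axis: "inj (\<lambda>i::'d::finite. axis i (1::real))"
  by (auto simp: inj_on_def axis_eq_axis)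

lemma prod_Basis_cart: "(\<Prod>b\<in>Basis. f b) = (\<Prod>i\<in>UNIV. f (axis i (1::real) :: real^'d::finite))"
  by (subst Basis_cart, subst prod.reindex[OF inj_axis]) simp

lemma sum_Basis_cart: "(\<Sum>b\<in>Basis. f b) = (\<Sum>i\<in>UNIV. f (axis i (1::real) :: real^'d::finite))"
  by (subst Basis_cart, subst sum.reindex[OF inj_axis]) simp

text \<open>
  The open unit strip stands in for a coordinate hyperplane with its lower-dimensional Lebesgue
  measure: a function that ignores the coordinate \<open>i\<close> has the same integral over
  both.
\<close>

definition strip :: "'d::finite \<Rightarrow> (real^'d) measure" where
  "strip i = density lborel (indicator {y. 0 < y $ i \<and> y $ i < 1})"

lemma sets_strip [simp, measurable_cong]: "sets (strip i) = sets borel"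
  by (simp add: strip_def)

lemma measurable_coordinate_strip [measurable]: "{y::real^'d::finite. 0 < y $ i \<and> y $ i < 1} \<in> sets borel"
  by (intro borel_open open_coordinate_strip)

lemma sigma_finite_strip: "sigma_finite_measure (strip i)"
  unfolding strip_def by (subst sigma_finite_measure.sigma_finite_iff_density_finite[OF sigma_finite_lborel]) (auto simp: indicator_def)

text \<open>
  Fubini with one coordinate singled out. Both measures give a box the product of its side
  lengths: the variable \<open>t\<close> contributes the side in direction \<open>i\<close>,
  where the strip only contributes \<open>1\<close>.
\<close>

lemma lborel_coordinate_strip:
  fixes i :: "'d::finite"
  shows "(lborel :: (real^'d) measure) = distr (strip i \<Otimes>\<^sub>M lborel) borel (\<lambda>(y, t). set_coord i t y)"
proof (rule lborel_eqI)
  fix l u :: "real^'d"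
  assume lu: "\<And>b. b \<in> Basis \<Longrightarrow> l \<bullet> b \<le> u \<bullet> b"
  have le: "l $ j \<le> u $ j" for j using lu[of "axis j 1"] by (auto simp: inner_axis Basis_cart)
  interpret strip: sigma_finite_measure "strip i" by (rule sigma_finite_strip)
  \<comment> \<open>the part of the strip over the box is a box, with side \<open>(0,1)\<close> in direction \<open>i\<close>\<close>
  define l' u' where "l' = set_coord i 0 l" and "u' = set_coord i 1 u"
  have vimage: "(\<lambda>(y, t). set_coord i t y) -` box l u \<inter> space (strip i \<Otimes>\<^sub>M lborel)
    = {y. \<forall>j. j \<noteq> i \<longrightarrow> l $ j < y $ j \<and> y $ j < u $ j} \<times> {l $ i<..<u $ i}" (is "_ = ?A \<times> _")
    by (auto simp: space_pair_measure strip_def mem_box_cart split: if_splits)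
  have [measurable]: "?A \<in> sets borel"
    by measurable
  have le': "l' \<bullet> b \<le> u' \<bullet> b" if "b \<in> Basis" for b
    using le that by (auto simp: Basis_cart inner_axis l'_def u'_def)
  have "emeasure (strip i) ?A = emeasure lborel (box l' u')"
    unfolding strip_def
    by (subst emeasure_density, simp, simp, subst nn_integral_indicator[symmetric], simp, intro nn_integral_cong)
      (auto simp: indicator_def l'_def u'_def mem_box_cart split: if_splits)
  also have "\<dots> = (\<Prod>j\<in>UNIV. (u' - l') $ j)"
    by (subst emeasure_lborel_box[OF le']) (simp_all add: prod_Basis_cart inner_axis)
  also have "\<dots> = (\<Prod>j\<in>UNIV - {i}. (u - l) $ j)"
    by (subst prod.remove[of _ i]) (auto simp: l'_def u'_def intro!: prod.cong)
  finally have A: "emeasure (strip i) ?A = (\<Prod>j\<in>UNIV - {i}. (u - l) $ j)" .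
  have "emeasure (distr (strip i \<Otimes>\<^sub>M lborel) borel (\<lambda>(y, t). set_coord i t y)) (box l u)
    = emeasure (strip i) ?A * emeasure lborel {l $ i<..<u $ i}"
    by (subst emeasure_distr, simp, simp)
      (subst vimage, rule lborel.emeasure_pair_measure_Times, auto)
  also have "\<dots> = ennreal ((\<Prod>j\<in>UNIV - {i}. (u - l) $ j) * (u $ i - l $ i))"
    using le by (simp add: A ennreal_mult prod_nonneg)
  also have "(\<Prod>j\<in>UNIV - {i}. (u - l) $ j) * (u $ i - l $ i) = (\<Prod>j\<in>UNIV. (u - l) $ j)"
    by (subst (2) prod.remove[of _ i]) auto
  finally show "emeasure (distr (strip i \<Otimes>\<^sub>M lborel) borel (\<lambda>(y, t). set_coord i t y)) (box l u)
    = (\<Prod>b\<in>Basis. (u - l) \<bullet> b)"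
    by (simp add: prod_Basis_cart inner_axis)
qed simp

lemma nn_integral_coordinate_strip:
  fixes h :: "real^'d::finite \<Rightarrow> ennreal"
  assumes [measurable]: "h \<in> borel_measurable borel"
  shows "(\<integral>\<^sup>+y. h y \<partial>lborel) = (\<integral>\<^sup>+y. \<integral>\<^sup>+t. h (set_coord i t y) \<partial>lborel \<partial>strip i)"
proof -
  have "(\<integral>\<^sup>+y. h y \<partial>lborel) = (\<integral>\<^sup>+p. h (set_coord i (snd p) (fst p)) \<partial>(strip i \<Otimes>\<^sub>M lborel))"
    by (subst lborel_coordinate_strip[of i], subst nn_integral_distr) (auto simp: split_beta)
  also have "\<dots> = (\<integral>\<^sup>+y. \<integral>\<^sup>+t. h (set_coord i t y) \<partial>lborel \<partial>strip i)"
    by (subst lborel.nn_integral_fst[symmetric]) auto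
  finally show ?thesis .
qed

lemma integral_coordinate_strip:
  fixes h :: "real^'d::finite \<Rightarrow> real"
  assumes "integrable lborel h"
  shows "(LINT y|lborel. h y) = (LINT y|strip i. LINT t|lborel. h (set_coord i t y))"
proof -
  interpret strip: sigma_finite_measure "strip i" by (rule sigma_finite_strip)
  interpret pair_sigma_finite "strip i" "lborel :: real measure" ..
  have [measurable]: "h \<in> borel_measurable borel"
    using assms by (auto dest: borel_measurable_integrable)
  have "integrable (strip i \<Otimes>\<^sub>M lborel) (\<lambda>(y, t). h (set_coord i t y))"
    using assms by (subst (asm) lborel_coordinate_strip[of i], subst (asm) integrable_distr_eq) (auto simp: case_prod_unfold)
  from integral_fst[OF this] show ?thesis
    by (subst lborel_coordinate_strip[of i], subst integral_distr) (auto simp: case_prod_unfold)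
qed

section \<open>Linear changes of variables\<close>

definition scales_volume :: "(real^'d::finite \<Rightarrow> real^'d) \<Rightarrow> real \<Rightarrow> bool" where
  "scales_volume f c \<longleftrightarrow> (\<forall>h::real^'d \<Rightarrow> ennreal. h \<in> borel_measurable borel \<longrightarrow>
     (\<integral>\<^sup>+x. h x \<partial>lborel) = ennreal c * (\<integral>\<^sup>+x. h (f x) \<partial>lborel))"

lemma scales_volumeD:
  "scales_volume f c \<Longrightarrow> h \<in> borel_measurable borel \<Longrightarrow>
    (\<integral>\<^sup>+x. h x \<partial>lborel) = ennreal c * (\<integral>\<^sup>+x. h (f x) \<partial>lborel)"
  by (simp add: scales_volume_def)

lemma measurable_linear_cart [measurable_dest]: "linear (f :: real^'d::finite \<Rightarrow> real^'d) \<Longrightarrow> f \<in> borel_measurable borel"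
  by (intro borel_measurable_continuous_onI linear_continuous_on) (simp add: linear_conv_bounded_linear)

lemma det_shear:
  fixes m n :: "'d::finite"
  assumes "m \<noteq> n"
  shows "det (matrix (\<lambda>x::real^'d. \<chi> i. if i = m then x $ m + x $ n else x $ i)) = 1"
proof -
  have "matrix (\<lambda>x::real^'d. \<chi> i. if i = m then x $ m + x $ n else x $ i) =
      (\<chi> k. if k = m then row m (mat 1) + 1 *s row n (mat 1) else row k (mat 1 :: real^'d^'d))"
    using assms by (auto simp: matrix_def vec_eq_iff row_def mat_def axis_def)
  then show ?thesis using det_row_operation[OF assms, of "mat 1 :: real^'d^'d" 1] by (simp only: det_I)
qed

text \<open>
  Both sides are multiplicative, so the elementary maps suffice. A shear translates one
  coordinate by an amount that is constant while that coordinate varies, hence preserves the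
  inner integral of Fubini; maps with a vanishing component are singular and excluded by the
  hypothesis.
\<close>

lemma scales_volume_det:
  fixes f :: "real^'d::finite \<Rightarrow> real^'d"
  assumes "linear f" "det (matrix f) \<noteq> 0"
  shows "scales_volume f \<bar>det (matrix f)\<bar>"
proof -
  let ?P = "\<lambda>f::real^'d \<Rightarrow> real^'d. det (matrix f) \<noteq> 0 \<longrightarrow> scales_volume f \<bar>det (matrix f)\<bar>"
  have "?P f"
  proof (rule induct_linear_elementary[OF \<open>linear f\<close>, of ?P])
    fix f g :: "real^'d \<Rightarrow> real^'d"
    assume lin: "linear f" "linear g" and fg: "?P f" "?P g"
    note [measurable] = lin[THEN measurable_linear_cart]
    show "?P (f \<circ> g)"
    proof
      assume d: "det (matrix (f \<circ> g)) \<noteq> 0"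
      have m: "matrix (f \<circ> g) = matrix f ** matrix g"
        using lin by (simp add: matrix_compose)
      show "scales_volume (f \<circ> g) \<bar>det (matrix (f \<circ> g))\<bar>"
        unfolding scales_volume_def
      proof (intro allI impI)
        fix h :: "real^'d \<Rightarrow> ennreal" assume [measurable]: "h \<in> borel_measurable borel"
        have "(\<integral>\<^sup>+x. h x \<partial>lborel) = ennreal \<bar>det (matrix f)\<bar> * (\<integral>\<^sup>+x. h (f x) \<partial>lborel)"
          using fg(1) d by (intro scales_volumeD) (auto simp: m det_mul)
        also have "(\<integral>\<^sup>+x. h (f x) \<partial>lborel) = ennreal \<bar>det (matrix g)\<bar> * (\<integral>\<^sup>+x. h (f (g x)) \<partial>lborel)"
          using fg(2) d lin by (intro scales_volumeD) (auto simp: m det_mul)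
        finally show "(\<integral>\<^sup>+x. h x \<partial>lborel) =
            ennreal \<bar>det (matrix (f \<circ> g))\<bar> * (\<integral>\<^sup>+x. h ((f \<circ> g) x) \<partial>lborel)"
          by (simp add: m det_mul abs_mult ennreal_mult mult.assoc)
      qed
    qed
  next
    fix f :: "real^'d \<Rightarrow> real^'d" and i
    assume "linear f" and 0: "\<And>x. f x $ i = 0"
    then have "\<not> inj f"
      by (metis (full_types) linear_injective_imp_surjective one_neq_zero surjE vec_component)
    then show "?P f"
      using det_nz_iff_inj[OF \<open>linear f\<close>] by blast
  next
    fix c :: "'d \<Rightarrow> real"
    let ?f = "\<lambda>x::real^'d. \<chi> i. c i * x $ i"
    have det: "det (matrix ?f) = prod c UNIV"
      by (simp add: axis_def matrix_def det_diagonal)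
    show "?P ?f"
    proof
      assume "det (matrix ?f) \<noteq> 0"
      then have c: "c i \<noteq> 0" for i by (simp add: det)
      define c' :: "real^'d \<Rightarrow> real" where "c' b = c (axis_index b)" for b
      have f: "?f x = 0 + (\<Sum>b\<in>Basis. (c' b * (x \<bullet> b)) *\<^sub>R b)" for x
        by (simp add: sum_Basis_cart c'_def axis_index_axis inner_axis vec_eq_iff)
          (simp add: axis_def if_distrib cong: if_cong)
      have p: "(\<Prod>b\<in>Basis. \<bar>c' b\<bar>) = \<bar>prod c UNIV\<bar>"
        by (simp add: prod_Basis_cart c'_def axis_index_axis abs_prod)
      have [measurable]: "?f \<in> borel_measurable borel" 
        by (intro borel_measurable_continuous_onI continuous_intros)
      have eq: "lborel = density (distr lborel borel ?f) (\<lambda>_. \<bar>prod c UNIV\<bar>)"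
        unfolding f p[symmetric] by (rule lborel_affine_euclidean) (auto simp: c'_def c)
      then show "scales_volume ?f \<bar>det (matrix ?f)\<bar>"
        unfolding scales_volume_def det
      proof (intro allI impI)
        fix h :: "real^'d \<Rightarrow> ennreal" assume [measurable]: "h \<in> borel_measurable borel"
        have "(\<integral>\<^sup>+x. h x \<partial>lborel) = (\<integral>\<^sup>+x. h x \<partial>density (distr lborel borel ?f) (\<lambda>_. \<bar>prod c UNIV\<bar>))"
          by (subst eq) (rule refl)
        then show "(\<integral>\<^sup>+x. h x \<partial>lborel) = ennreal \<bar>prod c UNIV\<bar> * (\<integral>\<^sup>+x. h (?f x) \<partial>lborel)"
          by (simp add: nn_integral_density nn_integral_distr nn_integral_cmult)
      qed
    qed
  next
    fix m n :: 'd assume "m \<noteq> n"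
    let ?f = "\<lambda>x::real^'d. \<chi> i. x $ Transposition.transpose m n i"
    have "matrix ?f = transpose (\<chi> i j. mat 1 $ i $ Transposition.transpose m n j)"
      by (auto simp: vec_eq_iff transpose_def axis_def mat_def matrix_def)
    then have det: "\<bar>det (matrix ?f)\<bar> = 1"
      by (simp add: det_permute_columns permutes_swap_id sign_swap_id abs_mult)
    have [measurable]: "?f \<in> borel_measurable borel"
        by (intro borel_measurable_continuous_onI continuous_intros)
    have eq: "lborel = distr lborel borel ?f"
    proof (rule lborel_eqI)
      fix l u :: "real^'d"
      assume lu: "\<And>b. b \<in> Basis \<Longrightarrow> l \<bullet> b \<le> u \<bullet> b"
      have le: "l $ j \<le> u $ j" for j using lu[of "axis j 1"] by (auto simp: inner_axis Basis_cart)
      have le': "?f l \<bullet> b \<le> ?f u \<bullet> b" if "b \<in> Basis" for b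
        using le that by (auto simp: Basis_cart inner_axis)
      have "?f -` box l u = box (?f l) (?f u)"
        by (auto simp: mem_box_cart) (metis transpose_involutory)+
      then have "emeasure (distr lborel borel ?f) (box l u) = (\<Prod>j\<in>UNIV. (u - l) $ Transposition.transpose m n j)"
        by (simp add: emeasure_distr emeasure_lborel_box[OF le'] prod_Basis_cart inner_axis)
      also have "(\<Prod>j\<in>UNIV. (u - l) $ Transposition.transpose m n j) = (\<Prod>j\<in>UNIV. (u - l) $ j)"
        by (rule prod.permute[OF permutes_swap_id, symmetric, unfolded comp_def]) auto
      finally show "emeasure (distr lborel borel ?f) (box l u) = (\<Prod>b\<in>Basis. (u - l) \<bullet> b)"
        by (simp add: prod_Basis_cart inner_axis)
    qed simp
    show "?P ?f"
      unfolding scales_volume_def det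
    proof (intro allI impI)
      fix h :: "real^'d \<Rightarrow> ennreal" assume [measurable]: "h \<in> borel_measurable borel"
      have "(\<integral>\<^sup>+x. h x \<partial>lborel) = (\<integral>\<^sup>+x. h x \<partial>distr lborel borel ?f)"
        by (subst eq) (rule refl)
      then show "(\<integral>\<^sup>+x. h x \<partial>lborel) = ennreal 1 * (\<integral>\<^sup>+x. h (?f x) \<partial>lborel)"
        by (simp add: nn_integral_distr)
    qed
  next
    fix m n :: 'd assume mn: "m \<noteq> n"
    let ?f = "\<lambda>x::real^'d. \<chi> i. if i = m then x $ m + x $ n else x $ i"
    have [measurable]: "?f \<in> borel_measurable borel"
      by (intro measurable_linear_cart linearI) (auto simp: vec_eq_iff algebra_simps)
    have f: "?f (set_coord m t y) = set_coord m (t + y $ n) y" for t y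
      using mn by (auto simp: vec_eq_iff)
    show "?P ?f"
      unfolding scales_volume_def det_shear[OF mn]
    proof (intro allI impI)
      fix h :: "real^'d \<Rightarrow> ennreal" assume [measurable]: "h \<in> borel_measurable borel"
      have "(\<integral>\<^sup>+t. h (set_coord m t y) \<partial>lborel) = (\<integral>\<^sup>+t. h (set_coord m (t + y $ n) y) \<partial>lborel)" for y
        using nn_integral_real_affine[of "\<lambda>t. h (set_coord m t y)" 1 "y $ n"] by (simp add: add.commute)
      then show "(\<integral>\<^sup>+x. h x \<partial>lborel) = ennreal \<bar>1\<bar> * (\<integral>\<^sup>+x. h (?f x) \<partial>lborel)"
        by (subst (1 2) nn_integral_coordinate_strip[of _ m]) (simp_all add: f)
    qed
  qed
  with assms show ?thesis by blast
qed

lemma lborel_affine_matrix: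
  fixes A :: "real^'d::finite^'d"
  assumes "det A \<noteq> 0"
  shows "(lborel :: (real^'d) measure) = density (distr lborel borel (\<lambda>x. A *v x + b)) (\<lambda>_. ennreal \<bar>det A\<bar>)" (is "_ = ?R")
proof (rule measure_eqI)
  have [measurable]: "(\<lambda>x. A *v x + b) \<in> borel_measurable borel"
    by (intro borel_measurable_continuous_onI continuous_intros matrix_vector_mult_linear_continuous_on)
  fix X :: "(real^'d) set" assume "X \<in> sets lborel"
  then have [measurable]: "X \<in> sets borel" by simp
  have "emeasure lborel X = (\<integral>\<^sup>+x. indicator X x \<partial>lborel)" by simp
  also have "\<dots> = (\<integral>\<^sup>+x. indicator X (x + b) \<partial>lborel)"
    by (subst lborel_distr_plus[of b, symmetric], subst nn_integral_distr) (auto simp: add.commute)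
  also have "\<dots> = ennreal \<bar>det A\<bar> * (\<integral>\<^sup>+x. indicator X (A *v x + b) \<partial>lborel)"
    using scales_volume_det[of "(*v) A"] assms by (intro scales_volumeD) simp_all
  also have "\<dots> = emeasure ?R X"
    by (simp add: emeasure_density nn_integral_distr nn_integral_cmult del: nn_integral_indicator)
  finally show "emeasure lborel X = emeasure ?R X" .
qed simp

lemma lborel_integral_affine_matrix:
  fixes A :: "real^'d::finite^'d" and f :: "real^'d \<Rightarrow> real"
  assumes "det A \<noteq> 0" and [measurable]: "f \<in> borel_measurable borel"
  shows "(LINT x|lborel. f x) = \<bar>det A\<bar> * (LINT y|lborel. f (A *v y + b))"
proof -
  have [measurable]: "(\<lambda>x. A *v x + b) \<in> borel_measurable borel"
    by (intro borel_measurable_continuous_onI continuous_intros matrix_vector_mult_linear_continuous_on)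
  show ?thesis
    by (subst lborel_affine_matrix[OF assms(1), of b]) (simp add: integral_density integral_distr)
qed

section \<open>Gauss theorem on the reference cube\<close>

lemma ref_cube_eq_cbox: "ref_cube = cbox 0 (1 :: real^'d::finite)"
  by (auto simp: ref_cube_def mem_box_cart)

lemma compact_ref_cube: "compact (ref_cube :: (real^'d::finite) set)"
  by (simp add: ref_cube_eq_cbox)

lemma integrable_continuous_compact:
  fixes f :: "real^'d::finite \<Rightarrow> real"
  assumes "compact S" "continuous_on UNIV f"
  shows "set_integrable lborel S f"
  unfolding set_integrable_def
  by (intro borel_integrable_compact assms continuous_on_subset[OF assms(2)]) auto

lemma AE_coordinate_neq: "AE y::real^'d::finite in lborel. y $ i \<noteq> c"
proof -
  have "negligible {y::real^'d. y $ i = c}"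
    using negligible_hyperplane[of "axis i 1 :: real^'d" c] by (simp add: inner_axis')
  moreover have "{y::real^'d. y $ i = c} \<in> sets lborel"
    by (auto intro!: borel_closed closed_Collect_eq continuous_intros)
  ultimately have "{y::real^'d. y $ i = c} \<in> null_sets lborel"
    by (simp add: negligible_iff_null_sets null_sets_completion_iff)
  then show ?thesis by (rule AE_I') auto
qed

lemma DERIV_set_coord:
  fixes G :: "real^'d::finite \<Rightarrow> real"
  assumes "\<And>y. (G has_derivative G' y) (at y)"
  shows "((\<lambda>t. G (set_coord i t y)) has_real_derivative G' (set_coord i t y) (axis i 1)) (at t)"
proof -
  have "((\<lambda>t. G (set_coord i t y)) has_derivative (\<lambda>h. G' (set_coord i t y) (h *\<^sub>R axis i 1))) (at t)"
    unfolding set_coord_eq_add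
    by (rule has_derivative_compose[OF _ assms]) (auto intro!: derivative_eq_intros)
  moreover have "(\<lambda>h. G' (set_coord i t y) (h *\<^sub>R axis i 1)) = (*) (G' (set_coord i t y) (axis i 1))"
    using has_derivative_linear[OF assms] by (simp add: fun_eq_iff linear_cmul)
  ultimately show ?thesis
    by (simp add: has_field_derivative_def)
qed

text \<open>
  Fubini in the coordinate \<open>i\<close>, then the fundamental theorem of calculus. The
  integrals over the two opposite faces appear as integrals over the whole cube of functions
  that ignore the coordinate \<open>i\<close>, which is also the form that integrals over faces
  of an element take below.
\<close>

lemma gauss_ref_cube:
  fixes G :: "real^'d::finite \<Rightarrow> real"
  assumes der: "\<And>y. (G has_derivative G' y) (at y)"
    and cont: "continuous_on UNIV (\<lambda>y. G' y (axis i 1))"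
  shows "(LINT y:ref_cube|lborel. G' y (axis i 1)) =
    (LINT y:ref_cube|lborel. G (set_coord i 1 y)) - (LINT y:ref_cube|lborel. G (set_coord i 0 y))"
proof -
  define g where "g y = G' y (axis i 1)" for y
  \<comment> \<open>the constraints of the cube that do not involve the coordinate \<open>i\<close>\<close>
  define C :: "(real^'d) set" where "C = {y. \<forall>j. j \<noteq> i \<longrightarrow> 0 \<le> y $ j \<and> y $ j \<le> 1}"
  define K where "K y = G (set_coord i 1 y) - G (set_coord i 0 y)" for y
  have contG: "continuous_on UNIV G"
    using der by (intro has_derivative_continuous_on) auto
  have contg: "continuous_on UNIV g"
    using cont by (simp add: g_def[abs_def])
  have contK: "continuous_on UNIV K" "continuous_on UNIV (\<lambda>y. G (set_coord i s y))" for s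
    unfolding K_def by (intro continuous_intros continuous_on_compose2[OF contG] subset_UNIV)+
  have [measurable]: "K \<in> borel_measurable borel"
    using contK by (intro borel_measurable_continuous_onI)
  have [measurable]: "C \<in> sets borel"
    unfolding C_def by measurable
  have [measurable]: "(ref_cube :: (real^'d) set) \<in> sets borel"
    by (simp add: ref_cube_eq_cbox)
  have inner: "(LINT t|lborel. indicator ref_cube (set_coord i t y) * g (set_coord i t y)) = indicator C y * K y" for y
  proof -
    have "(LINT t|lborel. indicator ref_cube (set_coord i t y) * g (set_coord i t y)) =
      (LINT t|lborel. indicator C y * (g (set_coord i t y) * indicator {0..1} t))"
      by (intro Bochner_Integration.integral_cong refl) (auto simp: indicator_def ref_cube_def C_def split: if_splits)
    also have "\<dots> = indicator C y * (LINT t|lborel. g (set_coord i t y) * indicator {0..1} t)"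
      by simp
    also have "(LINT t|lborel. g (set_coord i t y) * indicator {0..1} t) = K y"
      unfolding K_def
    proof (rule integral_FTC_Icc_real)
      fix t :: real
      show "((\<lambda>t. G (set_coord i t y)) has_real_derivative g (set_coord i t y)) (at t)"
        unfolding g_def by (rule DERIV_set_coord[OF der])
      have "continuous_on UNIV (\<lambda>t. g (set_coord i t y))"
        by (intro continuous_intros continuous_on_compose2[OF contg] subset_UNIV)
      then show "isCont (\<lambda>t. g (set_coord i t y)) t"
        by (simp add: continuous_on_eq_continuous_at)
    qed simp
    finally show ?thesis .
  qed
  have "(LINT y:ref_cube|lborel. g y) = (LINT y|strip i. indicator C y * K y)"
    unfolding set_lebesgue_integral_def
    using integrable_continuous_compact[OF compact_ref_cube contg]
    by (subst integral_coordinate_strip[of _ i]) (auto simp: inner set_integrable_def)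
  also have "\<dots> = (LINT y|lborel. indicator {y. 0 < y $ i \<and> y $ i < 1} y *\<^sub>R (indicator C y * K y))"
  proof -
    have "strip i = density lborel (\<lambda>y. ennreal (indicat_real {y. 0 < y $ i \<and> y $ i < 1} y))"
      by (simp add: strip_def ennreal_indicator)
    then show ?thesis by (simp add: integral_density)
  qed
  also have "\<dots> = (LINT y:ref_cube|lborel. K y)"
    unfolding set_lebesgue_integral_def
  proof (rule integral_cong_AE)
    show "AE y in lborel. indicator {y. 0 < y $ i \<and> y $ i < 1} y *\<^sub>R (indicator C y * K y) = indicator ref_cube y *\<^sub>R K y"
      using AE_coordinate_neq[of i 0] AE_coordinate_neq[of i 1]
    proof eventually_elim
      case (elim y)
      have "y \<in> ref_cube \<longleftrightarrow> 0 < y $ i \<and> y $ i < 1 \<and> y \<in> C"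
        using elim by (auto simp: ref_cube_def C_def order_less_le)
      then show ?case by (auto simp: indicator_def)
    qed
  qed auto
  also have "\<dots> = (LINT y:ref_cube|lborel. G (set_coord i 1 y)) - (LINT y:ref_cube|lborel. G (set_coord i 0 y))"
    unfolding K_def
    by (intro set_integral_diff(2) integrable_continuous_compact compact_ref_cube contK)
  finally show ?thesis by (simp add: g_def)
qed

section \<open>Parallelepipeds and their facets\<close>

locale parallelepiped =
  fixes B :: "real^'d::finite^'d" and b :: "real^'d" and E :: "(real^'d) set"
  assumes det_B: "det B \<noteq> 0"
    and E_eq: "E = (\<lambda>y. B *v y + b) ` ref_cube"
begin

definition chart :: "real^'d \<Rightarrow> real^'d" where "chart y = B *v y + b"

definition coords :: "real^'d \<Rightarrow> real^'d" where "coords x = matrix_inv B *v (x - b)"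

text \<open>
  A row of the inverse matrix is the gradient of an affine coordinate, hence normal to the faces
  on which that coordinate is constant. Its length records how the map stretches in this
  direction.
\<close>

definition conormal :: "'d \<Rightarrow> real^'d" where "conormal i = row i (matrix_inv B)"

definition unormal :: "'d \<Rightarrow> real^'d" where "unormal i = conormal i /\<^sub>R norm (conormal i)"

definition face :: "'d \<Rightarrow> real \<Rightarrow> (real^'d) set" where "face i s = chart ` ref_face i s"

lemma B_inv: "matrix_inv B *v (B *v x) = x" "B *v (matrix_inv B *v x) = x"
proof -
  have "\<exists>A'. B ** A' = mat 1 \<and> A' ** B = mat 1"
    using det_B by (simp add: invertible_det_nz[symmetric] invertible_def)
  then have "B ** matrix_inv B = mat 1 \<and> matrix_inv B ** B = mat 1"
    unfolding matrix_inv_def by (rule someI_ex)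
  then show "matrix_inv B *v (B *v x) = x" "B *v (matrix_inv B *v x) = x"
    by (simp_all add: matrix_vector_mul_assoc)
qed

lemma coords_chart [simp]: "coords (chart y) = y"
  by (simp add: coords_def chart_def B_inv)

lemma chart_coords [simp]: "chart (coords x) = x"
  by (simp add: coords_def chart_def B_inv)

lemma inv_chart: "inv chart = coords"
  by (rule inv_unique_comp) (auto simp: fun_eq_iff)

lemma coords_nth: "coords x $ i = conormal i \<bullet> (x - b)"
  by (simp add: coords_def conormal_def row_def inner_vec_def matrix_vector_mult_def)

lemma coords_add: "coords (x + v) $ i = coords x $ i + conormal i \<bullet> v"
  by (simp add: coords_nth inner_simps)

lemma coords_diff: "conormal i \<bullet> (x - y) = coords x $ i - coords y $ i"
  by (simp add: coords_nth inner_simps)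

lemma continuous_on_coords [continuous_intros]:
  "continuous_on S f \<Longrightarrow> continuous_on S (\<lambda>x. coords (f x))"
  unfolding coords_def by (intro matrix_vector_mult_linear_continuous_on[THEN continuous_on_compose2[OF _ _ subset_UNIV]] continuous_intros)

lemma continuous_on_chart [continuous_intros]:
  "continuous_on S f \<Longrightarrow> continuous_on S (\<lambda>x. chart (f x))"
  unfolding chart_def by (intro continuous_on_add matrix_vector_mult_linear_continuous_on[THEN continuous_on_compose2[OF _ _ subset_UNIV]] continuous_intros)

lemma chart_add: "chart (y + v) = chart y + B *v v"
  by (simp add: chart_def matrix_vector_right_distrib)

lemma conormal_B: "conormal i \<bullet> (B *v v) = v $ i"
  using coords_add[of "chart 0" "B *v v" i] by (simp add: chart_add[symmetric])

lemma conormal_nonzero [simp]: "conormal i \<noteq> 0"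
  using conormal_B[of i "axis i 1"] by auto

lemma norm_unormal [simp]: "norm (unormal i) = 1"
  by (simp add: unormal_def)

lemma conormal_unormal [simp]: "conormal i \<bullet> unormal i = norm (conormal i)"
  by (simp add: unormal_def power2_norm_eq_inner[symmetric] power2_eq_square)

lemma E_conv_chart: "E = chart ` ref_cube"
  by (simp add: E_eq chart_def)

lemma mem_E: "x \<in> E \<longleftrightarrow> (\<forall>i. 0 \<le> coords x $ i \<and> coords x $ i \<le> 1)"
proof -
  have "x \<in> E \<longleftrightarrow> coords x \<in> ref_cube"
    unfolding E_conv_chart by (metis chart_coords coords_chart image_iff)
  then show ?thesis by (simp add: ref_cube_def)
qed

lemma mem_face: "x \<in> face i s \<longleftrightarrow> x \<in> E \<and> coords x $ i = s"
proof -
  have "x \<in> face i s \<longleftrightarrow> coords x \<in> ref_face i s"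
    using image_eqI[of x chart "coords x" "ref_face i s"] by (auto simp: face_def)
  then show ?thesis by (simp add: ref_face_def mem_E ref_cube_def)
qed

lemma compact_E: "compact E"
  unfolding E_conv_chart by (intro compact_continuous_image compact_ref_cube continuous_intros)

lemma convex_E: "convex E"
proof -
  have E: "E = (+) b ` (*v) B ` cbox 0 1"
    unfolding E_eq ref_cube_eq_cbox image_image by (simp add: add.commute)
  show ?thesis
    unfolding E by (intro convex_translation convex_linear_image convex_box matrix_vector_mul_linear)
qed

lemma interior_E: "interior E = {x. \<forall>i. 0 < coords x $ i \<and> coords x $ i < 1}"
proof -
  have "inj ((*v) B)"
    by (metis B_inv(1) injI)
  have "E = (+) b ` (*v) B ` cbox 0 1"
    unfolding E_eq ref_cube_eq_cbox image_image by (simp add: add.commute)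
  then have "interior E = (+) b ` (*v) B ` box 0 1"
    by (simp add: interior_translation interior_injective_linear_image \<open>inj ((*v) B)\<close>)
  also have "\<dots> = chart ` box 0 1"
    unfolding image_image by (simp add: chart_def add.commute)
  also have "\<dots> = {x. coords x \<in> box 0 1}"
    by (auto simp: image_iff) (metis chart_coords)
  finally show ?thesis by (simp add: mem_box_cart)
qed

definition middle :: "real^'d" where "middle = (\<chi> j. 1/2)"

lemma chart_middle_interior: "chart middle \<in> interior E"
  by (simp add: interior_E middle_def)

lemma closure_interior_E: "closure (interior E) = E"
  using convex_closure_interior[OF convex_E] chart_middle_interior compact_E
  by (metis closure_closed compact_imp_closed empty_iff)

lemma mem_face_center: "chart (set_coord i s middle) \<in> face i s" if "s \<in> {0, 1}"
  using that by (auto simp: mem_face mem_E middle_def)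

lemma face_subset: "face i s \<subseteq> E"
  by (auto simp: mem_face)

lemma coord_hyperplane: "{x. coords x $ i = s} = {x. conormal i \<bullet> x = s + conormal i \<bullet> b}"
  by (auto simp: coords_nth inner_simps)

text \<open>
  A face is its hyperplane cut by the constraints on the other coordinates. They hold in a
  neighbourhood of the centre of the face, so the cut still spans the hyperplane.
\<close>

lemma affine_hull_face:
  assumes s: "s \<in> {0, 1}"
  shows "affine hull (face i s) = {x. coords x $ i = s}"
proof -
  let ?S = "{x. coords x $ i = s}"
  define T where "T = {x. \<forall>j. j \<noteq> i \<longrightarrow> 0 \<le> coords x $ j \<and> coords x $ j \<le> 1}"
  define U where "U = {x. \<forall>j. j \<noteq> i \<longrightarrow> 0 < coords x $ j \<and> coords x $ j < 1}"
  have aff: "affine ?S"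
    unfolding coord_hyperplane by (rule affine_hyperplane)
  have "U = (\<Inter>j\<in>UNIV - {i}. {x. 0 < coords x $ j \<and> coords x $ j < 1})"
    by (auto simp: U_def)
  moreover have "open {x. 0 < coords x $ j \<and> coords x $ j < 1}" for j
    by (intro open_Collect_conj open_Collect_less continuous_intros)
  ultimately have "open U" by auto
  moreover have "U \<subseteq> T" by (auto simp: U_def T_def intro: less_imp_le)
  ultimately have "U \<subseteq> interior T" by (simp add: interior_maximal)
  moreover have "chart (set_coord i s middle) \<in> U" "chart (set_coord i s middle) \<in> ?S"
    by (auto simp: U_def middle_def)
  ultimately have "?S \<inter> interior T \<noteq> {}" by blast
  then have "affine hull (?S \<inter> T) = affine hull ?S"
    using aff by (intro affine_hull_convex_Int_nonempty_interior affine_imp_convex) auto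
  moreover have "?S \<inter> T = face i s"
    unfolding set_eq_iff Int_iff mem_Collect_eq mem_face mem_E T_def using s
    by (metis insert_iff le_numeral_extra(3,4) singletonD zero_le_one)
  ultimately show ?thesis
    using aff by (simp add: hull_same)
qed

lemma aff_dim_face: "s \<in> {0, 1} \<Longrightarrow> aff_dim (face i s) = int CARD('d) - 1"
  by (subst aff_dim_affine_hull[symmetric])
    (simp add: affine_hull_face coord_hyperplane aff_dim_hyperplane)

lemma aff_dim_E: "aff_dim E = int CARD('d)"
  using aff_dim_nonempty_interior[of E] chart_middle_interior by auto

lemma face_face_of: 
  assumes "s \<in> {0, 1}" shows "face i s face_of E"
proof -
  have "face i s = E \<inter> {x. conormal i \<bullet> x = s + conormal i \<bullet> b}"
    by (auto simp: mem_face coord_hyperplane[symmetric])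
  moreover have "0 \<le> conormal i \<bullet> (x - b) \<and> conormal i \<bullet> (x - b) \<le> 1" if "x \<in> E" for x
    using that by (simp add: mem_E coords_nth)
  ultimately show ?thesis
    using assms face_of_Int_supporting_hyperplane_le[OF convex_E, of "conormal i" "1 + conormal i \<bullet> b"]
      face_of_Int_supporting_hyperplane_ge[OF convex_E, of "0 + conormal i \<bullet> b" "conormal i"]
    by (auto simp: inner_diff_right algebra_simps)
qed

lemma face_facet_of: "s \<in> {0, 1} \<Longrightarrow> face i s facet_of E"
  using face_face_of mem_face_center by (fastforce simp: facet_of_def aff_dim_face aff_dim_E)

text \<open>
  A facet avoids the interior, so some coordinate is \<open>0\<close> or \<open>1\<close> at a
  relatively interior point of it. Then it lies in the corresponding face, and equality of
  dimensions makes the two equal.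
\<close>

lemma facet_of_E_iff: "e facet_of E \<longleftrightarrow> (\<exists>i. \<exists>s\<in>{0, 1}. e = face i s)"
proof
  assume e: "e facet_of E"
  then have e': "e face_of E" "e \<noteq> {}" "aff_dim e = int CARD('d) - 1"
    by (auto simp: facet_of_def aff_dim_E)
  then have "convex e" by (simp add: face_of_imp_convex)
  then obtain x where x: "x \<in> rel_interior e"
    using e' rel_interior_eq_empty by blast
  have "e \<noteq> E" using e' aff_dim_E by auto
  then have "x \<notin> interior E"
    using face_of_disjoint_interior[OF e'(1)] x rel_interior_subset by blast
  moreover have "x \<in> E" using x rel_interior_subset e' face_of_imp_subset by blast
  ultimately obtain i where "coords x $ i = 0 \<or> coords x $ i = 1"
    unfolding interior_E mem_E mem_Collect_eq by (metis order_less_le)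
  with \<open>x \<in> E\<close> obtain s where s: "s \<in> {0, 1}" "x \<in> face i s"
    by (auto simp: mem_face)
  have "e \<subseteq> face i s"
    using x s e' by (intro subset_of_face_of[OF face_face_of[OF s(1)]]) (auto dest: face_of_imp_subset)
  then have "e face_of face i s"
    by (rule face_of_subset[OF e'(1) _ face_subset])
  then have "e = face i s"
    using face_of_aff_dim_lt[of "face i s" e] s e' aff_dim_face[OF s(1)] face_face_of[OF s(1)]
    by (force dest: face_of_imp_convex)
  then show "\<exists>i. \<exists>s\<in>{0, 1}. e = face i s" using s by blast
qed (auto intro: face_facet_of)

lemma face_eq_iff:
  assumes "s \<in> {0, 1}" "t \<in> {0, 1}"
  shows "face i s = face j t \<longleftrightarrow> i = j \<and> s = t"
proof
  assume "face i s = face j t"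
  then have "chart (set_coord i s middle) \<in> face j t"
    using mem_face_center[OF assms(1), of i] by simp
  then show "i = j \<and> s = t"
    using assms by (auto simp: mem_face middle_def split: if_splits)
qed auto

text \<open>
  The edge directions other than the \<open>i\<close>-th are parallel to the face. A vector
  orthogonal to them is determined by its product with the \<open>i\<close>-th edge, so it is a
  multiple of the conormal.
\<close>

lemma orthogonal_to_face:
  assumes s: "s \<in> {0, 1}" and n: "norm n = 1"
    and orth: "\<And>x y. x \<in> face i s \<Longrightarrow> y \<in> face i s \<Longrightarrow> n \<bullet> (y - x) = 0"
  shows "n = unormal i \<or> n = - unormal i"
proof -
  define c where "c = n \<bullet> (B *v axis i 1)"
  have n_axis: "n \<bullet> (B *v axis j 1) = 0" if "j \<noteq> i" for j
  proof -
    let ?y = "set_coord j 1 (set_coord i s middle)" and ?x = "set_coord j 0 (set_coord i s middle)"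
    have "chart ?y \<in> face i s" "chart ?x \<in> face i s"
      using s that by (auto simp: mem_face mem_E middle_def)
    then have "n \<bullet> (chart ?y - chart ?x) = 0" by (intro orth)
    moreover have "?y = ?x + axis j 1"
      by (auto simp: vec_eq_iff axis_def)
    ultimately show ?thesis
      by (metis add_diff_cancel_left' chart_add)
  qed
  have "n \<bullet> (B *v v) = (c *\<^sub>R conormal i) \<bullet> (B *v v)" for v
  proof -
    have "B *v v = (\<Sum>j\<in>UNIV. v $ j *\<^sub>R (B *v axis j 1))"
      by (subst matrix_mult_sum) (simp add: matrix_vector_mult_basis scalar_mult_eq_scaleR)
    then have "n \<bullet> (B *v v) = (\<Sum>j\<in>UNIV. v $ j * (n \<bullet> (B *v axis j 1)))"
      by (simp add: inner_sum_right)
    also have "\<dots> = (\<Sum>j\<in>UNIV. if j = i then v $ i * c else 0)"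
      by (intro sum.cong) (auto simp: n_axis c_def)
    finally show ?thesis by (simp add: conormal_B)
  qed
  from this[of "matrix_inv B *v (n - c *\<^sub>R conormal i)"]
  have "(n - c *\<^sub>R conormal i) \<bullet> (n - c *\<^sub>R conormal i) = 0"
    by (subst inner_diff_left) (simp only: B_inv(2) diff_self)
  then have eq: "n = c *\<^sub>R conormal i"
    by (simp only: inner_eq_zero_iff eq_iff_diff_eq_0[of n])
  then have "\<bar>c\<bar> * norm (conormal i) = 1" using n by simp
  then have "c = 1 / norm (conormal i) \<or> c = - (1 / norm (conormal i))"
    by (auto simp: field_simps abs_if split: if_splits)
  then show ?thesis
    by (subst (1 2) eq) (auto simp: unormal_def inverse_eq_divide)
qed

text \<open>
  Of the two unit normals of the face, the centre of the element selects one, so the description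
  defining the outer normal has a unique solution. The factor \<open>2 * s - 1\<close> is the
  sign: the coordinate \<open>i\<close> grows outwards at the face \<open>s = 1\<close> and
  inwards at \<open>s = 0\<close>.
\<close>

lemma outer_normal_unique:
  assumes s: "s \<in> {0, 1}"
  shows "norm n = 1 \<and> (\<forall>x\<in>face i s. \<forall>y\<in>E. (y - x) \<bullet> n \<le> 0) \<longleftrightarrow> n = (2 * s - 1) *\<^sub>R unormal i"
proof -
  let ?n = "(2 * s - 1) *\<^sub>R unormal i"
  have n: "norm ?n = 1" using s by auto
  have inner: "(y - x) \<bullet> ?n = (2 * s - 1) * (coords y $ i - coords x $ i) / norm (conormal i)" for x y
    by (simp add: unormal_def coords_diff[symmetric] inner_commute divide_inverse)
  have le: "(y - x) \<bullet> ?n \<le> 0" if "x \<in> face i s" "y \<in> E" for x y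
    using that s unfolding inner by (auto simp: mem_face mem_E divide_simps)
  have False if "\<forall>x\<in>face i s. \<forall>y\<in>E. (y - x) \<bullet> (- ?n) \<le> 0"
  proof -
    have "(chart middle - chart (set_coord i s middle)) \<bullet> ?n \<ge> 0"
      using that mem_face_center[OF s] chart_middle_interior interior_subset by fastforce
    then show False
      using s unfolding inner by (auto simp: middle_def divide_simps)
  qed
  moreover have "n = ?n \<or> n = - ?n" if "norm n = 1" "\<forall>x\<in>face i s. \<forall>y\<in>E. (y - x) \<bullet> n \<le> 0"
  proof -
    have "n \<bullet> (y - x) = 0" if "x \<in> face i s" "y \<in> face i s" for x y
    proof -
      have "(y - x) \<bullet> n \<le> 0" "(x - y) \<bullet> n \<le> 0"
        using that \<open>\<forall>x\<in>face i s. _\<close> face_subset by blast+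
      then show ?thesis by (simp add: inner_simps inner_commute)
    qed
    from orthogonal_to_face[of s n i, OF s \<open>norm n = 1\<close> this] show ?thesis using s by auto
  qed
  ultimately show ?thesis using n le by metis
qed

lemma outer_normal_face:
  assumes s: "s \<in> {0, 1}"
  shows "outer_normal E (face i s) = (2 * s - 1) *\<^sub>R unormal i"
  unfolding outer_normal_def outer_normal_unique[OF s] by simp

text \<open>
  If another coordinate were \<open>0\<close> or \<open>1\<close> at a relatively interior
  point, then the entire face would lie in a second face, which does not contain the centre of
  the first.
\<close>

lemma rel_interior_face:
  assumes s: "s \<in> {0, 1}" and x: "x \<in> rel_interior (face i s)" and "j \<noteq> i"
  shows "0 < coords x $ j" "coords x $ j < 1"
proof -
  have "coords x $ j \<noteq> t" if t: "t \<in> {0, 1}" for t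
  proof
    assume "coords x $ j = t"
    moreover have "x \<in> E" using subsetD[OF rel_interior_subset x] by (simp add: mem_face)
    ultimately have "face i s \<subseteq> face j t"
      using x by (intro subset_of_face_of[OF face_face_of[OF t]] face_subset) (auto simp: mem_face)
    from subsetD[OF this mem_face_center[OF s]] have "chart (set_coord i s middle) \<in> face j t" .
    then show False using t \<open>j \<noteq> i\<close> by (auto simp: mem_face middle_def)
  qed
  moreover have "x \<in> E" using subsetD[OF rel_interior_subset x] by (simp add: mem_face)
  ultimately show "0 < coords x $ j" "coords x $ j < 1"
    by (force simp: mem_E order_less_le)+
qed

text \<open>
  Near a relatively interior point of a facet, the constraint of this facet is the only active
  one.
\<close>

lemma locally_half_space:
  assumes e: "e facet_of E" and x: "x \<in> rel_interior e"
  shows "\<exists>r>0. \<forall>y\<in>ball x r. ((y - x) \<bullet> outer_normal E e \<le> 0 \<longrightarrow> y \<in> E) \<and>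
    ((y - x) \<bullet> outer_normal E e < 0 \<longrightarrow> y \<in> interior E)"
proof -
  obtain i s where s: "s \<in> {0, 1}" and e_eq: "e = face i s"
    using e facet_of_E_iff by auto
  have xi: "coords x $ i = s"
    using subsetD[OF rel_interior_subset x] by (simp add: e_eq mem_face)
  define U where "U = (\<Inter>j\<in>UNIV - {i}. {y. 0 < coords y $ j \<and> coords y $ j < 1}) \<inter> {y. s - 1 < coords y $ i \<and> coords y $ i < s + 1}"
  have "open U" unfolding U_def
    by (intro open_Int open_INT finite ballI open_Collect_conj open_Collect_less continuous_intros)
  moreover have "x \<in> U"
    using rel_interior_face[OF s] x by (auto simp: U_def e_eq xi)
  ultimately obtain r where r: "r > 0" "ball x r \<subseteq> U"
    by (meson open_contains_ball)
  have inner: "(y - x) \<bullet> outer_normal E e = (2 * s - 1) * (coords y $ i - s) / norm (conormal i)" for y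
    using coords_diff[of i y x] xi by (simp add: e_eq outer_normal_face[OF s] unormal_def inner_commute divide_inverse)
  have "((y - x) \<bullet> outer_normal E e \<le> 0 \<longrightarrow> y \<in> E) \<and> ((y - x) \<bullet> outer_normal E e < 0 \<longrightarrow> y \<in> interior E)"
    if "y \<in> ball x r" for y
  proof -
    have U: "\<And>j. j \<noteq> i \<Longrightarrow> 0 < coords y $ j \<and> coords y $ j < 1" "s - 1 < coords y $ i" "coords y $ i < s + 1"
      using that r by (auto simp: U_def)
    have "(\<forall>j. P (coords y $ j)) \<longleftrightarrow> P (coords y $ i) \<and> (\<forall>j. j \<noteq> i \<longrightarrow> P (coords y $ j))" for P
      by metis
    note * = this[of "\<lambda>r. 0 \<le> r \<and> r \<le> 1"] this[of "\<lambda>r. 0 < r \<and> r < 1"]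
    show ?thesis
      unfolding mem_E interior_E mem_Collect_eq * inner using U s
      by (auto simp: divide_le_0_iff divide_less_0_iff intro: less_imp_le)
  qed
  with r show ?thesis by blast
qed

end

section \<open>Gauss theorem on a parallelepiped\<close>

context parallelepiped
begin

lemma sets_E [measurable]: "E \<in> sets borel"
  using compact_E by (simp add: borel_compact)

lemma set_integral_lebesgue_E:
  fixes f :: "real^'d \<Rightarrow> real"
  assumes "continuous_on UNIV f"
  shows "(LINT x:E|lebesgue. f x) = (LINT x:E|lborel. f x)"
  unfolding set_lebesgue_integral_def
  using borel_measurable_continuous_onI[OF assms] by (intro integral_completion) measurable

lemma set_integrable_lebesgue_E:
  fixes f :: "real^'d \<Rightarrow> real"
  assumes "continuous_on UNIV f"
  shows "set_integrable lebesgue E f"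
  using integrable_continuous_compact[OF compact_E assms] unfolding set_integrable_def
  by (intro integrable_completion[THEN iffD2]) (auto dest: borel_measurable_integrable)

lemma volume_integral:
  fixes f :: "real^'d \<Rightarrow> real"
  assumes "continuous_on UNIV f"
  shows "(LINT x:E|lborel. f x) = \<bar>det B\<bar> * (LINT y:ref_cube|lborel. f (chart y))"
proof -
  note [measurable] = borel_measurable_continuous_onI[OF assms]
  have "indicator E (chart y) = (indicator ref_cube y :: real)" for y
    by (auto simp: indicator_def mem_E ref_cube_def)
  then show ?thesis
    unfolding set_lebesgue_integral_def
    by (subst lborel_integral_affine_matrix[OF det_B, of _ b]) (simp_all add: chart_def[symmetric])
qed

text \<open>The orthogonal projection onto the hyperplane that carries the face.\<close>

definition face_proj :: "'d \<Rightarrow> real \<Rightarrow> real^'d \<Rightarrow> real^'d" where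
  "face_proj i s y = y - ((coords y $ i - s) / norm (conormal i)) *\<^sub>R unormal i"

lemma coords_face_proj [simp]: "coords (face_proj i s y) $ i = s"
  using coords_add[of y "- ((coords y $ i - s) / norm (conormal i)) *\<^sub>R unormal i" i]
  by (simp add: face_proj_def)

lemma dist_face_proj: "dist y (face_proj i s y) = \<bar>coords y $ i - s\<bar> / norm (conormal i)"
  by (simp add: face_proj_def dist_norm)

lemma closest_point_affine_hull_face:
  assumes s: "s \<in> {0, 1}"
  shows "closest_point (affine hull (face i s)) y = face_proj i s y"
proof (rule closest_point_unique[symmetric])
  show "convex (affine hull (face i s))"
    by (simp add: affine_imp_convex affine_affine_hull)
  show "closed (affine hull (face i s))" by (rule closed_affine_hull)
  show "face_proj i s y \<in> affine hull (face i s)"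
    by (simp add: affine_hull_face[OF s])
  show "\<forall>z\<in>affine hull (face i s). dist y (face_proj i s y) \<le> dist y z"
  proof
    fix z assume "z \<in> affine hull (face i s)"
    then have "conormal i \<bullet> (y - z) = coords y $ i - s"
      by (simp add: affine_hull_face[OF s] coords_diff)
    then have "\<bar>coords y $ i - s\<bar> \<le> norm (conormal i) * norm (y - z)"
      by (metis Cauchy_Schwarz_ineq2)
    then show "dist y (face_proj i s y) \<le> dist y z"
      unfolding dist_face_proj by (simp add: divide_le_eq dist_norm mult.commute)
  qed
qed

text \<open>
  Parametrises the slab over a face by the unit cube: the coordinate \<open>i\<close>, constant
  on the face, now measures the signed distance from it, with the shift by \<open>1/2\<close>
  putting the face in the middle.
\<close>

definition slab_chart :: "'d \<Rightarrow> real \<Rightarrow> real^'d \<Rightarrow> real^'d" where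
  "slab_chart i s z = chart (set_coord i s z) + (z $ i - 1/2) *\<^sub>R unormal i"

lemma coords_slab_chart: "coords (slab_chart i s z) $ i = s + (z $ i - 1/2) * norm (conormal i)"
  by (simp add: slab_chart_def coords_add)

lemma face_proj_slab_chart: "face_proj i s (slab_chart i s z) = chart (set_coord i s z)"
  unfolding face_proj_def coords_slab_chart by (simp add: slab_chart_def)

lemma mem_face_chart_set_coord: "s \<in> {0, 1} \<Longrightarrow> chart (set_coord i s z) \<in> face i s \<longleftrightarrow> (\<forall>j. j \<noteq> i \<longrightarrow> 0 \<le> z $ j \<and> z $ j \<le> 1)"
  by (auto simp: mem_face mem_E)

lemma slab_chart_mem_slab:
  assumes s: "s \<in> {0, 1}"
  shows "slab_chart i s z \<in> slab (face i s) \<longleftrightarrow> z \<in> ref_cube"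
proof -
  have "slab_chart i s z \<in> slab (face i s) \<longleftrightarrow>
      (\<forall>j. j \<noteq> i \<longrightarrow> 0 \<le> z $ j \<and> z $ j \<le> 1) \<and> \<bar>z $ i - 1/2\<bar> \<le> 1/2"
    by (simp add: slab_def closest_point_affine_hull_face[OF s] face_proj_slab_chart dist_face_proj coords_slab_chart
        mem_face_chart_set_coord[OF s] abs_mult)
  also have "\<bar>z $ i - 1/2\<bar> \<le> 1/2 \<longleftrightarrow> 0 \<le> z $ i \<and> z $ i \<le> 1"
    by (auto simp: abs_if)
  finally show ?thesis by (auto simp: ref_cube_def)
qed

text \<open>
  The linear part is \<open>B\<close> with its \<open>i\<close>-th column replaced by the unit
  normal. By Cramer's rule its determinant is \<open>det B\<close> times the \<open>i\<close>-th
  coordinate of the unit normal with respect to the columns of \<open>B\<close>, and this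
  coordinate is the norm of the conormal.
\<close>

lemma slab_chart_affine:
  obtains B' where "\<And>z. slab_chart i s z = B' *v z + slab_chart i s 0"
    and "\<bar>det B'\<bar> = norm (conormal i) * \<bar>det B\<bar>"
proof
  let ?B' = "\<chi> k j. if j = i then (B *v (matrix_inv B *v unormal i)) $ k else B $ k $ j"
  have "(matrix_inv B *v unormal i) $ i = conormal i \<bullet> unormal i"
    using conormal_B[of i "matrix_inv B *v unormal i"] by (simp add: B_inv)
  then show "\<bar>det ?B'\<bar> = norm (conormal i) * \<bar>det B\<bar>"
    by (subst cramer_lemma) (simp add: abs_mult)
  fix z
  have eq: "set_coord i s z = set_coord i s 0 + set_coord i 0 z"
    by (auto simp: vec_eq_iff)
  have "slab_chart i s z = slab_chart i s 0 + (B *v set_coord i 0 z + z $ i *\<^sub>R unormal i)"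
    unfolding slab_chart_def by (subst eq) (simp add: chart_def matrix_vector_right_distrib algebra_simps)
  also have "B *v set_coord i 0 z + z $ i *\<^sub>R unormal i = ?B' *v z"
  proof (unfold B_inv vec_eq_iff, intro allI)
    fix k
    let ?A = "\<chi> k j. if j = i then unormal i $ k else B $ k $ j"
    have "(?A *v z) $ k = (\<Sum>j\<in>UNIV. B $ k $ j * set_coord i 0 z $ j + (if j = i then z $ i * unormal i $ k else 0))"
      unfolding matrix_vector_mult_def by (auto intro!: sum.cong)
    then show "(B *v set_coord i 0 z + z $ i *\<^sub>R unormal i) $ k = (?A *v z) $ k"
      by (simp add: sum.distrib matrix_vector_mult_def)
  qed
  finally show "slab_chart i s z = ?B' *v z + slab_chart i s 0" by (simp add: add.commute)
qed

lemma continuous_on_face_proj: "continuous_on UNIV (face_proj i s)"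
  unfolding face_proj_def by (intro continuous_intros) simp_all

lemma slab_face_closed: "s \<in> {0, 1} \<Longrightarrow> closed (slab (face i s))"
proof -
  assume s: "s \<in> {0, 1}"
  have "compact (face i s)"
    using compact_E convex_E face_face_of[OF s] face_of_imp_compact by blast
  then have "closed (face_proj i s -` face i s)"
    by (intro closed_vimage compact_imp_closed continuous_on_face_proj)
  moreover have "closed {y. dist y (face_proj i s y) \<le> 1/2}"
    by (intro closed_Collect_le continuous_intros continuous_on_face_proj)
  moreover have "slab (face i s) = face_proj i s -` face i s \<inter> {y. dist y (face_proj i s y) \<le> 1/2}"
    by (auto simp: slab_def closest_point_affine_hull_face[OF s])
  ultimately show ?thesis by auto
qed

text \<open>
  The slab is an affine image of the unit cube, and projecting it to the hyperplane of the face
  corresponds to freezing the coordinate \<open>i\<close>. The factor in front is the area of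
  the face.
\<close>

lemma face_integral:
  fixes f :: "real^'d \<Rightarrow> real"
  assumes s: "s \<in> {0, 1}" and f: "continuous_on UNIV f"
  shows "(LINT x|face_measure (face i s). f x) =
    norm (conormal i) * \<bar>det B\<bar> * (LINT z:ref_cube|lborel. f (chart (set_coord i s z)))"
    and "integrable (face_measure (face i s)) f"
proof -
  let ?S = "slab (face i s)"
  note [measurable] = borel_measurable_continuous_onI[OF f] borel_measurable_continuous_onI[OF continuous_on_face_proj, of i s]
    borel_closed[OF slab_face_closed[OF s], of i]
  have face_proj: "face_proj i s \<in> restrict_space lborel ?S \<rightarrow>\<^sub>M restrict_space borel (face i s)"
    by (intro measurable_restrict_space3) (auto simp: slab_def closest_point_affine_hull_face[OF s])
  have f': "f \<in> borel_measurable (restrict_space borel (face i s))"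
    by (intro measurable_restrict_space1) measurable
  have fm: "face_measure (face i s) = distr (restrict_space lborel ?S) (restrict_space borel (face i s)) (face_proj i s)"
    unfolding face_measure_def by (rule distr_cong) (auto simp: closest_point_affine_hull_face[OF s])
  obtain B' where B': "\<And>z. slab_chart i s z = B' *v z + slab_chart i s 0" "\<bar>det B'\<bar> = norm (conormal i) * \<bar>det B\<bar>"
    by (rule slab_chart_affine[of i s]) blast
  then have "det B' \<noteq> 0" using det_B by auto
  have ind: "indicator ?S (slab_chart i s z) = (indicator ref_cube z :: real)" for z
    by (simp add: indicator_def slab_chart_mem_slab[OF s])
  have "(LINT x|face_measure (face i s). f x) = (LINT y|restrict_space lborel ?S. f (face_proj i s y))"
    unfolding fm by (rule integral_distr[OF face_proj f'])
  also have "\<dots> = (LINT y|lborel. indicator ?S y *\<^sub>R f (face_proj i s y))"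
    by (rule integral_restrict_space) simp
  also have "\<dots> = \<bar>det B'\<bar> * (LINT z|lborel. indicator ?S (B' *v z + slab_chart i s 0) *\<^sub>R f (face_proj i s (B' *v z + slab_chart i s 0)))"
    by (rule lborel_integral_affine_matrix[OF \<open>det B' \<noteq> 0\<close>]) measurable
  also have "\<dots> = norm (conormal i) * \<bar>det B\<bar> * (LINT z:ref_cube|lborel. f (chart (set_coord i s z)))"
    unfolding B'(1)[symmetric] B'(2) by (simp add: set_lebesgue_integral_def face_proj_slab_chart ind)
  finally show "(LINT x|face_measure (face i s). f x) =
    norm (conormal i) * \<bar>det B\<bar> * (LINT z:ref_cube|lborel. f (chart (set_coord i s z)))" .
  have "bounded ?S"
  proof -
    have "?S \<subseteq> slab_chart i s ` ref_cube"
    proof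
      fix y assume y: "y \<in> ?S"
      \<comment> \<open>the parameters of \<open>y\<close>: coordinates of its foot point, and its distance from the hyperplane\<close>
      define z where "z = set_coord i ((coords y $ i - s) / norm (conormal i) + 1/2) (coords (face_proj i s y))"
      have "slab_chart i s z = chart (set_coord i s (coords (face_proj i s y))) + ((coords y $ i - s) / norm (conormal i)) *\<^sub>R unormal i"
        by (simp add: slab_chart_def z_def)
      also have "set_coord i s (coords (face_proj i s y)) = coords (face_proj i s y)"
        by (auto simp: vec_eq_iff)
      finally have "slab_chart i s z = y" by (simp add: face_proj_def)
      with y show "y \<in> slab_chart i s ` ref_cube"
        using slab_chart_mem_slab[OF s] by blast
    qed
    moreover have "compact (slab_chart i s ` ref_cube)"
      unfolding slab_chart_def
      by (intro compact_continuous_image compact_ref_cube continuous_intros)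
    ultimately show ?thesis using bounded_subset compact_imp_bounded by blast
  qed
  then have "compact ?S"
    using slab_face_closed[OF s] by (simp add: compact_eq_bounded_closed)
  then have "set_integrable lborel ?S (\<lambda>y. f (face_proj i s y))"
    by (intro integrable_continuous_compact continuous_on_compose2[OF f continuous_on_face_proj]) auto
  then show "integrable (face_measure (face i s)) f"
    unfolding fm by (subst integrable_distr_eq[OF face_proj f']) (simp add: integrable_restrict_space set_integrable_def)
qed

text \<open>
  With respect to the edges, a direction \<open>v\<close> has the coordinates \<open>conormal i
  \<bullet> v\<close>, so the integral pulled back to the cube splits into one contribution for
  each coordinate direction. The volume factor \<open>\<bar>det B\<bar>\<close> times the
  conormal is the area of a face times its unit normal, which turns the difference over two
  opposite faces of the cube into outward fluxes.
\<close>

theorem gauss: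
  fixes f :: "real^'d \<Rightarrow> real"
  assumes der: "\<And>x. (f has_derivative f' x) (at x)"
    and cont: "\<And>v. continuous_on UNIV (\<lambda>x. f' x v)"
  shows "(LINT x:E|lebesgue. f' x v) =
    (\<Sum>e\<in>{e. e facet_of E}. (outer_normal E e \<bullet> v) * (LINT x|face_measure e. f x))"
proof -
  have contf: "continuous_on UNIV f"
    using der by (intro has_derivative_continuous_on) auto
  let ?F = "\<lambda>i s. LINT z:ref_cube|lborel. f (chart (set_coord i s z))"
  have lin: "linear (f' x)" for x using has_derivative_linear[OF der] .
  have "v = (\<Sum>i\<in>UNIV. (conormal i \<bullet> v) *\<^sub>R (B *v axis i 1))"
  proof -
    have c: "(matrix_inv B *v v) $ i = conormal i \<bullet> v" for i
      using conormal_B[of i "matrix_inv B *v v"] by (simp add: B_inv)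
    have "v = B *v (matrix_inv B *v v)" by (simp add: B_inv)
    also have "\<dots> = (\<Sum>i\<in>UNIV. (matrix_inv B *v v) $ i *\<^sub>R (B *v axis i 1))"
      by (subst matrix_mult_sum) (simp add: matrix_vector_mult_basis scalar_mult_eq_scaleR)
    finally show ?thesis by (simp only: c)
  qed
  from arg_cong[OF this, of "f' x" for x] have v: "f' x v = (\<Sum>i\<in>UNIV. (conormal i \<bullet> v) * f' x (B *v axis i 1))" for x
    by (simp add: linear_sum[OF lin] linear_cmul[OF lin])
  have derG: "((\<lambda>y. f (chart y)) has_derivative (\<lambda>h. f' (chart y) (B *v h))) (at y)" for y
  proof (rule has_derivative_compose[OF _ der])
    show "(chart has_derivative (*v) B) (at y)"
      unfolding chart_def
      using has_derivative_add[OF linear_imp_has_derivative[OF matrix_vector_mul_linear] has_derivative_const] by simp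
  qed
  have contG: "continuous_on UNIV (\<lambda>y. f' (chart y) w)" for w
    by (intro continuous_on_compose2[OF cont] continuous_intros subset_UNIV)
  have "(LINT x:E|lebesgue. f' x v) = \<bar>det B\<bar> * (LINT y:ref_cube|lborel. f' (chart y) v)"
    by (simp add: set_integral_lebesgue_E volume_integral cont)
  also have "(LINT y:ref_cube|lborel. f' (chart y) v) =
      (\<Sum>i\<in>UNIV. (conormal i \<bullet> v) * (LINT y:ref_cube|lborel. f' (chart y) (B *v axis i 1)))"
  proof -
    have int: "integrable lborel (\<lambda>y. indicator ref_cube y *\<^sub>R f' (chart y) w)" for w
      using integrable_continuous_compact[OF compact_ref_cube contG] by (simp add: set_integrable_def)
    have "(LINT y:ref_cube|lborel. f' (chart y) v) =
      (LINT y|lborel. (\<Sum>i\<in>UNIV. (conormal i \<bullet> v) * (indicator ref_cube y *\<^sub>R f' (chart y) (B *v axis i 1))))"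
      unfolding set_lebesgue_integral_def
      by (intro Bochner_Integration.integral_cong refl, subst v) (simp add: sum_distrib_left mult.left_commute)
    also have "\<dots> = (\<Sum>i\<in>UNIV. (conormal i \<bullet> v) * (LINT y:ref_cube|lborel. f' (chart y) (B *v axis i 1)))"
      unfolding set_lebesgue_integral_def
      by (subst Bochner_Integration.integral_sum) (intro integrable_mult_right int, simp)
    finally show ?thesis .
  qed
  also have "\<dots> = (\<Sum>i\<in>UNIV. (conormal i \<bullet> v) * (?F i 1 - ?F i 0))"
    by (subst gauss_ref_cube[OF derG contG]) simp
  also have "\<bar>det B\<bar> * \<dots> = (\<Sum>i\<in>UNIV. \<Sum>s\<in>{0, 1}. ((2 * s - 1) * (unormal i \<bullet> v)) * (norm (conormal i) * \<bar>det B\<bar> * ?F i s))"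
  proof -
    have "norm (conormal i) * (unormal i \<bullet> v) = conormal i \<bullet> v" for i
      by (simp add: unormal_def)
    then show ?thesis
      unfolding sum_distrib_left by (intro sum.cong refl) (simp add: algebra_simps flip: \<open>\<And>i. _ = conormal i \<bullet> v\<close>)
  qed
  also have "\<dots> = (\<Sum>i\<in>UNIV. \<Sum>s\<in>{0, 1}. (outer_normal E (face i s) \<bullet> v) * (LINT x|face_measure (face i s). f x))"
    by (intro sum.cong refl) (simp add: outer_normal_face face_integral[OF _ contf])
  also have "\<dots> = (\<Sum>(i, s)\<in>UNIV \<times> {0, 1}. (outer_normal E (face i s) \<bullet> v) * (LINT x|face_measure (face i s). f x))"
    by (rule sum.cartesian_product)
  also have "\<dots> = (\<Sum>e\<in>{e. e facet_of E}. (outer_normal E e \<bullet> v) * (LINT x|face_measure e. f x))"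
  proof (rule sum.reindex_cong[symmetric])
    show "inj_on (\<lambda>(i, s). face i s) (UNIV \<times> {0, 1})"
      by (auto simp: inj_on_def face_eq_iff)
    show "{e. e facet_of E} = (\<lambda>(i, s). face i s) ` (UNIV \<times> {0, 1})"
      by (auto simp: facet_of_E_iff)
  qed auto
  finally show ?thesis .
qed

lemma finite_facets: "finite {e. e facet_of E}"
proof -
  have "{e. e facet_of E} = (\<lambda>(i, s). face i s) ` (UNIV \<times> {0, 1})"
    by (auto simp: facet_of_E_iff)
  then show ?thesis by simp
qed

end

section \<open>Elements on the two sides of a face\<close>

locale mesh =
  fixes T :: "'d::finite dg_data"
  assumes affine_cuboid_mesh: "affine_cuboid_mesh T"
begin

lemma mesh_facts:
  "open (omega T)" "interior (closure (omega T)) = omega T" "gamD T \<subseteq> frontier (omega T)"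
  "finite (elems T)" "\<Union>(elems T) = closure (omega T)"
  "\<forall>E\<in>elems T. det (Bmat T E) \<noteq> 0 \<and> E = mu T E ` ref_cube"
  "\<forall>E\<in>elems T. \<forall>F\<in>elems T. (E \<inter> F) face_of E \<and> (E \<inter> F) face_of F"
  "\<forall>e\<in>faces T. e \<subseteq> frontier (omega T) \<longrightarrow> e \<in> dir_faces T \<or> e \<in> neu_faces T"
  "\<forall>e\<in>faces T. side1 T e \<in> elems T \<and> e facet_of side1 T e"
  "\<forall>e\<in>int_faces T. side2 T e \<in> elems T \<and> e facet_of side2 T e \<and> side1 T e \<noteq> side2 T e"
  using affine_cuboid_mesh unfolding affine_cuboid_mesh_def by - (elim conjE, assumption)+

lemmas finite_elems = mesh_facts(4)
lemmas Union_elems = mesh_facts(5)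
lemmas regular_omega = mesh_facts(1,2)
lemmas conforming = mesh_facts(7)[rule_format]

lemma side1: "e \<in> faces T \<Longrightarrow> side1 T e \<in> elems T" "e \<in> faces T \<Longrightarrow> e facet_of side1 T e"
  using mesh_facts(9) by auto

lemma side2: "e \<in> int_faces T \<Longrightarrow> side2 T e \<in> elems T" "e \<in> int_faces T \<Longrightarrow> e facet_of side2 T e"
  "e \<in> int_faces T \<Longrightarrow> side1 T e \<noteq> side2 T e"
  using mesh_facts(10) by auto

lemma int_faces_subset: "int_faces T \<subseteq> faces T"
  by (auto simp: int_faces_def faces_def)

lemma int_faceD: "e \<in> int_faces T \<Longrightarrow> e \<in> faces T"
  using int_faces_subset by auto

lemma element_parallelepiped: "E \<in> elems T \<Longrightarrow> parallelepiped (Bmat T E) (bvec T E) E"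
  using mesh_facts(6) by (simp add: parallelepiped_def mu_def[abs_def])

lemma interior_subset_omega:
  assumes "E \<in> elems T" shows "interior E \<subseteq> omega T"
proof -
  have "E \<subseteq> closure (omega T)" using assms Union_elems by blast
  from interior_mono[OF this] show ?thesis by (simp add: regular_omega)
qed

text \<open>
  In a conforming mesh two elements meet in a common face of both, and a face that meets the
  interior is the whole element.
\<close>

lemma disjoint_interiors:
  assumes "E \<in> elems T" "F \<in> elems T" "E \<noteq> F"
  shows "interior E \<inter> interior F = {}"
proof (rule ccontr)
  assume "interior E \<inter> interior F \<noteq> {}"
  then obtain x where "x \<in> interior E" "x \<in> interior F" by blast
  then have "x \<in> (E \<inter> F) \<inter> interior E" "x \<in> (E \<inter> F) \<inter> interior F"
    using interior_subset[of E] interior_subset[of F] by auto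
  then have "E \<inter> F = E" "E \<inter> F = F"
    using conforming[OF assms(1,2)] face_of_disjoint_interior[of "E \<inter> F" E]
      face_of_disjoint_interior[of "E \<inter> F" F] by auto
  with \<open>E \<noteq> F\<close> show False by simp
qed

lemma outer_normal_props:
  assumes "E \<in> elems T" "e facet_of E"
  shows "norm (outer_normal E e) = 1" "\<And>x y. x \<in> e \<Longrightarrow> y \<in> E \<Longrightarrow> (y - x) \<bullet> outer_normal E e \<le> 0"
proof -
  interpret parallelepiped "Bmat T E" "bvec T E" E using assms(1) by (rule element_parallelepiped)
  obtain i s where s: "s \<in> {0, 1}" "e = face i s"
    using assms(2) facet_of_E_iff by auto
  show "norm (outer_normal E e) = 1" "\<And>x y. x \<in> e \<Longrightarrow> y \<in> E \<Longrightarrow> (y - x) \<bullet> outer_normal E e \<le> 0"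
    using outer_normal_unique[OF s(1), of "outer_normal E e" i] outer_normal_face[OF s(1), of i] s(2) by blast+
qed

lemma rel_interior_facet_nonempty:
  assumes "e facet_of E" "E \<in> elems T"
  obtains x where "x \<in> rel_interior e"
proof -
  interpret parallelepiped "Bmat T E" "bvec T E" E using assms(2) by (rule element_parallelepiped)
  have "convex e" "e \<noteq> {}"
    using assms by (auto simp: facet_of_def dest: face_of_imp_convex)
  then show ?thesis using that rel_interior_eq_empty by blast
qed

lemmas half_space_at_facet = parallelepiped.locally_half_space[OF element_parallelepiped]

text \<open>
  Both are unit normals of one hyperplane, so they agree up to sign. If they were equal, a small
  step inwards from a relatively interior point of the face would enter both interiors.
\<close>

lemma opposite_normals:
  assumes E: "E \<in> elems T" "e facet_of E" and F: "F \<in> elems T" "e facet_of F" and "E \<noteq> F"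
  shows "outer_normal F e = - outer_normal E e"
proof -
  interpret parallelepiped "Bmat T E" "bvec T E" E using E(1) by (rule element_parallelepiped)
  obtain i s where s: "s \<in> {0, 1}" and e: "e = face i s"
    using E(2) facet_of_E_iff by auto
  let ?n = "outer_normal E e" and ?m = "outer_normal F e"
  have "?m \<bullet> (y - x) = 0" if "x \<in> face i s" "y \<in> face i s" for x y
  proof -
    have "x \<in> F" "y \<in> F" using that facet_of_imp_subset[OF F(2)] e by auto
    then have "(y - x) \<bullet> ?m \<le> 0" "(x - y) \<bullet> ?m \<le> 0"
      using outer_normal_props(2)[OF F] that e by auto
    then show ?thesis by (simp add: inner_diff_left inner_diff_right inner_commute)
  qed
  from orthogonal_to_face[of s ?m i, OF s outer_normal_props(1)[OF F] this]
  have "?m = ?n \<or> ?m = - ?n"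
    using s by (auto simp: e outer_normal_face)
  moreover have "?m \<noteq> ?n"
  proof
    assume eq: "?m = ?n"
    obtain x where x: "x \<in> rel_interior e" using rel_interior_facet_nonempty[OF E(2,1)] .
    obtain r1 where r1: "r1 > 0" "\<And>y. y \<in> ball x r1 \<Longrightarrow> (y - x) \<bullet> ?n < 0 \<Longrightarrow> y \<in> interior E"
      using half_space_at_facet[OF E x] by blast
    obtain r2 where r2: "r2 > 0" "\<And>y. y \<in> ball x r2 \<Longrightarrow> (y - x) \<bullet> ?n < 0 \<Longrightarrow> y \<in> interior F"
      using half_space_at_facet[OF F x] unfolding eq by blast
    define y where "y = x - (min r1 r2 / 2) *\<^sub>R ?n"
    have d: "dist x y = min r1 r2 / 2"
      using r1(1) r2(1) outer_normal_props(1)[OF E] by (simp add: y_def dist_norm)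
    have "dist x y < r1" "dist x y < r2"
      using r1(1) r2(1) unfolding d by linarith+
    moreover have "(y - x) \<bullet> ?n < 0"
      using r1(1) r2(1) outer_normal_props(1)[OF E] by (simp add: y_def norm_eq_1)
    ultimately have "y \<in> interior E" "y \<in> interior F"
      by (auto intro!: r1(2) r2(2))
    then show False using disjoint_interiors[OF E(1) F(1) \<open>E \<noteq> F\<close>] by blast
  qed
  ultimately show ?thesis by blast
qed

lemma outer_normal_sides:
  "outer_normal (side1 T e) e = nrm T e"
  "e \<in> int_faces T \<Longrightarrow> outer_normal (side2 T e) e = - nrm T e"
  using opposite_normals[of "side1 T e" e "side2 T e"] side1[of e] side2[of e] int_faceD[of e]
  by (auto simp: nrm_def)

text \<open>Three elements at one face would have pairwise opposite unit normals, which is impossible.\<close>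

lemma elements_at_int_face:
  assumes e: "e \<in> int_faces T"
  shows "{E \<in> elems T. e facet_of E} = {side1 T e, side2 T e}"
proof -
  have s: "side1 T e \<in> elems T" "e facet_of side1 T e" "side2 T e \<in> elems T" "e facet_of side2 T e"
    using side1[OF int_faceD[OF e]] side2[OF e] by simp_all
  have "E = side1 T e \<or> E = side2 T e" if E: "E \<in> elems T" "e facet_of E" for E
  proof (rule ccontr)
    assume "\<not> ?thesis"
    then have "outer_normal E e = - outer_normal (side1 T e) e" "outer_normal E e = - outer_normal (side2 T e) e"
      using opposite_normals[of "side1 T e" e E] opposite_normals[of "side2 T e" e E] s E by auto
    then have "2 *\<^sub>R nrm T e = 0"
      unfolding scaleR_2 using outer_normal_sides(1)[of e] outer_normal_sides(2)[OF e] by simp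
    then have "nrm T e = 0" by simp
    then show False
      using outer_normal_props(1)[OF s(1,2)] outer_normal_sides(1)[of e] by simp
  qed
  with s show ?thesis by blast
qed

lemma elements_at_boundary_face:
  assumes e: "e \<in> faces T - int_faces T"
  shows "{E \<in> elems T. e facet_of E} = {side1 T e}"
  using e side1[of e] by (auto simp: int_faces_def)

text \<open>
  Around a relatively interior point of the face, the two elements cover a half-ball each. The
  point is therefore interior to the closed domain, hence in the domain, which has no slits.
\<close>

lemma int_face_meets_omega:
  assumes e: "e \<in> int_faces T" and x: "x \<in> rel_interior e"
  shows "x \<in> omega T"
proof -
  let ?E = "side1 T e" and ?F = "side2 T e"
  have s: "?E \<in> elems T" "e facet_of ?E" "?F \<in> elems T" "e facet_of ?F"
    using side1[OF int_faceD[OF e]] side2[OF e] by simp_all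
  obtain r1 where r1: "r1 > 0" "\<And>y. y \<in> ball x r1 \<Longrightarrow> (y - x) \<bullet> nrm T e \<le> 0 \<Longrightarrow> y \<in> ?E"
    using half_space_at_facet[OF s(1,2) x] unfolding outer_normal_sides(1) by blast
  obtain r2 where r2: "r2 > 0" "\<And>y. y \<in> ball x r2 \<Longrightarrow> - ((y - x) \<bullet> nrm T e) \<le> 0 \<Longrightarrow> y \<in> ?F"
    using half_space_at_facet[OF s(3,4) x] unfolding outer_normal_sides(2)[OF e] inner_minus_right by blast
  have "ball x (min r1 r2) \<subseteq> ?E \<union> ?F"
  proof
    fix y assume "y \<in> ball x (min r1 r2)"
    then show "y \<in> ?E \<union> ?F"
      using r1(2)[of y] r2(2)[of y] by (cases "(y - x) \<bullet> nrm T e \<le> 0") auto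
  qed
  then have "ball x (min r1 r2) \<subseteq> closure (omega T)"
    using s Union_elems by blast
  then have "x \<in> interior (closure (omega T))"
    using r1(1) r2(1) by (meson centre_in_ball interior_maximal min_less_iff_conj open_ball subsetD)
  then show ?thesis by (simp add: regular_omega)
qed

text \<open>
  A relatively interior point of the face lies in no second element, since by conformity the
  face would be a facet of that element, too, and hence interior. So the closed domain coincides
  with a single element near this point, which is on the boundary of that element.
\<close>

lemma boundary_face_subset_frontier:
  assumes e: "e \<in> faces T - int_faces T"
  shows "e \<subseteq> frontier (omega T)"
proof -
  let ?E = "side1 T e"
  have E: "?E \<in> elems T" "e facet_of ?E" using e side1[of e] by simp_all
  interpret parallelepiped "Bmat T ?E" "bvec T ?E" ?E using E(1) by (rule element_parallelepiped)
  have e_face: "e face_of ?E" using E(2) by (rule facet_of_imp_face_of)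
  have "rel_interior e \<subseteq> frontier (omega T)"
  proof
    fix x assume x: "x \<in> rel_interior e"
    then have "x \<in> e" using rel_interior_subset by blast
    then have "x \<in> ?E" using E(2) facet_of_imp_subset by blast
    have only: "x \<notin> F" if F: "F \<in> elems T" "F \<noteq> ?E" for F
    proof
      assume "x \<in> F"
      interpret F: parallelepiped "Bmat T F" "bvec T F" F using F(1) by (rule element_parallelepiped)
      have int: "(?E \<inter> F) face_of ?E" "(?E \<inter> F) face_of F"
        using conforming[OF E(1) F(1)] by auto
      have "e \<subseteq> ?E \<inter> F"
        using x \<open>x \<in> F\<close> \<open>x \<in> ?E\<close> by (intro subset_of_face_of[OF int(1) facet_of_imp_subset[OF E(2)]]) auto
      then have "e face_of F"
        using face_of_trans[OF face_of_subset[OF e_face, of "?E \<inter> F"] int(2)] by blast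
      then have "e facet_of F"
        using E(2) by (simp add: facet_of_def aff_dim_E F.aff_dim_E)
      then show False
        using e E F unfolding int_faces_def by blast
    qed
    have "closed (\<Union>(elems T - {?E}))"
      by (intro closed_Union ballI finite_Diff finite_elems)
        (auto intro: compact_imp_closed parallelepiped.compact_E[OF element_parallelepiped])
    moreover have "x \<notin> \<Union>(elems T - {?E})" using only by blast
    ultimately obtain r where r: "r > 0" "ball x r \<inter> \<Union>(elems T - {?E}) = {}"
      by (metis open_Compl ComplI disjoint_eq_subset_Compl open_contains_ball)
    have "x \<notin> omega T"
    proof
      assume "x \<in> omega T"
      then have "x \<in> interior (closure (omega T)) \<inter> ball x r"
        using r by (simp add: regular_omega)
      moreover have "interior (closure (omega T)) \<inter> ball x r \<subseteq> ?E"
        using r interior_subset[of "closure (omega T)"] Union_elems by blast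
      ultimately have "x \<in> interior ?E"
        by (meson interior_maximal open_Int open_ball open_interior subsetD)
      moreover have "e \<noteq> ?E" using E(2) by auto
      ultimately show False
        using face_of_disjoint_interior[OF e_face] \<open>x \<in> e\<close> by blast
    qed
    moreover have "x \<in> closure (omega T)" using \<open>x \<in> ?E\<close> E(1) Union_elems by blast
    ultimately show "x \<in> frontier (omega T)"
      by (simp add: frontier_def regular_omega interior_open)
  qed
  then have "closure (rel_interior e) \<subseteq> frontier (omega T)"
    by (simp add: closure_minimal)
  moreover have "convex e" using e_face by (rule face_of_imp_convex)
  ultimately show ?thesis
    using convex_closure_rel_interior closure_subset by fastforce
qed

text \<open>
  Interior faces reach into the open domain, whereas the Dirichlet and Neumann parts are
  disjoint subsets of its boundary.
\<close>

lemma faces_partition: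
  "faces T = int_faces T \<union> dir_faces T \<union> neu_faces T"
  "int_faces T \<inter> (dir_faces T \<union> neu_faces T) = {}" "dir_faces T \<inter> neu_faces T = {}"
proof -
  have "e \<in> dir_faces T \<union> neu_faces T" if "e \<in> faces T - int_faces T" for e
    using that boundary_face_subset_frontier[OF that] mesh_facts(8) by blast
  then show "faces T = int_faces T \<union> dir_faces T \<union> neu_faces T"
    using int_faces_subset by (auto simp: dir_faces_def neu_faces_def)
  have ne: "\<exists>x. x \<in> rel_interior e" if "e \<in> faces T" for e
    using that side1[OF that] rel_interior_facet_nonempty[of e "side1 T e"] by metis
  have gam: "gamD T \<subseteq> frontier (omega T)" "gamN T \<subseteq> frontier (omega T)" "gamD T \<inter> gamN T = {}"
    using mesh_facts(3) unfolding gamN_def by auto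
  have "frontier (omega T) \<inter> omega T = {}"
    by (simp add: frontier_disjoint_eq regular_omega)
  then have "\<not> rel_interior e \<subseteq> frontier (omega T)" if "e \<in> int_faces T" for e
    using that int_face_meets_omega[OF that] ne[of e] int_faces_subset by blast
  then show "int_faces T \<inter> (dir_faces T \<union> neu_faces T) = {}"
    using gam(1,2) by (auto simp: dir_faces_def neu_faces_def dest: subset_trans)
  show "dir_faces T \<inter> neu_faces T = {}"
    using gam ne by (fastforce simp: dir_faces_def neu_faces_def)
qed

lemma finite_faces: "finite (faces T)"
proof -
  have "faces T = (\<Union>E\<in>elems T. {e. e facet_of E})" by (auto simp: faces_def)
  then show ?thesis
    using finite_elems by (auto intro: parallelepiped.finite_facets[OF element_parallelepiped])
qed

lemma sum_over_element_faces:
  fixes X :: "(real^'d) set \<Rightarrow> (real^'d) set \<Rightarrow> real"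
  shows "A \<subseteq> faces T \<Longrightarrow> (\<Sum>E\<in>elems T. \<Sum>e\<in>{e\<in>A. e facet_of E}. X E e) = (\<Sum>e\<in>A. \<Sum>E\<in>{E\<in>elems T. e facet_of E}. X E e)"
  using finite_subset[OF _ finite_faces] by (intro sum.swap_restrict finite_elems) auto

lemma sum_int_faces:
  fixes X :: "(real^'d) set \<Rightarrow> (real^'d) set \<Rightarrow> real"
  shows "(\<Sum>E\<in>elems T. \<Sum>e\<in>{e\<in>int_faces T. e facet_of E}. X E e) =
    (\<Sum>e\<in>int_faces T. X (side1 T e) e + X (side2 T e) e)"
  unfolding sum_over_element_faces[OF int_faces_subset]
  by (intro sum.cong refl) (simp add: elements_at_int_face side2)

lemma sum_boundary_faces:
  fixes X :: "(real^'d) set \<Rightarrow> (real^'d) set \<Rightarrow> real"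
  assumes "A = dir_faces T \<or> A = neu_faces T"
  shows "(\<Sum>E\<in>elems T. \<Sum>e\<in>{e\<in>A. e facet_of E}. X E e) = (\<Sum>e\<in>A. X (side1 T e) e)"
proof -
  have "A \<subseteq> faces T - int_faces T" using assms faces_partition by blast
  then show ?thesis
    by (subst sum_over_element_faces) (auto intro!: sum.cong simp: elements_at_boundary_face)
qed

text \<open>
  Collects elementwise boundary terms into the face sums of the discrete forms: an interior face
  receives a contribution from either side, a boundary face from one.
\<close>

lemma sum_all_faces:
  fixes X :: "(real^'d) set \<Rightarrow> (real^'d) set \<Rightarrow> real"
  shows "(\<Sum>E\<in>elems T. \<Sum>e\<in>{e. e facet_of E}. X E e) =
    (\<Sum>e\<in>int_faces T. X (side1 T e) e + X (side2 T e) e) +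
    (\<Sum>e\<in>dir_faces T. X (side1 T e) e) + (\<Sum>e\<in>neu_faces T. X (side1 T e) e)"
proof -
  have fin: "finite (int_faces T)" "finite (dir_faces T)" "finite (neu_faces T)"
    using finite_faces faces_partition(1) by (auto intro: finite_subset)
  have "(\<Sum>e\<in>{e. e facet_of E}. X E e) = (\<Sum>e\<in>{e\<in>int_faces T. e facet_of E}. X E e) +
      (\<Sum>e\<in>{e\<in>dir_faces T. e facet_of E}. X E e) + (\<Sum>e\<in>{e\<in>neu_faces T. e facet_of E}. X E e)"
    if "E \<in> elems T" for E
  proof -
    have eq: "{e. e facet_of E} = ({e\<in>int_faces T. e facet_of E} \<union> {e\<in>dir_faces T. e facet_of E}) \<union> {e\<in>neu_faces T. e facet_of E}"
      using that faces_partition(1) unfolding faces_def by blast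
    have d: "{e\<in>int_faces T. e facet_of E} \<inter> {e\<in>dir_faces T. e facet_of E} = {}"
      "({e\<in>int_faces T. e facet_of E} \<union> {e\<in>dir_faces T. e facet_of E}) \<inter> {e\<in>neu_faces T. e facet_of E} = {}"
      using faces_partition(2,3) by blast+
    have f: "finite {e\<in>int_faces T. e facet_of E}" "finite {e\<in>dir_faces T. e facet_of E}"
      "finite {e\<in>neu_faces T. e facet_of E}"
      using fin by simp_all
    show ?thesis
      unfolding eq sum.union_disjoint[OF finite_UnI[OF f(1,2)] f(3) d(2)] sum.union_disjoint[OF f(1,2) d(1)] ..
  qed
  then show ?thesis
    by (simp add: sum.distrib sum_int_faces sum_boundary_faces)
qed

end

section \<open>Polynomials with a degree bound in each variable\<close>

definition monomial :: "('d::finite \<Rightarrow> nat) \<Rightarrow> real^'d \<Rightarrow> real" where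
  "monomial a x = (\<Prod>j\<in>UNIV. (x $ j) ^ a j)"

lemma finite_multi_indices: "finite {a :: 'd::finite \<Rightarrow> nat. \<forall>j. a j \<le> m j}"
proof -
  have "{a. \<forall>j. a j \<le> m j} = Pi\<^sub>E UNIV (\<lambda>j. {..m j})" by auto
  then show ?thesis by (simp add: finite_PiE)
qed

lemma polysE:
  assumes "q \<in> polys m"
  obtains c where "q = (\<lambda>x. \<Sum>a\<in>{a. \<forall>j. a j \<le> m j}. c a * monomial a x)"
  using assms unfolding polys_def monomial_def by fastforce

lemma monomial_polys:
  assumes "\<And>j. a j \<le> m j"
  shows "(\<lambda>x. c * monomial a x) \<in> polys m"
proof -
  have "(\<Sum>a'\<in>{a. \<forall>j. a j \<le> m j}. (if a' = a then c else 0) * monomial a' x) = c * monomial a x" for x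
  proof -
    have "(\<Sum>a'\<in>{a. \<forall>j. a j \<le> m j}. (if a' = a then c else 0) * monomial a' x)
      = (\<Sum>a'\<in>{a. \<forall>j. a j \<le> m j}. if a' = a then c * monomial a x else 0)"
      by (intro sum.cong) auto
    then show ?thesis using assms by (simp add: finite_multi_indices)
  qed
  then show ?thesis unfolding polys_def monomial_def
    by (intro CollectI exI[of _ "\<lambda>a'. if a' = a then c else 0"]) simp
qed

lemma polys_zero: "(\<lambda>x. 0) \<in> polys m"
  unfolding polys_def by (intro CollectI exI[of _ "\<lambda>a. 0"]) simp

lemma polys_add: "p \<in> polys m \<Longrightarrow> q \<in> polys m \<Longrightarrow> (\<lambda>x. p x + q x) \<in> polys m"
  by (elim polysE) (auto simp: polys_def monomial_def sum.distrib[symmetric] distrib_right[symmetric])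

lemma polys_cmult: "p \<in> polys m \<Longrightarrow> (\<lambda>x. r * p x) \<in> polys m"
proof (elim polysE)
  fix c assume "p = (\<lambda>x. \<Sum>a\<in>{a. \<forall>j. a j \<le> m j}. c a * monomial a x)"
  then show ?thesis unfolding polys_def monomial_def
    by (intro CollectI exI[of _ "\<lambda>a. r * c a"]) (simp add: sum_distrib_left mult.assoc)
qed

lemma polys_sum: "(\<And>i. i \<in> I \<Longrightarrow> f i \<in> polys m) \<Longrightarrow> (\<lambda>x. \<Sum>i\<in>I. f i x) \<in> polys m"
  by (induction I rule: infinite_finite_induct) (auto intro: polys_zero polys_add)

lemma polys_diff: "p \<in> polys m \<Longrightarrow> q \<in> polys m \<Longrightarrow> (\<lambda>x. p x - q x) \<in> polys m"
  using polys_add[of p m "\<lambda>x. (-1) * q x"] polys_cmult[of q m "-1"] by simp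

lemma polys_mono: "q \<in> polys m \<Longrightarrow> (\<And>j. m j \<le> m' j) \<Longrightarrow> q \<in> polys m'"
  by (elim polysE) (auto intro!: polys_sum monomial_polys intro: order_trans)

lemma real_polynomial_function_nth: "real_polynomial_function (\<lambda>x::real^'d::finite. x $ j)"
  by (intro real_polynomial_function.intros(1) bounded_linear_vec_nth)

lemma polys_imp_polynomial: "q \<in> polys m \<Longrightarrow> real_polynomial_function q"
  by (elim polysE) (simp add: monomial_def, intro real_polynomial_function_sum real_polynomial_function.intros(2,4)
      real_polynomial_function_prod real_polynomial_function_power real_polynomial_function_nth finite_multi_indices finite)

lemma monomial_set_coord: "monomial a (set_coord i s x) = s ^ a i * monomial (a(i := 0)) x"
  unfolding monomial_def by (subst (1 2) prod.remove[of UNIV i]) auto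

text \<open>
  Freezing a coordinate removes it from the polynomial; this is how the trace on a face becomes
  a polynomial in the face coordinates.
\<close>

lemma polys_set_coord:
  assumes "q \<in> polys (m :: 'd::finite \<Rightarrow> nat)"
  shows "(\<lambda>x. q (set_coord i s x)) \<in> polys (m(i := 0))"
  using assms
proof (elim polysE)
  fix c assume "q = (\<lambda>x. \<Sum>a\<in>{a. \<forall>j. a j \<le> m j}. c a * monomial a x)"
  then have "(\<lambda>x. q (set_coord i s x)) = (\<lambda>x. \<Sum>a\<in>{a. \<forall>j. a j \<le> m j}. (c a * s ^ a i) * monomial (a(i := 0)) x)"
    by (simp add: monomial_set_coord mult.assoc)
  then show ?thesis by (auto intro!: polys_sum monomial_polys)
qed

section \<open>Gradients and traces of polynomials\<close>

lemma real_polynomial_function_derivative: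
  "real_polynomial_function (f :: 'a::real_normed_vector \<Rightarrow> real) \<Longrightarrow>
    \<exists>f'. (\<forall>x. (f has_derivative f' x) (at x)) \<and> (\<forall>v. real_polynomial_function (\<lambda>x. f' x v))"
proof (induction rule: real_polynomial_function.induct)
  case (linear f)
  then show ?case
    by (intro exI[of _ "\<lambda>x. f"]) (auto intro: bounded_linear_imp_has_derivative)
next
  case (const c)
  then show ?case by (intro exI[of _ "\<lambda>x v. 0"]) auto
next
  case (add f g)
  then obtain f' g' where "\<forall>x. (f has_derivative f' x) (at x)" "\<forall>v. real_polynomial_function (\<lambda>x. f' x v)"
    "\<forall>x. (g has_derivative g' x) (at x)" "\<forall>v. real_polynomial_function (\<lambda>x. g' x v)" by blast
  then show ?case
    by (intro exI[of _ "\<lambda>x v. f' x v + g' x v"]) (auto intro!: has_derivative_add)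
next
  case (mult f g)
  then obtain f' g' where d: "\<forall>x. (f has_derivative f' x) (at x)" "\<forall>x. (g has_derivative g' x) (at x)"
    and p: "\<forall>v. real_polynomial_function (\<lambda>x. f' x v)" "\<forall>v. real_polynomial_function (\<lambda>x. g' x v)"
    by blast
  have "real_polynomial_function (\<lambda>x. f x * g' x v + f' x v * g x)" for v
    by (rule real_polynomial_function.intros(3); rule real_polynomial_function.intros(4)) (use mult.hyps p in auto)
  with d show ?case
    by (intro exI[of _ "\<lambda>x v. f x * g' x v + f' x v * g x"]) (auto intro!: has_derivative_mult)
qed

lemma has_derivative_imp_grad:
  fixes f :: "real^'d::finite \<Rightarrow> real"
  assumes "(f has_derivative f') (at x)"
  shows "f' v = grad f x \<bullet> v" "grad f x $ i = f' (axis i 1)"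
proof -
  have f': "frechet_derivative f (at x) = f'"
    using frechet_derivative_at[OF assms] by simp
  then show "grad f x $ i = f' (axis i 1)" by (simp add: grad_def)
  have "f' v = f' (\<Sum>i\<in>UNIV. v $ i *\<^sub>R axis i 1)"
    using basis_expansion[of v] by (simp add: scalar_mult_eq_scaleR)
  also have "\<dots> = grad f x \<bullet> v"
    using has_derivative_linear[OF assms]
    by (simp add: linear_sum linear_cmul inner_vec_def grad_def f' mult.commute)
  finally show "f' v = grad f x \<bullet> v" .
qed

lemma polynomial_grad:
  fixes f :: "real^'d::finite \<Rightarrow> real"
  assumes "real_polynomial_function f"
  shows "(f has_derivative (\<lambda>v. grad f x \<bullet> v)) (at x)"
    and "real_polynomial_function (\<lambda>x. grad f x \<bullet> v)"
    and "real_polynomial_function (\<lambda>x. grad f x $ i)"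
proof -
  obtain f' where f': "\<forall>x. (f has_derivative f' x) (at x)" "\<forall>v. real_polynomial_function (\<lambda>x. f' x v)"
    using real_polynomial_function_derivative[OF assms] by blast
  have eq: "f' x = (\<lambda>v. grad f x \<bullet> v)" for x using has_derivative_imp_grad(1)[of f "f' x" x] f' by auto
  then show "(f has_derivative (\<lambda>v. grad f x \<bullet> v)) (at x)" "real_polynomial_function (\<lambda>x. grad f x \<bullet> v)"
    using f' unfolding eq by auto
  have "(\<lambda>x. grad f x $ i) = (\<lambda>x. f' x (axis i 1))"
    using f' has_derivative_imp_grad(2) by blast
  then show "real_polynomial_function (\<lambda>x. grad f x $ i)" using f' by simp
qed

lemma continuous_polynomial: "real_polynomial_function f \<Longrightarrow> continuous_on S f"
  by (simp add: continuous_on_polymonial_function real_polynomial_function_eq)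

text \<open>
  The degree drops in the variable of differentiation only, which is the degree pattern of the
  space \<open>Psi_loc\<close>. For \<open>m i = 0\<close> the truncated subtraction does no
  harm: the exponent \<open>a i\<close>, which is \<open>0\<close>, is a factor of the
  coefficient.
\<close>

lemma polys_grad:
  assumes "q \<in> polys (m :: 'd::finite \<Rightarrow> nat)"
  shows "(\<lambda>x. grad q x $ i) \<in> polys (m(i := m i - 1))"
  using assms
proof (elim polysE)
  fix c assume q: "q = (\<lambda>x. \<Sum>a\<in>{a. \<forall>j. a j \<le> m j}. c a * monomial a x)"
  have "grad q x $ i = (\<Sum>a\<in>{a. \<forall>j. a j \<le> m j}. (c a * real (a i)) * monomial (a(i := a i - 1)) x)" for x
  proof (rule DERIV_unique)
    show "((\<lambda>t. q (set_coord i t x)) has_real_derivative grad q x $ i) (at (x $ i))"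
      using DERIV_set_coord[OF polynomial_grad(1)[OF polys_imp_polynomial[OF assms]], of i x "x $ i"]
      by (simp add: inner_axis)
    have "x $ i ^ (a i - 1) * monomial (a(i := 0)) x = monomial (a(i := a i - 1)) x" for a
      using monomial_set_coord[of "a(i := a i - 1)" i "x $ i" x] by simp
    then show "((\<lambda>t. q (set_coord i t x)) has_real_derivative
        (\<Sum>a\<in>{a. \<forall>j. a j \<le> m j}. (c a * real (a i)) * monomial (a(i := a i - 1)) x)) (at (x $ i))"
      unfolding q monomial_set_coord
      by (auto intro!: derivative_eq_intros sum.cong)
  qed
  then show ?thesis
    by (auto intro!: polys_sum monomial_polys diff_le_mono)
qed

lemma polys_degree_0:
  assumes "q \<in> polys (\<lambda>_. 0)" shows "\<exists>c. q = (\<lambda>_. c)"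
proof -
  have "{a :: 'a \<Rightarrow> nat. \<forall>j. a j \<le> 0} = {\<lambda>_. 0}" by auto
  with assms show ?thesis unfolding polys_def by auto
qed

text \<open>
  Derivatives are local: inside an element, those of a discontinuous function are those of its
  polynomial piece.
\<close>

lemma grad_cong_open:
  fixes f g :: "real^'d::finite \<Rightarrow> real"
  assumes "open S" "x \<in> S" "\<And>y. y \<in> S \<Longrightarrow> f y = g y" and g: "(g has_derivative g') (at x)"
  shows "(f has_derivative g') (at x)" "grad f x = grad g x"
proof -
  show f: "(f has_derivative g') (at x)"
    using has_derivative_transform_within_open[OF g assms(1,2)] assms(3) by auto
  show "grad f x = grad g x"
    by (simp add: vec_eq_iff has_derivative_imp_grad(2)[OF f] has_derivative_imp_grad(2)[OF g])
qed

lemma dvg_eq: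
  fixes v V :: "real^'d::finite \<Rightarrow> real^'d"
  assumes S: "open S" "x \<in> S" "\<And>y. y \<in> S \<Longrightarrow> v y = V y"
    and V: "\<And>i. real_polynomial_function (\<lambda>x. V x $ i)"
  shows "dvg v x = (\<Sum>i\<in>UNIV. grad (\<lambda>x. V x $ i) x $ i)"
proof -
  have "(V has_derivative (\<lambda>h. \<chi> i. grad (\<lambda>x. V x $ i) x \<bullet> h)) (at x)"
    by (subst has_derivative_componentwise_within)
      (auto simp: Basis_cart inner_axis intro!: polynomial_grad(1) V)
  then have "(v has_derivative (\<lambda>h. \<chi> i. grad (\<lambda>x. V x $ i) x \<bullet> h)) (at x)"
    by (rule has_derivative_transform_within_open[OF _ S(1,2)]) (simp add: S(3))
  from frechet_derivative_at[OF this, symmetric] show ?thesis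
    by (simp add: dvg_def inner_axis)
qed

context parallelepiped
begin

lemma nontrivial_trace: "x \<in> E \<Longrightarrow> \<not> trivial_limit (at x within interior E)"
proof (cases "x \<in> interior E")
  case True
  then show ?thesis by (simp add: trivial_limit_within interior_limit_point)
next
  case False
  assume "x \<in> E"
  with False have "x islimpt interior E"
    using closure_interior_E by (auto simp: closure_def)
  then show ?thesis by (simp add: trivial_limit_within)
qed

text \<open>
  The element is the closure of its interior, so the limit that defines the trace is taken at an
  accumulation point and is unique.
\<close>

lemma elt_trace_eq:
  fixes f g :: "real^'d \<Rightarrow> 'b::t2_space"
  assumes "x \<in> E" "\<And>y. y \<in> interior E \<Longrightarrow> f y = g y" "continuous_on UNIV g"
  shows "elt_trace E f x = g x"
  unfolding elt_trace_def
proof (rule tendsto_Lim[OF nontrivial_trace[OF assms(1)]])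
  have "(g \<longlongrightarrow> g x) (at x within interior E)"
    using assms(3) by (meson UNIV_I continuous_on_def tendsto_within_subset subset_UNIV)
  moreover have "eventually (\<lambda>y. f y = g y) (at x within interior E)"
    using assms(2) by (auto simp: eventually_at_filter)
  ultimately show "(f \<longlongrightarrow> g x) (at x within interior E)"
    by (simp add: tendsto_cong)
qed

text \<open>The boundary of a convex set is a null set.\<close>

lemma lebesgue_integral_cong_interior:
  fixes f g :: "real^'d \<Rightarrow> real"
  assumes fg: "\<And>y. y \<in> interior E \<Longrightarrow> f y = g y" and g: "continuous_on UNIV g"
  shows "(LINT x:E|lebesgue. f x) = (LINT x:E|lebesgue. g x)"
proof -
  have "negligible (frontier E)"
    using convex_E by (rule negligible_convex_frontier)
  then have "AE x in lebesgue. x \<notin> frontier E"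
    by (auto simp: negligible_iff_null_sets intro: AE_not_in)
  then have ae: "AE x in lebesgue. indicator E x *\<^sub>R f x = indicator E x *\<^sub>R g x"
  proof eventually_elim
    case (elim x)
    then have "x \<in> E \<Longrightarrow> x \<in> interior E" 
      using compact_E by (auto simp: frontier_def compact_imp_closed closure_closed)
    then show ?case using fg by (auto simp: indicator_def)
  qed
  have "(\<lambda>x. indicator E x *\<^sub>R g x) \<in> borel_measurable lebesgue"
    using borel_measurable_continuous_onI[OF g] by (intro measurable_completion) measurable
  moreover have "(\<lambda>x. indicator E x *\<^sub>R f x) \<in> borel_measurable lebesgue"
    using ae by (intro borel_measurable_AE[OF calculation]) auto
  ultimately show ?thesis
    unfolding set_lebesgue_integral_def by (intro integral_cong_AE ae)
qed

end

section \<open>Integration by parts\<close>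

abbreviation face_int :: "(real^'d::finite) set \<Rightarrow> (real^'d \<Rightarrow> real) \<Rightarrow> real" where
  "face_int e f \<equiv> LINT x|face_measure e. f x"

abbreviation vol_int :: "(real^'d::finite) set \<Rightarrow> (real^'d \<Rightarrow> real) \<Rightarrow> real" where
  "vol_int E f \<equiv> LINT x:E|lebesgue. f x"

lemma real_polynomial_function_inner:
  fixes V W :: "'a::real_normed_vector \<Rightarrow> real^'d::finite"
  assumes "\<And>i. real_polynomial_function (\<lambda>x. V x $ i)" "\<And>i. real_polynomial_function (\<lambda>x. W x $ i)"
  shows "real_polynomial_function (\<lambda>x. V x \<bullet> W x)"
  unfolding inner_vec_def inner_real_def
  by (intro real_polynomial_function_sum real_polynomial_function.intros(4) assms finite)

lemma continuous_vector_polynomial: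
  fixes V :: "real^'e::finite \<Rightarrow> real^'d::finite"
  assumes "\<And>i. real_polynomial_function (\<lambda>x. V x $ i)"
  shows "continuous_on S V"
proof -
  have "continuous_on S (\<lambda>x. \<chi> i. V x $ i)"
    by (intro continuous_on_vec_lambda continuous_polynomial assms)
  then show ?thesis by simp
qed

lemma space_face_measure: "space (face_measure e) = e"
  by (simp add: face_measure_def space_restrict_space)

lemma face_int_cong: "(\<And>x. x \<in> e \<Longrightarrow> f x = g x) \<Longrightarrow> face_int e f = face_int e g"
  by (intro Bochner_Integration.integral_cong refl) (simp add: space_face_measure)

context parallelepiped
begin

lemma set_integrable_polynomial: "real_polynomial_function f \<Longrightarrow> set_integrable lebesgue E f"
  by (intro set_integrable_lebesgue_E continuous_polynomial)

lemma integrable_on_facet: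
  assumes "e facet_of E" "real_polynomial_function f"
  shows "integrable (face_measure e) f"
proof -
  obtain j s where s: "s \<in> {0, 1}" and e: "e = face j s"
    using assms(1) facet_of_E_iff by blast
  show ?thesis
    unfolding e by (intro face_integral(2)[OF s] continuous_polynomial assms)
qed

text \<open>
  The Gauss theorem for the products \<open>V\<^sub>i Q\<close> in direction \<open>i\<close>,
  summed over \<open>i\<close>.
\<close>

lemma gauss_vector:
  fixes V :: "real^'d \<Rightarrow> real^'d"
  assumes V: "\<And>i. real_polynomial_function (\<lambda>x. V x $ i)" and Q: "real_polynomial_function Q"
  shows "vol_int E (\<lambda>x. (\<Sum>i\<in>UNIV. grad (\<lambda>x. V x $ i) x $ i) * Q x) + vol_int E (\<lambda>x. V x \<bullet> grad Q x) =
    (\<Sum>e\<in>{e. e facet_of E}. face_int e (\<lambda>x. (V x \<bullet> outer_normal E e) * Q x))"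
proof -
  let ?D = "\<lambda>i x. V x $ i * (grad Q x $ i) + grad (\<lambda>x. V x $ i) x $ i * Q x"
  have poly: "real_polynomial_function (?D i)" for i
    by (intro real_polynomial_function.intros(3,4) V Q polynomial_grad(3))
  have poly1: "real_polynomial_function (\<lambda>x. V x \<bullet> grad Q x)"
    by (intro real_polynomial_function_inner V Q polynomial_grad(3))
  have poly2: "real_polynomial_function (\<lambda>x. (\<Sum>i\<in>UNIV. grad (\<lambda>x. V x $ i) x $ i) * Q x)"
    by (intro real_polynomial_function.intros(4) real_polynomial_function_sum finite V Q polynomial_grad(3))
  have gi: "vol_int E (?D i) =
      (\<Sum>e\<in>{e. e facet_of E}. outer_normal E e $ i * face_int e (\<lambda>x. V x $ i * Q x))" for i
  proof -
    let ?f' = "\<lambda>x v. V x $ i * (grad Q x \<bullet> v) + (grad (\<lambda>x. V x $ i) x \<bullet> v) * Q x"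
    have "continuous_on UNIV (\<lambda>x. ?f' x v)" for v
      by (intro continuous_polynomial real_polynomial_function.intros(3,4) polynomial_grad(2) V Q)
    from gauss[OF has_derivative_mult[OF polynomial_grad(1)[OF V] polynomial_grad(1)[OF Q]] this, of "axis i 1"]
    show ?thesis by (simp add: inner_axis)
  qed
  have int: "integrable (face_measure e) (\<lambda>x. V x $ i * Q x)" if "e facet_of E" for e i
    by (intro integrable_on_facet that real_polynomial_function.intros(4) V Q)
  have "vol_int E (\<lambda>x. (\<Sum>i\<in>UNIV. grad (\<lambda>x. V x $ i) x $ i) * Q x) + vol_int E (\<lambda>x. V x \<bullet> grad Q x) =
      vol_int E (\<lambda>x. (\<Sum>i\<in>UNIV. grad (\<lambda>x. V x $ i) x $ i) * Q x + V x \<bullet> grad Q x)"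
    by (intro set_integral_add(2)[symmetric] set_integrable_polynomial poly1 poly2)
  also have "\<dots> = vol_int E (\<lambda>x. \<Sum>i\<in>UNIV. ?D i x)"
    by (simp add: sum.distrib inner_vec_def sum_distrib_right add.commute)
  also have "\<dots> = (\<Sum>i\<in>UNIV. vol_int E (?D i))"
    using set_integrable_polynomial[OF poly] unfolding set_lebesgue_integral_def set_integrable_def scaleR_sum_right
    by (intro Bochner_Integration.integral_sum)
  also have "\<dots> = (\<Sum>e\<in>{e. e facet_of E}. \<Sum>i\<in>UNIV. outer_normal E e $ i * face_int e (\<lambda>x. V x $ i * Q x))"
    unfolding gi by (rule sum.swap)
  also have "\<dots> = (\<Sum>e\<in>{e. e facet_of E}. face_int e (\<lambda>x. (V x \<bullet> outer_normal E e) * Q x))"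
  proof (intro sum.cong refl)
    fix e assume "e \<in> {e. e facet_of E}"
    then have "(\<Sum>i\<in>UNIV. outer_normal E e $ i * face_int e (\<lambda>x. V x $ i * Q x)) =
        face_int e (\<lambda>x. (\<Sum>i\<in>UNIV. outer_normal E e $ i * (V x $ i * Q x)))"
      using int by (subst Bochner_Integration.integral_sum) auto
    also have "(\<lambda>x. (\<Sum>i\<in>UNIV. outer_normal E e $ i * (V x $ i * Q x))) = (\<lambda>x. (V x \<bullet> outer_normal E e) * Q x)"
      by (simp add: inner_vec_def sum_distrib_left sum_distrib_right mult_ac)
    finally show "(\<Sum>i\<in>UNIV. outer_normal E e $ i * face_int e (\<lambda>x. V x $ i * Q x)) =
        face_int e (\<lambda>x. (V x \<bullet> outer_normal E e) * Q x)" .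
  qed
  finally show ?thesis .
qed

lemma polynomial_coords: "real_polynomial_function P \<Longrightarrow> real_polynomial_function (P \<circ> coords)"
proof (rule real_polynomial_function_compose)
  have "real_polynomial_function (\<lambda>x. conormal i \<bullet> x + (- (conormal i \<bullet> b)))" for i
    by (intro real_polynomial_function.intros(1-3) bounded_linear_inner_right)
  then show "polynomial_function coords"
    by (auto simp: polynomial_function_iff_Basis_inner Basis_cart inner_axis coords_nth inner_diff_right)
qed

lemma polys_on_face:
  assumes "P \<in> polys (\<lambda>_. k)"
  obtains P' where "P' \<in> polys (\<lambda>j. if j = i then 0 else k)" "\<And>x. x \<in> ref_face i s \<Longrightarrow> P x = P' x"
proof
  show "(\<lambda>x. P (set_coord i s x)) \<in> polys (\<lambda>j. if j = i then 0 else k)"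
    using polys_set_coord[OF assms, of i s] by (simp add: fun_upd_def)
  show "P x = P (set_coord i s x)" if "x \<in> ref_face i s" for x
  proof -
    have "set_coord i s x = x" using that by (auto simp: ref_face_def vec_eq_iff)
    then show ?thesis by simp
  qed
qed

text \<open>
  The chain rule for \<open>P = (P \<circ> coords) \<circ> chart\<close>: partial derivatives in
  the reference coordinates are derivatives along the edges.
\<close>

lemma grad_comp_coords:
  assumes P: "P \<in> polys m"
  shows "grad P (coords x) $ i = grad (P \<circ> coords) x \<bullet> column i B"
proof -
  have "real_polynomial_function (P \<circ> coords)"
    by (intro polynomial_coords polys_imp_polynomial[OF P])
  then have "((P \<circ> coords) has_derivative (\<lambda>v. grad (P \<circ> coords) (chart (coords x)) \<bullet> v)) (at (chart (coords x)))"
    by (rule polynomial_grad(1))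
  moreover have "(chart has_derivative (*v) B) (at (coords x))"
    unfolding chart_def
    using has_derivative_add[OF linear_imp_has_derivative[OF matrix_vector_mul_linear] has_derivative_const] by simp
  ultimately have "((\<lambda>y. (P \<circ> coords) (chart y)) has_derivative (\<lambda>h. grad (P \<circ> coords) (chart (coords x)) \<bullet> (B *v h))) (at (coords x))"
    by (rule has_derivative_compose[rotated])
  then have "(P has_derivative (\<lambda>h. grad (P \<circ> coords) x \<bullet> (B *v h))) (at (coords x))"
    by simp
  from has_derivative_imp_grad(2)[OF this, of i] show ?thesis
    by (simp add: matrix_vector_mult_basis)
qed

text \<open>The difference of both sides is orthogonal to the columns, which span the space.\<close>

lemma orthogonal_expansion:
  assumes orth: "\<And>i j. i \<noteq> j \<Longrightarrow> column i B \<bullet> column j B = 0"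
  shows "g = (\<Sum>i\<in>UNIV. ((g \<bullet> column i B) / (column i B \<bullet> column i B)) *\<^sub>R column i B)" (is "g = ?u")
proof -
  have nz: "column i B \<bullet> column i B \<noteq> 0" for i
    using conormal_B[of i "axis i 1"] by (auto simp: matrix_vector_mult_basis)
  have "(g - ?u) \<bullet> column j B = 0" for j
  proof -
    have "?u \<bullet> column j B = (\<Sum>i\<in>UNIV. if i = j then g \<bullet> column j B else 0)"
      unfolding inner_sum_left by (intro sum.cong) (auto simp: orth nz)
    then show ?thesis by (simp add: inner_diff_left)
  qed
  then have "(g - ?u) \<bullet> (B *v w) = 0" for w
    by (simp add: matrix_mult_sum inner_sum_right scalar_mult_eq_scaleR)
  from this[of "matrix_inv B *v (g - ?u)"] show ?thesis
    unfolding B_inv inner_eq_zero_iff by simp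
qed

end

context mesh
begin

lemma mu_conv: "mu T E = parallelepiped.chart (Bmat T E) (bvec T E)" if "E \<in> elems T"
  using parallelepiped.chart_def[OF element_parallelepiped[OF that]] by (simp add: fun_eq_iff mu_def)

lemma inv_mu_conv: "inv (mu T E) = parallelepiped.coords (Bmat T E) (bvec T E)" if "E \<in> elems T"
  using parallelepiped.inv_chart[OF element_parallelepiped[OF that]] mu_conv[OF that] by simp

text \<open>
  Each piece is a polynomial on the whole space. Traces and elementwise derivatives of a
  discontinuous function then become values and derivatives of polynomials, and limits disappear
  from the argument.
\<close>

definition pieces :: "(real^'d \<Rightarrow> real) \<Rightarrow> ((real^'d) set \<Rightarrow> real^'d \<Rightarrow> real) \<Rightarrow> bool" where
  "pieces f F \<longleftrightarrow> (\<forall>E\<in>elems T. real_polynomial_function (F E) \<and> (\<forall>x\<in>interior E. f x = F E x))"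

definition vpieces :: "(real^'d \<Rightarrow> real^'d) \<Rightarrow> ((real^'d) set \<Rightarrow> real^'d \<Rightarrow> real^'d) \<Rightarrow> bool" where
  "vpieces v V \<longleftrightarrow> (\<forall>i. pieces (\<lambda>x. v x $ i) (\<lambda>E x. V E x $ i))"

lemma piecesD:
  assumes "pieces f F" "E \<in> elems T"
  shows "real_polynomial_function (F E)" "\<And>x. x \<in> interior E \<Longrightarrow> f x = F E x"
  using assms by (auto simp: pieces_def)

lemma vpiecesD:
  assumes "vpieces v V" "E \<in> elems T"
  shows "real_polynomial_function (\<lambda>x. V E x $ i)" "\<And>x. x \<in> interior E \<Longrightarrow> v x = V E x"
  using assms by (auto simp: vpieces_def pieces_def vec_eq_iff)

lemma pieces_grad:
  assumes "pieces f F" shows "vpieces (grad f) (\<lambda>E. grad (F E))"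
  unfolding vpieces_def pieces_def
proof (intro allI ballI conjI)
  fix i E assume E: "E \<in> elems T"
  show "real_polynomial_function (\<lambda>x. grad (F E) x $ i)"
    by (intro polynomial_grad(3) piecesD[OF assms E])
  fix x assume x: "x \<in> interior E"
  show "grad f x $ i = grad (F E) x $ i"
    by (subst grad_cong_open(2)[OF open_interior x piecesD(2)[OF assms E] polynomial_grad(1)[OF piecesD(1)[OF assms E]]]) auto
qed

lemma trace_pieces:
  assumes "pieces f F" "E \<in> elems T" "x \<in> E" shows "elt_trace E f x = F E x"
  by (rule parallelepiped.elt_trace_eq[OF element_parallelepiped[OF assms(2)] assms(3)])
    (auto intro: piecesD[OF assms(1,2)] continuous_polynomial)

lemma trace_vpieces:
  assumes "vpieces v V" "E \<in> elems T" "x \<in> E" shows "elt_trace E v x = V E x"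
  by (rule parallelepiped.elt_trace_eq[OF element_parallelepiped[OF assms(2)] assms(3)])
    (auto intro: vpiecesD[OF assms(1,2)] continuous_vector_polynomial)

lemma face_subset_sides:
  "e \<in> faces T \<Longrightarrow> x \<in> e \<Longrightarrow> x \<in> side1 T e" "e \<in> int_faces T \<Longrightarrow> x \<in> e \<Longrightarrow> x \<in> side2 T e"
  using side1(2)[of e] side2(2)[of e] facet_of_imp_subset by auto

lemma face_traces:
  assumes "pieces f F"
  shows "e \<in> int_faces T \<Longrightarrow> x \<in> e \<Longrightarrow> jump T e f x = F (side1 T e) x - F (side2 T e) x"
    "e \<in> int_faces T \<Longrightarrow> x \<in> e \<Longrightarrow> avg T e f x = F (side1 T e) x / 2 + F (side2 T e) x / 2"
    "e \<in> faces T \<Longrightarrow> x \<in> e \<Longrightarrow> btrace T e f x = F (side1 T e) x"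
  using side1(1)[of e] side2(1)[of e] face_subset_sides[of e x] int_faceD[of e]
  by (simp_all add: jump_def avg_def btrace_def trace_pieces[OF assms])

lemma face_vtraces:
  assumes "vpieces v V"
  shows "e \<in> int_faces T \<Longrightarrow> x \<in> e \<Longrightarrow> jump T e v x = V (side1 T e) x - V (side2 T e) x"
    "e \<in> int_faces T \<Longrightarrow> x \<in> e \<Longrightarrow> avg T e v x = (1/2) *\<^sub>R V (side1 T e) x + (1/2) *\<^sub>R V (side2 T e) x"
    "e \<in> faces T \<Longrightarrow> x \<in> e \<Longrightarrow> btrace T e v x = V (side1 T e) x"
  using side1(1)[of e] side2(1)[of e] face_subset_sides[of e x] int_faceD[of e]
  by (simp_all add: jump_def avg_def btrace_def trace_vpieces[OF assms])

lemma integrable_face: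
  assumes "e \<in> faces T" "real_polynomial_function f"
  shows "integrable (face_measure e) f"
  using parallelepiped.integrable_on_facet[OF element_parallelepiped[OF side1(1)[OF assms(1)]] side1(2)[OF assms(1)] assms(2)] .

text \<open>
  On each element, \<open>(div v, q)\<close> is exchanged for \<open>(v, grad q)\<close> and
  fluxes through the faces. On an interior face with normal \<open>n\<close>, the two fluxes add
  up to \<open>v\<^sub>1 \<bullet> n q\<^sub>1 - v\<^sub>2 \<bullet> n q\<^sub>2 = [v] \<bullet>
  n {q} + {v} \<bullet> n [q]\<close>, where the first product cancels against the form
  \<open>b\<close> and the second remains. Dirichlet fluxes cancel as well, and Neumann fluxes,
  which have no counterpart in \<open>b\<close>, remain.
\<close>

lemma bform_by_parts:
  assumes V: "vpieces v V" and Q: "pieces q Q"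
  shows "bform T v q = (\<Sum>E\<in>elems T. vol_int E (\<lambda>x. V E x \<bullet> grad (Q E) x))
    - (\<Sum>e\<in>int_faces T. face_int e (\<lambda>x. (avg T e v x \<bullet> nrm T e) * jump T e q x))
    - (\<Sum>e\<in>neu_faces T. face_int e (\<lambda>x. (btrace T e v x \<bullet> nrm T e) * btrace T e q x))"
proof -
  define X where "X E e = face_int e (\<lambda>x. (V E x \<bullet> outer_normal E e) * Q E x)" for E e
  have "vol_int E (\<lambda>x. dvg v x * q x) =
      (\<Sum>e\<in>{e. e facet_of E}. X E e) - vol_int E (\<lambda>x. V E x \<bullet> grad (Q E) x)" if E: "E \<in> elems T" for E
  proof -
    interpret parallelepiped "Bmat T E" "bvec T E" E using E by (rule element_parallelepiped)
    let ?g = "\<lambda>x. (\<Sum>i\<in>UNIV. grad (\<lambda>x. V E x $ i) x $ i) * Q E x"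
    have "vol_int E (\<lambda>x. dvg v x * q x) = vol_int E ?g"
    proof (rule lebesgue_integral_cong_interior)
      show "continuous_on UNIV ?g"
        by (intro continuous_polynomial real_polynomial_function.intros(4) real_polynomial_function_sum finite
            piecesD[OF Q E] polynomial_grad(3) vpiecesD[OF V E])
      show "dvg v x * q x = ?g x" if "x \<in> interior E" for x
        by (simp add: dvg_eq[OF open_interior that vpiecesD(2)[OF V E] vpiecesD(1)[OF V E]] piecesD(2)[OF Q E that])
    qed
    then show ?thesis
      using gauss_vector[OF vpiecesD(1)[OF V E] piecesD(1)[OF Q E]] by (simp add: X_def)
  qed
  then have vol: "(\<Sum>E\<in>elems T. vol_int E (\<lambda>x. dvg v x * q x)) =
      (\<Sum>e\<in>int_faces T. X (side1 T e) e + X (side2 T e) e) + (\<Sum>e\<in>dir_faces T. X (side1 T e) e) +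
      (\<Sum>e\<in>neu_faces T. X (side1 T e) e) - (\<Sum>E\<in>elems T. vol_int E (\<lambda>x. V E x \<bullet> grad (Q E) x))"
    by (simp add: sum_subtractf sum_all_faces)
  have int: "X (side1 T e) e + X (side2 T e) e =
      face_int e (\<lambda>x. (jump T e v x \<bullet> nrm T e) * avg T e q x) +
      face_int e (\<lambda>x. (avg T e v x \<bullet> nrm T e) * jump T e q x)" if e: "e \<in> int_faces T" for e
  proof -
    let ?E = "side1 T e" and ?F = "side2 T e" and ?n = "nrm T e"
    have ef: "e \<in> faces T" using e by (rule int_faceD)
    have E: "?E \<in> elems T" "?F \<in> elems T" using e ef side1 side2 by auto
    have p: "real_polynomial_function (\<lambda>x. (V A x \<bullet> ?n) * Q C x)" if "A \<in> elems T" "C \<in> elems T" for A C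
      by (intro real_polynomial_function.intros(2,4) real_polynomial_function_inner vpiecesD[OF V] piecesD[OF Q] that)
    note i = integrable_face[OF ef p]
    have "face_int e (\<lambda>x. (jump T e v x \<bullet> ?n) * avg T e q x) + face_int e (\<lambda>x. (avg T e v x \<bullet> ?n) * jump T e q x)
      = face_int e (\<lambda>x. (V ?E x \<bullet> ?n) * Q ?E x / 2 + (V ?E x \<bullet> ?n) * Q ?F x / 2 - (V ?F x \<bullet> ?n) * Q ?E x / 2 - (V ?F x \<bullet> ?n) * Q ?F x / 2)
      + face_int e (\<lambda>x. (V ?E x \<bullet> ?n) * Q ?E x / 2 - (V ?E x \<bullet> ?n) * Q ?F x / 2 + (V ?F x \<bullet> ?n) * Q ?E x / 2 - (V ?F x \<bullet> ?n) * Q ?F x / 2)"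
      by (intro arg_cong2[of _ _ _ _ "(+)"] face_int_cong)
        (simp_all add: face_traces(1,2)[OF Q e] face_vtraces(1,2)[OF V e] inner_diff_left inner_add_left field_simps)
    also have "\<dots> = face_int e (\<lambda>x. (V ?E x \<bullet> ?n) * Q ?E x) - face_int e (\<lambda>x. (V ?F x \<bullet> ?n) * Q ?F x)"
      using i E by simp
    finally show ?thesis
      by (simp add: X_def outer_normal_sides(1) outer_normal_sides(2)[OF e])
  qed
  have bd: "X (side1 T e) e = face_int e (\<lambda>x. (btrace T e v x \<bullet> nrm T e) * btrace T e q x)"
    if "e \<in> faces T" for e
    unfolding X_def
    by (intro face_int_cong) (simp add: face_traces(3)[OF Q that] face_vtraces(3)[OF V that] outer_normal_sides)
  have "dir_faces T \<subseteq> faces T" "neu_faces T \<subseteq> faces T" using faces_partition(1) by auto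
  then have bds: "(\<Sum>e\<in>dir_faces T. X (side1 T e) e) = (\<Sum>e\<in>dir_faces T. face_int e (\<lambda>x. (btrace T e v x \<bullet> nrm T e) * btrace T e q x))"
    "(\<Sum>e\<in>neu_faces T. X (side1 T e) e) = (\<Sum>e\<in>neu_faces T. face_int e (\<lambda>x. (btrace T e v x \<bullet> nrm T e) * btrace T e q x))"
    by (intro sum.cong refl bd; blast)+
  show ?thesis
    unfolding bform_def vol bds by (simp add: int sum.distrib)
qed

end

section \<open>Moments of the reconstruction\<close>

text \<open>
  Traces are only known on the face itself. Agreeing there with a polynomial makes them
  integrable, so that face integrals may be split.
\<close>

definition poly_on :: "(real^'d::finite) set \<Rightarrow> (real^'d \<Rightarrow> real) \<Rightarrow> bool" where
  "poly_on e f \<longleftrightarrow> (\<exists>g. real_polynomial_function g \<and> (\<forall>x\<in>e. f x = g x))"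

lemma poly_onI: "real_polynomial_function g \<Longrightarrow> (\<And>x. x \<in> e \<Longrightarrow> f x = g x) \<Longrightarrow> poly_on e f"
  by (auto simp: poly_on_def)

lemma poly_on_polynomial: "real_polynomial_function f \<Longrightarrow> poly_on e f"
  by (auto simp: poly_on_def)

lemma poly_on_add: "poly_on e f \<Longrightarrow> poly_on e g \<Longrightarrow> poly_on e (\<lambda>x. f x + g x)"
  and poly_on_mult: "poly_on e f \<Longrightarrow> poly_on e g \<Longrightarrow> poly_on e (\<lambda>x. f x * g x)"
  unfolding poly_on_def using real_polynomial_function.intros(3,4) by (metis (no_types, lifting))+

lemma poly_on_cmult: "poly_on e f \<Longrightarrow> poly_on e (\<lambda>x. c * f x)"
  by (rule poly_on_mult[OF poly_on_polynomial[OF real_polynomial_function.intros(2)]])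

lemma poly_on_minus: "poly_on e f \<Longrightarrow> poly_on e (\<lambda>x. - f x)"
  using poly_on_cmult[of e f "-1"] by simp

context mesh
begin

lemma integrable_poly_on:
  assumes "e \<in> faces T" "poly_on e f" shows "integrable (face_measure e) f"
proof -
  obtain g where g: "real_polynomial_function g" "\<And>x. x \<in> e \<Longrightarrow> f x = g x"
    using assms(2) by (auto simp: poly_on_def)
  have "integrable (face_measure e) f \<longleftrightarrow> integrable (face_measure e) g"
    by (intro Bochner_Integration.integrable_cong refl) (simp add: space_face_measure g(2))
  then show ?thesis using integrable_face[OF assms(1) g(1)] by simp
qed

lemma poly_on_traces:
  assumes F: "pieces f F"
  shows "e \<in> int_faces T \<Longrightarrow> poly_on e (jump T e f)"
    "e \<in> faces T \<Longrightarrow> poly_on e (btrace T e f)"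
proof -
  show "poly_on e (jump T e f)" if e: "e \<in> int_faces T"
    by (rule poly_onI[OF _ face_traces(1)[OF F e]])
      (intro real_polynomial_function_diff piecesD[OF F] side1(1) side2(1) int_faceD e; assumption)
  show "poly_on e (btrace T e f)" if e: "e \<in> faces T"
    by (rule poly_onI[OF _ face_traces(3)[OF F e]]) (intro piecesD[OF F] side1(1) e; assumption)
qed

lemma poly_on_vtraces:
  assumes V: "vpieces v V"
  shows "e \<in> int_faces T \<Longrightarrow> poly_on e (\<lambda>x. avg T e v x \<bullet> n)"
    "e \<in> faces T \<Longrightarrow> poly_on e (\<lambda>x. btrace T e v x \<bullet> n)"
proof -
  have p: "real_polynomial_function (\<lambda>x. V E x \<bullet> n)" if "E \<in> elems T" for E
    by (intro real_polynomial_function_inner real_polynomial_function.intros(2) vpiecesD[OF V that])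
  show "poly_on e (\<lambda>x. avg T e v x \<bullet> n)" if e: "e \<in> int_faces T"
  proof (rule poly_onI)
    show "real_polynomial_function (\<lambda>x. (1/2) * (V (side1 T e) x \<bullet> n) + (1/2) * (V (side2 T e) x \<bullet> n))"
      by (intro real_polynomial_function.intros(2-4) p side1(1) side2(1) int_faceD e)
    show "avg T e v x \<bullet> n = (1/2) * (V (side1 T e) x \<bullet> n) + (1/2) * (V (side2 T e) x \<bullet> n)" if "x \<in> e" for x
      using that by (simp add: face_vtraces(2)[OF V e] inner_add_left)
  qed
  show "poly_on e (\<lambda>x. btrace T e v x \<bullet> n)" if e: "e \<in> faces T"
    by (rule poly_onI[OF p[OF side1(1)[OF e]]]) (simp add: face_vtraces(3)[OF V e])
qed

text \<open>Pieces with a degree bound, which refers to the coordinates of the reference cube.\<close>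

definition qpieces :: "nat \<Rightarrow> (real^'d \<Rightarrow> real) \<Rightarrow> ((real^'d) set \<Rightarrow> real^'d \<Rightarrow> real) \<Rightarrow> bool" where
  "qpieces m f F \<longleftrightarrow> (\<forall>E\<in>elems T. (\<exists>P\<in>polys (\<lambda>_. m). F E = P \<circ> inv (mu T E)) \<and> (\<forall>x\<in>interior E. f x = F E x))"

lemma Qh_pieces: "q \<in> Qh T m \<Longrightarrow> \<exists>F. qpieces m q F"
proof -
  assume "q \<in> Qh T m"
  then have "\<forall>E\<in>elems T. \<exists>P. P \<in> polys (\<lambda>_. m) \<and> (\<forall>x\<in>interior E. q x = (P \<circ> inv (mu T E)) x)"
    by (auto simp: Qh_def)
  from bchoice[OF this] obtain P where
    "\<forall>E\<in>elems T. P E \<in> polys (\<lambda>_. m) \<and> (\<forall>x\<in>interior E. q x = (P E \<circ> inv (mu T E)) x)" by blast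
  then show ?thesis unfolding qpieces_def by (intro exI[of _ "\<lambda>E. P E \<circ> inv (mu T E)"]) auto
qed

lemma qpieces_imp_pieces:
  assumes "qpieces m f F" shows "pieces f F"
  unfolding pieces_def
proof (intro ballI conjI)
  fix E assume E: "E \<in> elems T"
  then obtain P where "P \<in> polys (\<lambda>_. m)" "F E = P \<circ> inv (mu T E)"
    using assms by (auto simp: qpieces_def)
  then show "real_polynomial_function (F E)"
    using parallelepiped.polynomial_coords[OF element_parallelepiped[OF E] polys_imp_polynomial] by (simp add: inv_mu_conv[OF E])
  fix x assume "x \<in> interior E"
  then show "f x = F E x" using assms E by (auto simp: qpieces_def)
qed

text \<open>
  The Piola transformation mixes the components, so the bounds \<open>k +
  \<delta>\<^sub>i\<^sub>j\<close> are weakened to \<open>k + 1\<close> in every variable; this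
  is the bound of the velocity space.
\<close>

lemma RTh_pieces:
  assumes "g \<in> RTh T k"
  shows "\<exists>G. \<forall>i. qpieces (k + 1) (\<lambda>x. g x $ i) (\<lambda>E x. G E x $ i)"
proof -
  have "\<forall>E\<in>elems T. \<exists>vh. (\<forall>i. (\<lambda>x. vh x $ i) \<in> polys (\<lambda>j. k + (if i = j then 1 else 0))) \<and>
      (\<forall>x\<in>interior E. g x = piola T E vh x)"
    using assms unfolding RTh_def RT_loc_def by blast
  from bchoice[OF this] obtain vh where
    vh: "\<And>E i. E \<in> elems T \<Longrightarrow> (\<lambda>x. vh E x $ i) \<in> polys (\<lambda>j. k + (if i = j then 1 else 0))"
    and g: "\<And>E x. E \<in> elems T \<Longrightarrow> x \<in> interior E \<Longrightarrow> g x = piola T E (vh E) x"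
    by blast
  have "qpieces (k + 1) (\<lambda>x. g x $ i) (\<lambda>E x. piola T E (vh E) x $ i)" for i
    unfolding qpieces_def
  proof (intro ballI conjI)
    fix E assume E: "E \<in> elems T"
    let ?P = "\<lambda>y. \<Sum>j\<in>UNIV. (Bmat T E $ i $ j / \<bar>det (Bmat T E)\<bar>) * vh E y $ j"
    have "?P \<in> polys (\<lambda>_. k + 1)"
      by (intro polys_sum polys_cmult polys_mono[OF vh[OF E]]) simp
    moreover have "(\<lambda>x. piola T E (vh E) x $ i) = ?P \<circ> inv (mu T E)"
      by (simp add: fun_eq_iff piola_def matrix_vector_mult_def sum_divide_distrib)
    ultimately show "\<exists>P\<in>polys (\<lambda>_. k + 1). (\<lambda>x. piola T E (vh E) x $ i) = P \<circ> inv (mu T E)" by blast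
  qed (simp add: g)
  then show ?thesis by (intro exI[of _ "\<lambda>E. piola T E (vh E)"] allI)
qed

text \<open>
  The face is the image of a reference face under the map of this element. The traces from the
  two sides enter the face space through their own elements, each with its own parametrisation of
  the face.
\<close>

lemma piece_in_Qface:
  assumes "qpieces k q Q" "E \<in> elems T" "e facet_of E"
  shows "Q E \<in> Qface T k e"
proof -
  interpret parallelepiped "Bmat T E" "bvec T E" E using assms(2) by (rule element_parallelepiped)
  obtain P where P: "P \<in> polys (\<lambda>_. k)" "Q E = P \<circ> coords"
    using assms(1,2) inv_mu_conv[OF assms(2)] by (auto simp: qpieces_def)
  obtain i s where s: "s \<in> {0, 1}" "e = face i s" using assms(3) facet_of_E_iff by blast
  obtain P' where P': "P' \<in> polys (\<lambda>j. if j = i then 0 else k)" "\<And>x. x \<in> ref_face i s \<Longrightarrow> P x = P' x"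
    using polys_on_face[OF P(1)] by blast
  show ?thesis
    unfolding Qface_def
  proof (intro CollectI bexI exI conjI ballI)
    show "e = mu T E ` ref_face i s" by (simp add: s face_def mu_conv[OF assms(2)])
    show "Q E (mu T E x) = P' x" if "x \<in> ref_face i s" for x
      using P'(2)[OF that] by (simp add: P mu_conv[OF assms(2)])
  qed (use s P' assms in auto)
qed

text \<open>
  If the columns \<open>b\<^sub>i\<close> of the matrix are orthogonal, a gradient is the sum of
  its components along them, \<open>(grad q \<bullet> b\<^sub>i) / (b\<^sub>i \<bullet>
  b\<^sub>i)\<close> times \<open>b\<^sub>i\<close>, and \<open>grad q \<bullet>
  b\<^sub>i\<close> is the \<open>i\<close>-th partial derivative in the reference coordinates.
  Up to a constant factor in each component, the inverse Piola transformation therefore maps the gradient to the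
  reference gradient, which has the degrees required in \<open>Psi_loc\<close>.
\<close>

lemma grad_piece_in_Psi:
  assumes "rectangular T" "qpieces k q Q" "E \<in> elems T"
  shows "grad (Q E) \<in> Psi_loc T k E"
proof -
  interpret parallelepiped "Bmat T E" "bvec T E" E using assms(3) by (rule element_parallelepiped)
  obtain P where P: "P \<in> polys (\<lambda>_. k)" "Q E = P \<circ> coords"
    using assms(2,3) inv_mu_conv[OF assms(3)] by (auto simp: qpieces_def)
  let ?c = "\<lambda>i. column i (Bmat T E)" and ?D = "\<bar>det (Bmat T E)\<bar>"
  define vh where "vh y = (\<chi> i. (?D / (?c i \<bullet> ?c i)) * grad P y $ i)" for y
  have orth: "?c i \<bullet> ?c j = 0" if "i \<noteq> j" for i j
    using assms(1,3) that by (auto simp: rectangular_def)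
  have "grad (Q E) x = piola T E vh x" for x
  proof -
    have "piola T E vh x = (\<Sum>i\<in>UNIV. ((grad (P \<circ> coords) x \<bullet> ?c i) / (?c i \<bullet> ?c i)) *\<^sub>R ?c i)"
      using det_B
      by (simp add: piola_def inv_mu_conv[OF assms(3)] vh_def matrix_mult_sum scaleR_sum_right scalar_mult_eq_scaleR
          grad_comp_coords[OF P(1)])
    then show ?thesis using orthogonal_expansion[OF orth, of "grad (P \<circ> coords) x"] by (simp add: P(2))
  qed
  moreover have "(\<lambda>x. vh x $ i) \<in> polys (\<lambda>j. k - (if i = j then 1 else 0))" for i
  proof -
    have "(\<lambda>x. grad P x $ i) \<in> polys (\<lambda>j. k - (if i = j then 1 else 0))"
      by (rule polys_mono[OF polys_grad[OF P(1)]]) auto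
    from polys_cmult[OF this, of "?D / (?c i \<bullet> ?c i)"] show ?thesis by (simp add: vh_def)
  qed
  ultimately show ?thesis unfolding Psi_loc_def by (intro CollectI exI[of _ vh]) (auto simp: fun_eq_iff)
qed

lemma grad_piece_degree_0:
  assumes "qpieces 0 q Q" "E \<in> elems T"
  shows "grad (Q E) x = 0"
proof -
  obtain c where "Q E = (\<lambda>_. c)"
    using assms polys_degree_0 by (fastforce simp: qpieces_def)
  then show ?thesis by (simp add: grad_def vec_eq_iff)
qed

context
  fixes k :: nat and \<psi> q :: "real^'d \<Rightarrow> real" and \<gamma> :: "real^'d \<Rightarrow> real^'d" and \<Psi> Q \<Gamma>
  assumes Gh: "is_Gh T k \<psi> \<gamma>" and rect: "k > 0 \<Longrightarrow> rectangular T"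
    and \<Psi>: "qpieces k \<psi> \<Psi>" and Q: "qpieces k q Q" and \<Gamma>: "vpieces \<gamma> \<Gamma>"
begin

lemmas p\<Psi> = qpieces_imp_pieces[OF \<Psi>] and pQ = qpieces_imp_pieces[OF Q]

text \<open>
  The moments are applied to the two one-sided traces of \<open>q\<close> separately and then
  subtracted, because it is these traces that are known to lie in the face space.
\<close>

lemma flux_int:
  assumes e: "e \<in> int_faces T"
  shows "face_int e (\<lambda>x. (avg T e \<gamma> x \<bullet> nrm T e) * jump T e q x) =
    - face_int e (\<lambda>x. (avg T e (grad \<psi>) x \<bullet> nrm T e) * jump T e q x)
    + penalty T / hface T e * face_int e (\<lambda>x. jump T e q x * jump T e \<psi> x)"
proof -
  have ef: "e \<in> faces T" using e by (rule int_faceD)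
  let ?c = "penalty T / hface T e"
  let ?A = "\<lambda>x. avg T e \<gamma> x \<bullet> nrm T e" and ?G = "\<lambda>x. avg T e (grad \<psi>) x \<bullet> nrm T e" and ?J = "jump T e \<psi>"
  let ?R = "\<lambda>x. - ?G x + ?c * ?J x"
  let ?Q1 = "Q (side1 T e)" and ?Q2 = "Q (side2 T e)"
  have E: "side1 T e \<in> elems T" "e facet_of side1 T e" "side2 T e \<in> elems T" "e facet_of side2 T e"
    using side1[OF ef] side2[OF e] by auto
  have pA: "poly_on e ?A" and pG: "poly_on e ?G" and pJ: "poly_on e ?J"
    by (intro poly_on_vtraces(1)[OF \<Gamma>] poly_on_vtraces(1)[OF pieces_grad[OF p\<Psi>]] poly_on_traces(1)[OF p\<Psi>] e)+
  have pR: "poly_on e ?R" by (intro poly_on_add poly_on_minus poly_on_cmult pG pJ)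
  have p12: "poly_on e ?Q1" "poly_on e ?Q2"
    by (intro poly_on_polynomial piecesD[OF pQ] E)+
  have pq: "poly_on e (jump T e q)" by (intro poly_on_traces(1)[OF pQ] e)
  note int = integrable_poly_on[OF ef poly_on_mult]
  have split: "face_int e (\<lambda>x. f x * jump T e q x) = face_int e (\<lambda>x. f x * ?Q1 x) - face_int e (\<lambda>x. f x * ?Q2 x)"
    if "poly_on e f" for f
  proof -
    have "face_int e (\<lambda>x. f x * jump T e q x) = face_int e (\<lambda>x. f x * ?Q1 x - f x * ?Q2 x)"
      by (intro face_int_cong) (simp add: face_traces(1)[OF pQ e] right_diff_distrib)
    then show ?thesis using int[OF that p12(1)] int[OF that p12(2)] by simp
  qed
  have "face_int e (\<lambda>x. ?A x * jump T e q x) = face_int e (\<lambda>x. ?A x * ?Q1 x) - face_int e (\<lambda>x. ?A x * ?Q2 x)"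
    by (rule split[OF pA])
  also have "\<dots> = face_int e (\<lambda>x. ?R x * ?Q1 x) - face_int e (\<lambda>x. ?R x * ?Q2 x)"
    using Gh e piece_in_Qface[OF Q E(1,2)] piece_in_Qface[OF Q E(3,4)] unfolding is_Gh_def by simp
  also have "\<dots> = face_int e (\<lambda>x. ?R x * jump T e q x)"
    by (rule split[OF pR, symmetric])
  also have "\<dots> = face_int e (\<lambda>x. - (?G x * jump T e q x) + ?c * (jump T e q x * ?J x))"
    by (simp add: algebra_simps)
  also have "\<dots> = face_int e (\<lambda>x. - (?G x * jump T e q x)) + face_int e (\<lambda>x. ?c * (jump T e q x * ?J x))"
    by (intro Bochner_Integration.integral_add integrable_poly_on[OF ef] poly_on_minus poly_on_cmult poly_on_mult pG pq pJ)
  finally show ?thesis by simp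
qed

lemma flux_neu:
  assumes e: "e \<in> neu_faces T"
  shows "face_int e (\<lambda>x. (btrace T e \<gamma> x \<bullet> nrm T e) * btrace T e q x) =
    - face_int e (\<lambda>x. (btrace T e (grad \<psi>) x \<bullet> nrm T e) * btrace T e q x)
    + penalty T / hface T e * face_int e (\<lambda>x. btrace T e q x * btrace T e \<psi> x)"
proof -
  have ef: "e \<in> faces T" using e by (simp add: neu_faces_def)
  let ?c = "penalty T / hface T e"
  let ?A = "\<lambda>x. btrace T e \<gamma> x \<bullet> nrm T e" and ?G = "\<lambda>x. btrace T e (grad \<psi>) x \<bullet> nrm T e" and ?J = "btrace T e \<psi>"
  let ?R = "\<lambda>x. - ?G x + ?c * ?J x"
  let ?Q1 = "Q (side1 T e)"
  have pG: "poly_on e ?G" and pJ: "poly_on e ?J" and pq: "poly_on e (btrace T e q)"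
    by (intro poly_on_vtraces(2)[OF pieces_grad[OF p\<Psi>]] poly_on_traces(2)[OF p\<Psi>] poly_on_traces(2)[OF pQ] ef)+
  have tr: "face_int e (\<lambda>x. f x * btrace T e q x) = face_int e (\<lambda>x. f x * ?Q1 x)" for f
    by (intro face_int_cong) (simp add: face_traces(3)[OF pQ ef])
  have "face_int e (\<lambda>x. ?A x * btrace T e q x) = face_int e (\<lambda>x. ?R x * btrace T e q x)"
    unfolding tr using Gh e piece_in_Qface[OF Q side1[OF ef]] unfolding is_Gh_def by simp
  also have "\<dots> = face_int e (\<lambda>x. - (?G x * btrace T e q x) + ?c * (btrace T e q x * ?J x))"
    by (simp add: algebra_simps)
  also have "\<dots> = face_int e (\<lambda>x. - (?G x * btrace T e q x)) + face_int e (\<lambda>x. ?c * (btrace T e q x * ?J x))"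
    by (intro Bochner_Integration.integral_add integrable_poly_on[OF ef] poly_on_minus poly_on_cmult poly_on_mult pG pq pJ)
  finally show ?thesis by simp
qed

text \<open>
  For \<open>k > 0\<close> this is the volume moment of the reconstruction with \<open>r = grad
  q\<close>. For \<open>k = 0\<close> the function \<open>q\<close> is constant on
  \<open>E\<close> and everything vanishes.
\<close>

lemma volume_moment:
  assumes E: "E \<in> elems T"
  shows "vol_int E (\<lambda>x. \<Gamma> E x \<bullet> grad (Q E) x) = - vol_int E (\<lambda>x. grad (\<Psi> E) x \<bullet> grad (Q E) x)
    + (\<Sum>e\<in>{e\<in>int_faces T. e facet_of E}. (1/2) * face_int e (\<lambda>x. (grad (Q E) x \<bullet> nrm T e) * jump T e \<psi> x))
    + (\<Sum>e\<in>{e\<in>neu_faces T. e facet_of E}. face_int e (\<lambda>x. (grad (Q E) x \<bullet> nrm T e) * btrace T e \<psi> x))"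
proof (cases "k > 0")
  case False
  then show ?thesis using grad_piece_degree_0[OF _ E, of q Q] Q by simp
next
  case True
  interpret parallelepiped "Bmat T E" "bvec T E" E using E by (rule element_parallelepiped)
  have pg: "real_polynomial_function (\<lambda>x. grad (Q E) x $ i)" for i
    by (intro polynomial_grad(3) piecesD[OF pQ E])
  have c: "vol_int E (\<lambda>x. f x \<bullet> grad (Q E) x) = vol_int E (\<lambda>x. F E x \<bullet> grad (Q E) x)" if F: "vpieces f F" for f F
    by (rule lebesgue_integral_cong_interior)
      (simp_all add: vpiecesD(2)[OF F E] continuous_polynomial real_polynomial_function_inner vpiecesD(1)[OF F E] pg)
  have "vol_int E (\<lambda>x. \<gamma> x \<bullet> grad (Q E) x) = - vol_int E (\<lambda>x. grad \<psi> x \<bullet> grad (Q E) x)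
    + (1/2) * (\<Sum>e\<in>{e\<in>int_faces T. e facet_of E}. face_int e (\<lambda>x. (grad (Q E) x \<bullet> nrm T e) * jump T e \<psi> x))
    + (\<Sum>e\<in>{e\<in>neu_faces T. e facet_of E}. face_int e (\<lambda>x. (grad (Q E) x \<bullet> nrm T e) * btrace T e \<psi> x))"
    using Gh True E grad_piece_in_Psi[OF rect[OF True] Q E] unfolding is_Gh_def by blast
  then show ?thesis
    unfolding c[OF \<Gamma>] c[OF pieces_grad[OF p\<Psi>]] by (simp add: sum_distrib_left)
qed

text \<open>
  After integration by parts, \<open>b(\<gamma>, q)\<close> and \<open>b(grad \<psi>, q)\<close>
  are sums of moments of \<open>\<gamma>\<close> and \<open>grad \<psi>\<close> with the same
  functions. Inserting the prescribed moments of \<open>\<gamma>\<close> gives \<open>- b(grad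
  \<psi>, q)\<close> together with the terms in the traces of \<open>\<psi>\<close>, which are
  those of \<open>- j\<^sub>0(\<psi>, q)\<close>.
\<close>

lemma bform_reconstruction: "bform T \<gamma> q = - alpha T \<psi> q"
proof -
  let ?n = "nrm T"
  have gQ: "vpieces (grad q) (\<lambda>E. grad (Q E))" and g\<Psi>: "vpieces (grad \<psi>) (\<lambda>E. grad (\<Psi> E))"
    by (intro pieces_grad p\<Psi> pQ)+
  have int: "(1/2) * face_int e (\<lambda>x. (grad (Q (side1 T e)) x \<bullet> ?n e) * jump T e \<psi> x)
      + (1/2) * face_int e (\<lambda>x. (grad (Q (side2 T e)) x \<bullet> ?n e) * jump T e \<psi> x)
    = face_int e (\<lambda>x. (avg T e (grad q) x \<bullet> ?n e) * jump T e \<psi> x)" if e: "e \<in> int_faces T" for e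
  proof -
    have p: "poly_on e (\<lambda>x. (grad (Q E) x \<bullet> ?n e) * jump T e \<psi> x)" if "E \<in> elems T" for E
      by (intro poly_on_mult poly_on_polynomial real_polynomial_function_inner real_polynomial_function.intros(2)
          polynomial_grad(3) piecesD[OF pQ that] poly_on_traces(1)[OF p\<Psi> e])
    note i = integrable_poly_on[OF int_faceD[OF e] p]
    have "face_int e (\<lambda>x. (avg T e (grad q) x \<bullet> ?n e) * jump T e \<psi> x) =
      face_int e (\<lambda>x. (1/2) * ((grad (Q (side1 T e)) x \<bullet> ?n e) * jump T e \<psi> x)
        + (1/2) * ((grad (Q (side2 T e)) x \<bullet> ?n e) * jump T e \<psi> x))"
      by (intro face_int_cong) (simp add: face_vtraces(2)[OF gQ e] inner_add_left algebra_simps)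
    also have "\<dots> = (1/2) * face_int e (\<lambda>x. (grad (Q (side1 T e)) x \<bullet> ?n e) * jump T e \<psi> x)
      + (1/2) * face_int e (\<lambda>x. (grad (Q (side2 T e)) x \<bullet> ?n e) * jump T e \<psi> x)"
      using i[OF side1(1)[OF int_faceD[OF e]]] i[OF side2(1)[OF e]]
      by (subst Bochner_Integration.integral_add) simp_all
    finally show ?thesis ..
  qed
  have neu: "face_int e (\<lambda>x. (grad (Q (side1 T e)) x \<bullet> ?n e) * btrace T e \<psi> x) =
      face_int e (\<lambda>x. (btrace T e (grad q) x \<bullet> ?n e) * btrace T e \<psi> x)" if "e \<in> neu_faces T" for e
    using that by (intro face_int_cong) (simp add: face_vtraces(3)[OF gQ] neu_faces_def)
  have vol: "(\<Sum>E\<in>elems T. vol_int E (\<lambda>x. \<Gamma> E x \<bullet> grad (Q E) x)) =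
      - (\<Sum>E\<in>elems T. vol_int E (\<lambda>x. grad (\<Psi> E) x \<bullet> grad (Q E) x))
      + (\<Sum>e\<in>int_faces T. face_int e (\<lambda>x. (avg T e (grad q) x \<bullet> ?n e) * jump T e \<psi> x))
      + (\<Sum>e\<in>neu_faces T. face_int e (\<lambda>x. (btrace T e (grad q) x \<bullet> ?n e) * btrace T e \<psi> x))"
    by (subst sum.cong[OF refl volume_moment], assumption)
      (unfold sum.distrib sum_negf, unfold sum_int_faces sum_boundary_faces[OF disjI2[OF refl]],
       intro arg_cong2[of _ _ _ _ "(+)"] sum.cong refl int neu)
  show ?thesis
    unfolding alpha_def j0form_def bform_by_parts[OF \<Gamma> pQ] bform_by_parts[OF g\<Psi> pQ] vol
    by (simp add: flux_int flux_neu sum.distrib sum_negf sum_subtractf cong: sum.cong)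
qed

end

section \<open>The effect of the projection on the form b\<close>

lemma qpieces_imp_poly:
  assumes "qpieces m f F" "E \<in> elems T"
  obtains P where "P \<in> polys (\<lambda>_. m)" "F E = P \<circ> inv (mu T E)"
  using assms by (auto simp: qpieces_def)

text \<open>
  The sum is only required inside the elements, where derivatives and traces are determined; the
  integrated form of \<open>b\<close> depends on the functions through nothing else.
\<close>

lemma bform_add:
  assumes W: "vpieces w W" and G: "vpieces g G" and V: "vpieces v (\<lambda>E x. W E x + G E x)" and Q: "pieces q Q"
  shows "bform T v q = bform T w q + bform T g q"
proof -
  have vol: "vol_int E (\<lambda>x. (W E x + G E x) \<bullet> grad (Q E) x) =
      vol_int E (\<lambda>x. W E x \<bullet> grad (Q E) x) + vol_int E (\<lambda>x. G E x \<bullet> grad (Q E) x)" if E: "E \<in> elems T" for E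
  proof -
    have "real_polynomial_function (\<lambda>x. W E x \<bullet> grad (Q E) x)" "real_polynomial_function (\<lambda>x. G E x \<bullet> grad (Q E) x)"
      by (intro real_polynomial_function_inner polynomial_grad(3) vpiecesD[OF W E] vpiecesD[OF G E] piecesD[OF Q E])+
    note this[THEN parallelepiped.set_integrable_polynomial[OF element_parallelepiped[OF E]]]
    from set_integral_add(2)[OF this] show ?thesis by (simp add: inner_add_left)
  qed
  have int: "face_int e (\<lambda>x. (avg T e v x \<bullet> nrm T e) * jump T e q x) =
      face_int e (\<lambda>x. (avg T e w x \<bullet> nrm T e) * jump T e q x) + face_int e (\<lambda>x. (avg T e g x \<bullet> nrm T e) * jump T e q x)"
    if e: "e \<in> int_faces T" for e
  proof -
    have "face_int e (\<lambda>x. (avg T e v x \<bullet> nrm T e) * jump T e q x) =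
      face_int e (\<lambda>x. (avg T e w x \<bullet> nrm T e) * jump T e q x + (avg T e g x \<bullet> nrm T e) * jump T e q x)"
      by (intro face_int_cong)
        (simp add: face_vtraces(2)[OF V e] face_vtraces(2)[OF W e] face_vtraces(2)[OF G e] inner_simps algebra_simps)
    then show ?thesis
      by (simp add: integrable_poly_on[OF int_faceD[OF e]] poly_on_mult poly_on_vtraces(1)[OF W e] poly_on_vtraces(1)[OF G e]
          poly_on_traces(1)[OF Q e])
  qed
  have neu: "face_int e (\<lambda>x. (btrace T e v x \<bullet> nrm T e) * btrace T e q x) =
      face_int e (\<lambda>x. (btrace T e w x \<bullet> nrm T e) * btrace T e q x) + face_int e (\<lambda>x. (btrace T e g x \<bullet> nrm T e) * btrace T e q x)"
    if "e \<in> neu_faces T" for e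
  proof -
    have e: "e \<in> faces T" using that by (simp add: neu_faces_def)
    have "face_int e (\<lambda>x. (btrace T e v x \<bullet> nrm T e) * btrace T e q x) =
      face_int e (\<lambda>x. (btrace T e w x \<bullet> nrm T e) * btrace T e q x + (btrace T e g x \<bullet> nrm T e) * btrace T e q x)"
      by (intro face_int_cong)
        (simp add: face_vtraces(3)[OF V e] face_vtraces(3)[OF W e] face_vtraces(3)[OF G e] inner_simps algebra_simps)
    then show ?thesis
      by (simp add: integrable_poly_on[OF e] poly_on_mult poly_on_vtraces(2)[OF W e] poly_on_vtraces(2)[OF G e]
          poly_on_traces(2)[OF Q e])
  qed
  show ?thesis
    unfolding bform_by_parts[OF V Q] bform_by_parts[OF W Q] bform_by_parts[OF G Q]
    by (simp add: vol int neu sum.distrib cong: sum.cong)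
qed

text \<open>
  Extension by zero from one element stays in the discontinuous space, which makes the
  \<open>L\<^sup>2\<close> projection local.
\<close>

lemma cutoff_in_Qh:
  assumes E: "E \<in> elems T" and P: "P \<in> polys (\<lambda>_. m)"
  shows "(\<lambda>x. indicator (interior E) x * P (inv (mu T E) x)) \<in> Qh T m" (is "?f \<in> _")
proof -
  interpret parallelepiped "Bmat T E" "bvec T E" E using E by (rule element_parallelepiped)
  let ?g = "\<lambda>x. P (inv (mu T E) x)"
  have g: "real_polynomial_function ?g"
    using polynomial_coords[OF polys_imp_polynomial[OF P]] by (simp add: inv_mu_conv[OF E] comp_def)
  note [measurable] = borel_measurable_continuous_onI[OF continuous_polynomial[OF g]]
  have [measurable]: "?f \<in> borel_measurable lebesgue"
    by (intro measurable_completion) measurable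
  have "set_integrable lebesgue E (\<lambda>x. ?g x * ?g x)"
    by (intro set_integrable_polynomial real_polynomial_function.intros(4) g)
  then have "set_integrable lebesgue (interior E) (\<lambda>x. ?g x * ?g x)"
    by (rule set_integrable_subset) (auto simp: interior_subset)
  then have "integrable lebesgue (\<lambda>x. (norm (?f x))\<^sup>2)"
    unfolding set_integrable_def
    by (rule Bochner_Integration.integrable_cong[THEN iffD1, rotated 2]) (auto simp: indicator_def power2_eq_square)
  then have "integrable lebesgue (\<lambda>x. indicator (omega T) x *\<^sub>R (norm (?f x))\<^sup>2)"
    using regular_omega(1) by (intro integrable_mult_indicator) simp_all
  then have "integrable (lebesgue_on (omega T)) (\<lambda>x. (norm (?f x))\<^sup>2)"
    using regular_omega(1) by (simp add: integrable_restrict_space)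
  moreover have "?f \<in> borel_measurable (lebesgue_on (omega T))"
    by (intro measurable_restrict_space1) measurable
  ultimately have "?f \<in> L2 (omega T)" by (simp add: L2_def)
  moreover have "\<exists>R\<in>polys (\<lambda>_. m). \<forall>x\<in>interior F. ?f x = (R \<circ> inv (mu T F)) x" if F: "F \<in> elems T" for F
  proof (cases "F = E")
    case True
    then show ?thesis using P by (intro bexI[of _ P]) auto
  next
    case False
    then have "interior F \<inter> interior E = {}" using disjoint_interiors[OF F E] by simp
    then show ?thesis by (intro bexI[of _ "\<lambda>x. 0"]) (auto simp: polys_zero indicator_def)
  qed
  ultimately show ?thesis by (simp add: Qh_def)
qed

text \<open>
  Inside an element, \<open>v - w - g\<close> is a vector of polynomials of degree at most
  \<open>p\<close> in each reference coordinate. Extended by zero, it is an admissible test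
  function, and testing with it shows that its square has integral zero over the element.
\<close>

lemma projection_pieces:
  assumes W: "\<forall>i. qpieces p (\<lambda>x. w x $ i) (\<lambda>E x. W E x $ i)"
    and G: "\<forall>i. qpieces p (\<lambda>x. g x $ i) (\<lambda>E x. G E x $ i)"
    and v: "v \<in> Xh T p"
    and proj: "\<forall>\<phi>\<in>Xh T p. (LINT x:omega T|lebesgue. v x \<bullet> \<phi> x) =
             (LINT x:omega T|lebesgue. w x \<bullet> \<phi> x) + (LINT x:omega T|lebesgue. g x \<bullet> \<phi> x)"
  shows "vpieces v (\<lambda>E x. W E x + G E x)"
proof -
  have "\<forall>i. \<exists>F. qpieces p (\<lambda>x. v x $ i) F"
    using v by (auto simp: Xh_def intro: Qh_pieces)
  then obtain V' where V': "\<And>i. qpieces p (\<lambda>x. v x $ i) (V' i)" by metis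
  define V where "V E x = (\<chi> i. V' i E x)" for E x
  have V: "\<forall>i. qpieces p (\<lambda>x. v x $ i) (\<lambda>E x. V E x $ i)" using V' by (simp add: V_def)
  have vW: "vpieces w W" and vG: "vpieces g G" and vV: "vpieces v V"
    using W G V by (auto simp: vpieces_def intro: qpieces_imp_pieces)
  have "V E x = W E x + G E x" if E: "E \<in> elems T" and x: "x \<in> interior E" for E x
  proof -
    interpret parallelepiped "Bmat T E" "bvec T E" E using E by (rule element_parallelepiped)
    define D where "D x = V E x - W E x - G E x" for x
    define \<phi> where "\<phi> x = indicator (interior E) x *\<^sub>R D x" for x
    have pD: "real_polynomial_function (\<lambda>x. D x $ i)" for i
      unfolding D_def vector_minus_component
      by (intro real_polynomial_function_diff vpiecesD[OF vV E] vpiecesD[OF vW E] vpiecesD[OF vG E])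
    have "\<phi> \<in> Xh T p"
      unfolding Xh_def
    proof (intro CollectI allI)
      fix i
      obtain PV where PV: "PV \<in> polys (\<lambda>_. p)" "(\<lambda>x. V E x $ i) = PV \<circ> inv (mu T E)"
        using V E qpieces_imp_poly by metis
      obtain PW where PW: "PW \<in> polys (\<lambda>_. p)" "(\<lambda>x. W E x $ i) = PW \<circ> inv (mu T E)"
        using W E qpieces_imp_poly by metis
      obtain PG where PG: "PG \<in> polys (\<lambda>_. p)" "(\<lambda>x. G E x $ i) = PG \<circ> inv (mu T E)"
        using G E qpieces_imp_poly by metis
      have "(\<lambda>x. indicator (interior E) x * (\<lambda>y. PV y - PW y - PG y) (inv (mu T E) x)) \<in> Qh T p"
        by (intro cutoff_in_Qh[OF E] polys_diff PV PW PG)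
      also have "(\<lambda>x. indicator (interior E) x * (\<lambda>y. PV y - PW y - PG y) (inv (mu T E) x)) = (\<lambda>x. \<phi> x $ i)"
        using PV(2) PW(2) PG(2) by (simp add: \<phi>_def D_def fun_eq_iff)
      finally show "(\<lambda>x. \<phi> x $ i) \<in> Qh T p" .
    qed
    then have test: "(LINT x:omega T|lebesgue. v x \<bullet> \<phi> x) =
        (LINT x:omega T|lebesgue. w x \<bullet> \<phi> x) + (LINT x:omega T|lebesgue. g x \<bullet> \<phi> x)"
      using proj by blast
    have loc: "(LINT x:omega T|lebesgue. f x \<bullet> \<phi> x) = vol_int E (\<lambda>x. F E x \<bullet> D x)" if F: "vpieces f F" for f F
    proof -
      have "(LINT x:omega T|lebesgue. f x \<bullet> \<phi> x) = vol_int E (\<lambda>x. f x \<bullet> \<phi> x)"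
        unfolding set_lebesgue_integral_def
      proof (intro Bochner_Integration.integral_cong refl)
        fix x show "indicator (omega T) x *\<^sub>R (f x \<bullet> \<phi> x) = indicator E x *\<^sub>R (f x \<bullet> \<phi> x)"
          using interior_subset_omega[OF E] interior_subset[of E] by (cases "x \<in> interior E") (auto simp: \<phi>_def indicator_def)
      qed
      also have "\<dots> = vol_int E (\<lambda>x. F E x \<bullet> D x)"
        by (rule lebesgue_integral_cong_interior)
          (simp_all add: \<phi>_def vpiecesD(2)[OF F E] continuous_polynomial real_polynomial_function_inner vpiecesD(1)[OF F E] pD)
      finally show ?thesis .
    qed
    note int = set_integrable_polynomial[OF real_polynomial_function_inner[OF _ pD]]
    have intD: "set_integrable lebesgue E (\<lambda>x. D x \<bullet> D x)"
      by (rule int[OF pD])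
    have "vol_int E (\<lambda>x. D x \<bullet> D x) = vol_int E (\<lambda>x. V E x \<bullet> D x - W E x \<bullet> D x - G E x \<bullet> D x)"
      by (simp add: D_def inner_diff_left)
    also have "\<dots> = vol_int E (\<lambda>x. V E x \<bullet> D x) - vol_int E (\<lambda>x. W E x \<bullet> D x) - vol_int E (\<lambda>x. G E x \<bullet> D x)"
      using int[OF vpiecesD(1)[OF vV E]] int[OF vpiecesD(1)[OF vW E]] int[OF vpiecesD(1)[OF vG E]]
      by (simp add: set_integral_diff)
    also have "\<dots> = 0" using test by (simp add: loc[OF vV] loc[OF vW] loc[OF vG])
    finally have AE: "AE x in lebesgue. indicator E x *\<^sub>R (D x \<bullet> D x) = 0"
      using intD unfolding set_lebesgue_integral_def set_integrable_def
      by (subst (asm) integral_nonneg_eq_0_iff_AE) (auto simp: indicator_def)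
    let ?U = "interior E \<inter> {x. D x \<bullet> D x \<noteq> 0}"
    have "open ?U"
      by (intro open_Int open_interior open_Collect_neq continuous_intros continuous_vector_polynomial pD)
    moreover have "AE x in lebesgue. x \<notin> ?U"
      using AE by eventually_elim (use interior_subset[of E] in \<open>auto simp: indicator_def\<close>)
    then have "negligible ?U"
      using \<open>open ?U\<close> by (simp add: negligible_iff_null_sets AE_iff_null_sets)
    ultimately have "?U = {}" using open_not_negligible by blast
    then have "D x = 0" using x by auto
    then show ?thesis by (simp add: D_def algebra_simps)
  qed
  then show ?thesis
    using vV vW vG unfolding vpieces_def pieces_def
    by (auto intro: real_polynomial_function.intros(3))
qed

end

theorem theorem2:
  fixes T :: "('d::finite) dg_data" and p :: nat
    and w v :: "real^'d \<Rightarrow> real^'d" and q :: "real^'d \<Rightarrow> real"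
  assumes dim: "CARD('d) = 2 \<or> CARD('d) = 3"
    and mesh: "affine_cuboid_mesh T"
    and rect: "p \<ge> 2 \<Longrightarrow> rectangular T"
    and data: "admissible_data T"
    and p: "p \<ge> 1"
    and penalty: "penalty T > 0" "coercive T (p - 1)"
    and w: "w \<in> Xh T p"
    and v: "is_RT_projection T p w v"
    and q: "q \<in> Mh T (p - 1)"
  shows "bform T v q = rform T q"
proof -
  interpret mesh T using mesh by unfold_locales
  obtain \<psi> \<gamma> where \<psi>: "\<psi> \<in> Mh T (p - 1)" and alpha: "alpha T \<psi> q = bform T w q - rform T q"
    and \<gamma>: "is_Gh T (p - 1) \<psi> \<gamma>" and vX: "v \<in> Xh T p"
    and proj: "\<forall>\<phi>\<in>Xh T p. (LINT x:omega T|lebesgue. v x \<bullet> \<phi> x) =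
             (LINT x:omega T|lebesgue. w x \<bullet> \<phi> x) + (LINT x:omega T|lebesgue. \<gamma> x \<bullet> \<phi> x)"
    using v q unfolding is_RT_projection_def by blast
  have "\<psi> \<in> Qh T (p - 1)" "q \<in> Qh T (p - 1)"
    using \<psi> q by (auto simp: Mh_def split: if_splits)
  then obtain \<Psi> Q where \<Psi>: "qpieces (p - 1) \<psi> \<Psi>" and Q: "qpieces (p - 1) q Q"
    using Qh_pieces by metis
  have "\<gamma> \<in> RTh T (p - 1)" using \<gamma> by (simp add: is_Gh_def)
  then obtain \<Gamma> where \<Gamma>: "\<forall>i. qpieces p (\<lambda>x. \<gamma> x $ i) (\<lambda>E x. \<Gamma> E x $ i)"
    using RTh_pieces[of \<gamma> "p - 1"] p by auto
  have "\<forall>i. \<exists>F. qpieces p (\<lambda>x. w x $ i) F"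
    using w by (auto simp: Xh_def intro: Qh_pieces)
  then obtain W' where W': "\<And>i. qpieces p (\<lambda>x. w x $ i) (W' i)" by metis
  have W: "\<forall>i. qpieces p (\<lambda>x. w x $ i) (\<lambda>E x. (\<chi> i. W' i E x) $ i)" using W' by simp
  have vp: "vpieces \<gamma> \<Gamma>" "vpieces w (\<lambda>E x. \<chi> i. W' i E x)"
    using \<Gamma> W by (auto simp: vpieces_def intro: qpieces_imp_pieces)
  have "bform T v q = bform T w q + bform T \<gamma> q"
    by (rule bform_add[OF vp(2,1) projection_pieces[OF W \<Gamma> vX proj] qpieces_imp_pieces[OF Q]])
  also have "bform T \<gamma> q = - alpha T \<psi> q"
    by (rule bform_reconstruction[OF \<gamma> _ \<Psi> Q vp(1)]) (use rect in auto)
  finally show ?thesis by (simp add: alpha)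
qed

end
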